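(* Let $N\ge2$. For $\times\in\{\emptyset,*,+\}$ let $L_\times$ be the operator on $\mathscr{O}(S_\times^{N-1})$ acting on the subspace $D_s^\times$ as multiplication by $\lambda_s^\times=-(q_s^\times)'(1)$, $s=0,1,2,\ldots$, and let $m_s^\times=\dim D_s^\times$. Define the spectral dimension $d_L$ of $S_\times^{N-1}$ with respect to $L_\times$ as the infimum of all $d>0$ such that $\sum_{s\ge1}m_s^\times(-\lambda_s^\times)^{-d/2}<\infty$ (with $d_L=+\infty$ if there is no such $d$). Then: (a) for the classical sphere $S^{N-1}$, $d_L=N-1$; (b) for the half-liberated sphere $S_*^{N-1}$, $d_L=2(N-1)$; (c) for the free sphere $S_+^{N-1}$, $d_L=2$ if $N=2$, and $d_L=+\infty$ if $N\ge3$.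
   Context: $O_N^+$ is the free orthogonal quantum group: $\mathscr{O}(O_N^+)$ is the universal unital $*$-algebra generated by self-adjoint $u_{ij}$ ($1\le i,j\le N$) with $u=(u_{ij})$ satisfying $uu^t=u^tu=1$, with $\Delta(u_{ij})=\sum_k u_{ik}\otimes u_{kj}$. The half-liberated $O_N^*$ is obtained by adding the relations $abc=cba$ for all $a,b,c\in\{u_{ij}\}$, and the classical $O_N=O_N^\emptyset$ by requiring the $u_{ij}$ to commute. $h$ denotes the Haar state. $\mathscr{O}(S_\times^{N-1})$ is the unital $*$-subalgebra of $\mathscr{O}(O_N^\times)$ generated by $x_i=u_{1i}$, $i=1,\ldots,N$. With inner product $\langle a,b\rangle=h(a^*b)$, put $H_k=\mathrm{span}\{x_{i_1}\cdots x_{i_r}:r\le k\}$ and $D_k^\times=H_k\cap H_{k-1}^\perp$ ($D_0^\times=\mathbb{C}1$), so $\mathscr{O}(S_\times^{N-1})=\bigoplus_kD_k^\times$. $q_s^\times$ denotes the polynomial of degree $s$ with $q_s^\times(1)=1$ such that $(q_s^\times)_{s\ge0}$ is orthogonal with respect to the distribution of $u_{11}$ in the Haar state, i.e. the probability measure $\mu_\times$ on $[-1,1]$ with $h(p(u_{11}))=\int p\,\mathrm{d}\mu_\times$ for all polynomials $p$. *)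

theory Defs
  imports "HOL-Probability.Probability" "HOL-Library.Poly_Mapping"
    "HOL-Computational_Algebra.Polynomial"
begin

section \<open>Unital complex algebras\<close>

(* The axiom 0 \<noteq> 1 is not part of the class: whether an algebra presented by generators and
   relations is nonzero is a theorem, not part of its construction. *)
class complex_algebra = ring + monoid_mult +
  fixes scaleC :: "complex \<Rightarrow> 'a \<Rightarrow> 'a" (infixr \<open>*\<^sub>C\<close> 75)
  assumes scaleC_add_right: "c *\<^sub>C (a + b) = c *\<^sub>C a + c *\<^sub>C b"
    and scaleC_add_left: "(c + d) *\<^sub>C a = c *\<^sub>C a + d *\<^sub>C a"
    and scaleC_scaleC: "c *\<^sub>C (d *\<^sub>C a) = (c * d) *\<^sub>C a"
    and scaleC_one: "1 *\<^sub>C a = a"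
    and mult_scaleC_left: "(c *\<^sub>C a) * b = c *\<^sub>C (a * b)"
    and mult_scaleC_right: "a * (c *\<^sub>C b) = c *\<^sub>C (a * b)"

global_interpretation cvec: vector_space "scaleC :: complex \<Rightarrow> 'a \<Rightarrow> 'a::complex_algebra"
  defines cspan = cvec.span and cdim = cvec.dim
  by unfold_locales
    (simp_all add: scaleC_add_right scaleC_add_left scaleC_scaleC scaleC_one)

definition clinear_functional :: "('a::complex_algebra \<Rightarrow> complex) \<Rightarrow> bool" where
  "clinear_functional h \<longleftrightarrow>
     (\<forall>a b. h (a + b) = h a + h b) \<and> (\<forall>c a. h (c *\<^sub>C a) = c * h a)"

definition eval_poly :: "complex poly \<Rightarrow> 'a::complex_algebra \<Rightarrow> 'a" where
  "eval_poly p a = (\<Sum>i\<le>degree p. coeff p i *\<^sub>C a ^ i)"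


section \<open>The free unital *-algebra on self-adjoint generators\<close>

(* Lists form the free monoid, so that 'x list \<Rightarrow>\<^sub>0 complex is the free unital algebra on 'x. *)
instantiation list :: (type) monoid_add
begin
definition zero_list :: "'a list" where "zero_list = []"
definition plus_list :: "'a list \<Rightarrow> 'a list \<Rightarrow> 'a list" where "plus_list = (@)"
instance by standard (simp_all add: zero_list_def plus_list_def)
end

type_synonym 'x free_algebra = "'x list \<Rightarrow>\<^sub>0 complex"

definition free_gen :: "'x \<Rightarrow> 'x free_algebra" where
  "free_gen x = Poly_Mapping.single [x] 1"

definition free_const :: "complex \<Rightarrow> 'x free_algebra" where
  "free_const c = Poly_Mapping.single [] c"

lift_definition free_star :: "'x free_algebra \<Rightarrow> 'x free_algebra"
  is "\<lambda>p w. cnj (p (rev w))"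
proof -
  fix p :: "'x list \<Rightarrow> complex"
  assume "finite {w. p w \<noteq> 0}"
  then have "finite (rev ` {w. p w \<noteq> 0})" by simp
  moreover have "{w. cnj (p (rev w)) \<noteq> 0} \<subseteq> rev ` {w. p w \<noteq> 0}"
    by (auto intro: image_eqI[where x = "rev _"])
  ultimately show "finite {w. cnj (p (rev w)) \<noteq> 0}" by (rule rev_finite_subset)
qed

definition free_eval :: "('x \<Rightarrow> 'b::complex_algebra) \<Rightarrow> 'x free_algebra \<Rightarrow> 'b" where
  "free_eval g p = (\<Sum>w\<in>Poly_Mapping.keys p. Poly_Mapping.lookup p w *\<^sub>C prod_list (map g w))"

lemma free_induct [case_names zero add]:
  fixes p :: "'x free_algebra"
  assumes z: "P 0" and a: "\<And>w c q. P q \<Longrightarrow> P (Poly_Mapping.single w c + q)"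
  shows "P p"
proof (induction p rule: Poly_Mapping.update_induct)
  case const
  show ?case by (rule z)
next
  case (update q w c)
  have "Poly_Mapping.update w c q = Poly_Mapping.single w c + q"
    using update(1)
    by (intro poly_mapping_eqI)
      (auto simp: lookup_update lookup_add lookup_single in_keys_iff when_def)
  then show ?case using a[OF update(3)] by simp
qed

lemma free_star_add: "free_star (p + q) = free_star p + free_star q"
  by transfer auto

lemma free_star_zero: "free_star 0 = 0"
  by transfer auto

lemma free_star_diff: "free_star (p - q) = free_star p - free_star q"
  by transfer auto

lemma free_star_sum: "free_star (\<Sum>i\<in>A. f i) = (\<Sum>i\<in>A. free_star (f i))"
  by (induction A rule: infinite_finite_induct) (simp_all add: free_star_add free_star_zero)

lemma free_star_single: "free_star (Poly_Mapping.single w c) = Poly_Mapping.single (rev w) (cnj c)"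
  by transfer (auto simp: when_def fun_eq_iff)

lemma free_star_mult: "free_star (p * q) = free_star q * free_star p"
proof -
  have s: "free_star (Poly_Mapping.single w c * q) = free_star q * free_star (Poly_Mapping.single w c)"
    for w c and q :: "'a free_algebra"
    by (induction q rule: free_induct)
      (simp_all add: free_star_zero free_star_add distrib_left distrib_right mult_single
        free_star_single plus_list_def mult.commute)
  show ?thesis
    by (induction p rule: free_induct)
      (simp_all add: free_star_zero free_star_add distrib_left distrib_right s)
qed

lemma free_star_gen: "free_star (free_gen x) = free_gen x"
  by (simp add: free_gen_def free_star_single)

lemma free_star_const: "free_star (free_const c) = free_const (cnj c)"
  by (simp add: free_const_def free_star_single)

lemma const_central: "free_const c * p = p * free_const c"
  by (induction p rule: free_induct)
    (simp_all add: distrib_left distrib_right free_const_def mult_single plus_list_def mult.commute)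

lemma const_left_commute: "a * (free_const c * b) = free_const c * (a * b)"
  by (simp only: mult.assoc[symmetric] const_central[of c a])

lemma const_add: "free_const (c + d) = free_const c + free_const d"
  by (simp add: free_const_def single_add)

lemma const_mult: "free_const (c * d) = free_const c * free_const d"
  by (simp add: free_const_def mult_single plus_list_def)

lemma const_one: "free_const 1 = 1"
  using single_one[where 'a = "'x list" and 'b = complex]
  by (simp add: free_const_def zero_list_def)

lemma free_eval_superset:
  assumes "finite A" "Poly_Mapping.keys p \<subseteq> A"
  shows "free_eval g p = (\<Sum>w\<in>A. Poly_Mapping.lookup p w *\<^sub>C prod_list (map g w))"
  unfolding free_eval_def
  by (rule sum.mono_neutral_left[OF assms]) (simp add: in_keys_iff)

lemma free_eval_add: "free_eval g (p + q) = free_eval g p + free_eval g q"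
proof -
  let ?A = "Poly_Mapping.keys p \<union> Poly_Mapping.keys q"
  have "Poly_Mapping.keys (p + q) \<subseteq> ?A" by (rule Poly_Mapping.keys_add)
  then show ?thesis
    by (simp add: free_eval_superset[of ?A] lookup_add scaleC_add_left sum.distrib)
qed

lemma free_eval_zero: "free_eval g 0 = 0"
  by (simp add: free_eval_def)

lemma free_eval_single: "free_eval g (Poly_Mapping.single w c) = c *\<^sub>C prod_list (map g w)"
  by (subst free_eval_superset[of "{w}"]) auto

lemma free_eval_mult:
  fixes p q :: "'x free_algebra" and g :: "'x \<Rightarrow> 'b::complex_algebra"
  shows "free_eval g (p * q) = free_eval g p * free_eval g q"
proof -
  have s: "free_eval g (Poly_Mapping.single w c * q)
      = free_eval g (Poly_Mapping.single w c) * free_eval g q" for w c and q :: "'x free_algebra"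
    by (induction q rule: free_induct)
      (simp_all add: free_eval_zero free_eval_add distrib_left mult_single free_eval_single
        plus_list_def mult_scaleC_left mult_scaleC_right scaleC_scaleC)
  show ?thesis
    by (induction p rule: free_induct)
      (simp_all add: free_eval_zero free_eval_add distrib_right s)
qed

lemma free_eval_diff: "free_eval g (p - q) = free_eval g p - free_eval g q"
  using free_eval_add[of g "p - q" q] by (simp add: algebra_simps)

lemma free_eval_sum: "free_eval g (\<Sum>i\<in>A. f i) = (\<Sum>i\<in>A. free_eval g (f i))"
  by (induction A rule: infinite_finite_induct) (simp_all add: free_eval_add free_eval_zero)

lemma free_eval_gen: "free_eval g (free_gen x) = g x"
  by (simp add: free_gen_def free_eval_single scaleC_one)

lemma free_eval_const: "free_eval g (free_const c) = c *\<^sub>C 1"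
  by (simp add: free_const_def free_eval_single)


section \<open>The algebras of the three orthogonal quantum groups\<close>

inductive_set gen_ideal :: "'x free_algebra set \<Rightarrow> 'x free_algebra set"
  for R :: "'x free_algebra set" where
  gen_ideal_rel: "r \<in> R \<Longrightarrow> r \<in> gen_ideal R"
| gen_ideal_zero: "0 \<in> gen_ideal R"
| gen_ideal_add: "p \<in> gen_ideal R \<Longrightarrow> q \<in> gen_ideal R \<Longrightarrow> p + q \<in> gen_ideal R"
| gen_ideal_mult: "p \<in> gen_ideal R \<Longrightarrow> a * p * b \<in> gen_ideal R"

datatype liberation = Classical | Half_Liberated | Free

(* The index set {1..N} is modelled by a finite type 'n with CARD('n) = N. *)

definition orthogonality_relations :: "('n::finite \<times> 'n) free_algebra set" where
  "orthogonality_relations =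
     {(\<Sum>k\<in>UNIV. free_gen (i, k) * free_gen (j, k)) - free_const (of_bool (i = j)) | i j. True}
   \<union> {(\<Sum>k\<in>UNIV. free_gen (k, i) * free_gen (k, j)) - free_const (of_bool (i = j)) | i j. True}"

fun liberation_relations :: "liberation \<Rightarrow> ('n::finite \<times> 'n) free_algebra set" where
  "liberation_relations Classical = {free_gen a * free_gen b - free_gen b * free_gen a | a b. True}"
| "liberation_relations Half_Liberated =
     {free_gen a * free_gen b * free_gen c - free_gen c * free_gen b * free_gen a | a b c. True}"
| "liberation_relations Free = {}"

definition quantum_ideal :: "liberation \<Rightarrow> ('n::finite \<times> 'n) free_algebra set" where
  "quantum_ideal l = gen_ideal (orthogonality_relations \<union> liberation_relations l)"

(* Phantom types that select one of the three cases at the level of types. *)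
class liberation_kind =
  fixes liberation_of :: "'a itself \<Rightarrow> liberation"

datatype classical = Classical_Kind
datatype half_liberated = Half_Liberated_Kind
datatype free_kind = Free_Kind

instantiation classical :: liberation_kind
begin
definition liberation_of_classical :: "classical itself \<Rightarrow> liberation" where
  "liberation_of_classical _ = Classical"
instance ..
end

instantiation half_liberated :: liberation_kind
begin
definition liberation_of_half_liberated :: "half_liberated itself \<Rightarrow> liberation" where
  "liberation_of_half_liberated _ = Half_Liberated"
instance ..
end

instantiation free_kind :: liberation_kind
begin
definition liberation_of_free_kind :: "free_kind itself \<Rightarrow> liberation" where
  "liberation_of_free_kind _ = Free"
instance ..
end

lemma gen_ideal_left: "p \<in> gen_ideal R \<Longrightarrow> a * p \<in> gen_ideal R"
  using gen_ideal_mult[of p R a 1] by simp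

lemma gen_ideal_right: "p \<in> gen_ideal R \<Longrightarrow> p * b \<in> gen_ideal R"
  using gen_ideal_mult[of p R 1 b] by simp

lemma gen_ideal_uminus: "p \<in> gen_ideal R \<Longrightarrow> - p \<in> gen_ideal R"
  using gen_ideal_mult[of p R "- 1" 1] by simp

lemma gen_ideal_star:
  assumes "\<And>r. r \<in> R \<Longrightarrow> free_star r \<in> R" and "p \<in> gen_ideal R"
  shows "free_star p \<in> gen_ideal R"
  using assms(2)
  by induction (auto simp: free_star_zero free_star_add free_star_mult assms(1) mult.assoc
      intro: gen_ideal.intros gen_ideal_left gen_ideal_right)

lemma row_relation:
  "(\<Sum>k\<in>UNIV. free_gen (i, k) * free_gen (j, k)) - free_const (of_bool (i = j))
    \<in> orthogonality_relations"
  unfolding orthogonality_relations_def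
  by (intro UnI1 CollectI exI conjI TrueI) (rule refl)

lemma column_relation:
  "(\<Sum>k\<in>UNIV. free_gen (k, i) * free_gen (k, j)) - free_const (of_bool (i = j))
    \<in> orthogonality_relations"
  unfolding orthogonality_relations_def
  by (intro UnI2 CollectI exI conjI TrueI) (rule refl)

lemma classical_relation:
  "free_gen a * free_gen b - free_gen b * free_gen a \<in> liberation_relations Classical"
  unfolding liberation_relations.simps
  by (intro CollectI exI conjI TrueI) (rule refl)

lemma half_liberated_relation:
  "free_gen a * free_gen b * free_gen c - free_gen c * free_gen b * free_gen a
    \<in> liberation_relations Half_Liberated"
  unfolding liberation_relations.simps
  by (intro CollectI exI conjI TrueI) (rule refl)

lemma orthogonality_relations_cases:
  assumes "r \<in> orthogonality_relations"
  obtains (row) i j where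
    "r = (\<Sum>k\<in>UNIV. free_gen (i, k) * free_gen (j, k)) - free_const (of_bool (i = j))"
  | (column) i j where
    "r = (\<Sum>k\<in>UNIV. free_gen (k, i) * free_gen (k, j)) - free_const (of_bool (i = j))"
  using assms unfolding orthogonality_relations_def by blast

lemma quantum_ideal_star:
  fixes p :: "('n::finite \<times> 'n) free_algebra"
  assumes "p \<in> quantum_ideal l"
  shows "free_star p \<in> quantum_ideal l"
proof -
  have "free_star r \<in> orthogonality_relations" if "r \<in> orthogonality_relations"
    for r :: "('n \<times> 'n) free_algebra"
    using that
  proof (cases rule: orthogonality_relations_cases)
    case (row i j)
    then have "free_star r
        = (\<Sum>k\<in>UNIV. free_gen (j, k) * free_gen (i, k)) - free_const (of_bool (j = i))"
      by (cases "i = j")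
        (simp_all add: free_star_diff free_star_sum free_star_mult free_star_gen free_star_const)
    then show ?thesis by (simp only: row_relation)
  next
    case (column i j)
    then have "free_star r
        = (\<Sum>k\<in>UNIV. free_gen (k, j) * free_gen (k, i)) - free_const (of_bool (j = i))"
      by (cases "i = j")
        (simp_all add: free_star_diff free_star_sum free_star_mult free_star_gen free_star_const)
    then show ?thesis by (simp only: column_relation)
  qed
  moreover have "free_star r \<in> liberation_relations l" if r: "r \<in> liberation_relations l"
    for r :: "('n \<times> 'n) free_algebra"
  proof (cases l)
    case Classical
    from r obtain a b where "r = free_gen a * free_gen b - free_gen b * free_gen a"
      unfolding Classical liberation_relations.simps by blast
    then have "free_star r = free_gen b * free_gen a - free_gen a * free_gen b"
      by (simp add: free_star_diff free_star_mult free_star_gen)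
    then show ?thesis by (simp only: Classical classical_relation)
  next
    case Half_Liberated
    from r obtain a b c where
      "r = free_gen a * free_gen b * free_gen c - free_gen c * free_gen b * free_gen a"
      unfolding Half_Liberated liberation_relations.simps by blast
    then have "free_star r = free_gen c * free_gen b * free_gen a - free_gen a * free_gen b * free_gen c"
      by (simp add: free_star_diff free_star_mult free_star_gen mult.assoc)
    then show ?thesis by (simp only: Half_Liberated half_liberated_relation)
  next
    case Free
    then show ?thesis using r by simp
  qed
  ultimately show ?thesis
    using assms unfolding quantum_ideal_def by (intro gen_ideal_star) blast+
qed

definition quantum_rel ::
  "'k::liberation_kind itself \<Rightarrow> ('n::finite \<times> 'n) free_algebra \<Rightarrow> ('n \<times> 'n) free_algebra \<Rightarrow> bool"
  where "quantum_rel k p q \<longleftrightarrow> p - q \<in> quantum_ideal (liberation_of k)"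

lemma equivp_quantum_rel: "equivp (quantum_rel k)"
proof (intro equivpI reflpI sympI transpI)
  fix p q r
  show "quantum_rel k p p"
    by (simp add: quantum_rel_def quantum_ideal_def gen_ideal_zero)
  show "quantum_rel k q p" if "quantum_rel k p q"
    using gen_ideal_uminus[of "p - q"] that by (simp add: quantum_rel_def quantum_ideal_def)
  show "quantum_rel k p r" if "quantum_rel k p q" "quantum_rel k q r"
    using gen_ideal_add[of "p - q" _ "q - r"] that by (simp add: quantum_rel_def quantum_ideal_def)
qed

(* With N = CARD('n): the algebra of the classical (half-liberated, free) orthogonal quantum group
   of size N is ('n, classical) quantum_algebra (with half_liberated, free_kind in place of
   classical). The ideal is invariant under the involution (quantum_ideal_star), so this is the
   universal unital *-algebra with the given relations. *)
quotient_type (overloaded) ('n, 'k) quantum_algebra =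
    "('n::finite \<times> 'n) free_algebra" / "quantum_rel TYPE('k::liberation_kind)"
  by (rule equivp_quantum_rel)

instantiation quantum_algebra :: (finite, liberation_kind) complex_algebra
begin

lift_definition zero_quantum_algebra :: "('a, 'b) quantum_algebra" is 0 .
lift_definition one_quantum_algebra :: "('a, 'b) quantum_algebra" is 1 .

lift_definition plus_quantum_algebra ::
  "('a, 'b) quantum_algebra \<Rightarrow> ('a, 'b) quantum_algebra \<Rightarrow> ('a, 'b) quantum_algebra" is "(+)"
  unfolding quantum_rel_def quantum_ideal_def add_diff_add by (rule gen_ideal_add)

lift_definition uminus_quantum_algebra ::
  "('a, 'b) quantum_algebra \<Rightarrow> ('a, 'b) quantum_algebra" is uminus
  unfolding quantum_rel_def quantum_ideal_def minus_diff_minus by (rule gen_ideal_uminus)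

lift_definition minus_quantum_algebra ::
  "('a, 'b) quantum_algebra \<Rightarrow> ('a, 'b) quantum_algebra \<Rightarrow> ('a, 'b) quantum_algebra" is "(-)"
proof -
  fix p p' q q' :: "('a \<times> 'a) free_algebra"
  assume "quantum_rel TYPE('b) p p'" "quantum_rel TYPE('b) q q'"
  then have "(p - p') + - (q - q') \<in> quantum_ideal (liberation_of TYPE('b))"
    unfolding quantum_rel_def quantum_ideal_def by (intro gen_ideal_add gen_ideal_uminus)
  then show "quantum_rel TYPE('b) (p - q) (p' - q')"
    by (simp add: quantum_rel_def algebra_simps)
qed

lift_definition times_quantum_algebra ::
  "('a, 'b) quantum_algebra \<Rightarrow> ('a, 'b) quantum_algebra \<Rightarrow> ('a, 'b) quantum_algebra" is "(*)"
proof -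
  fix p p' q q' :: "('a \<times> 'a) free_algebra"
  assume "quantum_rel TYPE('b) p p'" "quantum_rel TYPE('b) q q'"
  then have "(p - p') * q + p' * (q - q') \<in> quantum_ideal (liberation_of TYPE('b))"
    unfolding quantum_rel_def quantum_ideal_def
    by (intro gen_ideal_add gen_ideal_left gen_ideal_right)
  then show "quantum_rel TYPE('b) (p * q) (p' * q')"
    by (simp add: quantum_rel_def algebra_simps)
qed

lift_definition scaleC_quantum_algebra ::
  "complex \<Rightarrow> ('a, 'b) quantum_algebra \<Rightarrow> ('a, 'b) quantum_algebra" is "\<lambda>c p. free_const c * p"
  unfolding quantum_rel_def quantum_ideal_def right_diff_distrib[symmetric]
  by (rule gen_ideal_left)

instance
proof -
  have refl: "quantum_rel TYPE('b) p p" for p :: "('a \<times> 'a) free_algebra"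
    by (rule equivp_reflp[OF equivp_quantum_rel])
  have eq: "p = q \<Longrightarrow> quantum_rel TYPE('b) p q" for p q :: "('a \<times> 'a) free_algebra"
    using refl by simp
  show "OFCLASS(('a, 'b) quantum_algebra, complex_algebra_class)"
  proof
    fix a b c :: "('a, 'b) quantum_algebra" and x y :: complex
    show "a + b + c = a + (b + c)" by transfer (rule eq, simp add: add.assoc)
    show "a + b = b + a" by transfer (rule eq, simp add: add.commute)
    show "0 + a = a" by transfer (rule eq, simp)
    show "- a + a = 0" by transfer (rule eq, simp)
    show "a - b = a + - b" by transfer (rule eq, simp)
    show "a * b * c = a * (b * c)" by transfer (rule eq, simp add: mult.assoc)
    show "(a + b) * c = a * c + b * c" by transfer (rule eq, simp add: distrib_right)
    show "a * (b + c) = a * b + a * c" by transfer (rule eq, simp add: distrib_left)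
    show "1 * a = a" by transfer (rule eq, simp)
    show "a * 1 = a" by transfer (rule eq, simp)
    show "x *\<^sub>C (a + b) = x *\<^sub>C a + x *\<^sub>C b" by transfer (rule eq, simp add: distrib_left)
    show "(x + y) *\<^sub>C a = x *\<^sub>C a + y *\<^sub>C a"
      by transfer (rule eq, simp add: distrib_right const_add)
    show "x *\<^sub>C (y *\<^sub>C a) = (x * y) *\<^sub>C a"
      by transfer (rule eq, simp add: const_mult mult.assoc)
    show "1 *\<^sub>C a = a" by transfer (rule eq, simp add: const_one)
    show "(x *\<^sub>C a) * b = x *\<^sub>C (a * b)" by transfer (rule eq, simp add: mult.assoc)
    show "a * (x *\<^sub>C b) = x *\<^sub>C (a * b)"
      by transfer (rule eq, rule const_left_commute)
  qed
qed

end


lift_definition qstar ::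
  "('n::finite, 'k::liberation_kind) quantum_algebra \<Rightarrow> ('n, 'k) quantum_algebra" is free_star
  unfolding quantum_rel_def free_star_diff[symmetric] by (rule quantum_ideal_star)

lift_definition u_gen :: "'n::finite \<Rightarrow> 'n \<Rightarrow> ('n, 'k::liberation_kind) quantum_algebra"
  is "\<lambda>i j. free_gen (i, j)" .


section \<open>The algebraic tensor product of complex algebras\<close>

(* A finite multiset of pairs stands for the corresponding sum of elementary tensors. *)
inductive tensor_rel ::
  "('a::complex_algebra \<times> 'b::complex_algebra) multiset \<Rightarrow> ('a \<times> 'b) multiset \<Rightarrow> bool" where
  tensor_refl: "tensor_rel M M"
| tensor_sym: "tensor_rel M N \<Longrightarrow> tensor_rel N M"
| tensor_trans: "tensor_rel M N \<Longrightarrow> tensor_rel N K \<Longrightarrow> tensor_rel M K"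
| tensor_cong: "tensor_rel M N \<Longrightarrow> tensor_rel (M + K) (N + K)"
| tensor_add_left: "tensor_rel {#(a + a', b)#} {#(a, b), (a', b)#}"
| tensor_add_right: "tensor_rel {#(a, b + b')#} {#(a, b), (a, b')#}"
| tensor_scale: "tensor_rel {#(c *\<^sub>C a, b)#} {#(a, c *\<^sub>C b)#}"
| tensor_zero: "tensor_rel {#(0, b)#} {#}"

lemma equivp_tensor_rel: "equivp tensor_rel"
  by (intro equivpI reflpI sympI transpI) (blast intro: tensor_rel.intros)+

lemma tensor_cong2:
  assumes "tensor_rel M M'" "tensor_rel N N'"
  shows "tensor_rel (M + N) (M' + N')"
proof -
  have "tensor_rel (M + N) (M' + N)" by (rule tensor_cong[OF assms(1)])
  also have "tensor_rel (M' + N) (M' + N')"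
    using tensor_cong[OF assms(2), of M'] by (simp add: add.commute)
  finally (tensor_trans) show ?thesis .
qed

definition tensor_mult ::
  "('a::complex_algebra \<times> 'b::complex_algebra) multiset \<Rightarrow> ('a \<times> 'b) multiset \<Rightarrow> ('a \<times> 'b) multiset"
  where "tensor_mult M N = (\<Sum>x\<in>#M. \<Sum>y\<in>#N. {#(fst x * fst y, snd x * snd y)#})"

lemma tensor_mult_add_left: "tensor_mult (M + M') N = tensor_mult M N + tensor_mult M' N"
  by (simp add: tensor_mult_def)

lemma tensor_mult_add_right: "tensor_mult M (N + N') = tensor_mult M N + tensor_mult M N'"
  by (simp add: tensor_mult_def sum_mset.distrib)

lemma tensor_mult_empty [simp]: "tensor_mult {#} N = {#}" "tensor_mult M {#} = {#}"
  by (simp_all add: tensor_mult_def)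

lemma tensor_mult_single:
  "tensor_mult {#(a, b)#} {#(a', b')#} = {#(a * a', b * b')#}"
  by (simp add: tensor_mult_def)

lemma tensor_mult_add_mset_left:
  "tensor_mult (add_mset x M) N = tensor_mult {#x#} N + tensor_mult M N"
  by (simp add: tensor_mult_def)

lemma tensor_mult_add_mset_right:
  "tensor_mult M (add_mset y N) = tensor_mult M {#y#} + tensor_mult M N"
  using tensor_mult_add_right[of M "{#y#}" N] by simp

lemma tensor_mult_assoc: "tensor_mult (tensor_mult M N) K = tensor_mult M (tensor_mult N K)"
proof -
  have 1: "tensor_mult (tensor_mult {#x#} {#y#}) K = tensor_mult {#x#} (tensor_mult {#y#} K)"
    for x y :: "'a \<times> 'b"
  proof (induction K)
    case (add z K)
    have "tensor_mult (tensor_mult {#x#} {#y#}) {#z#} = tensor_mult {#x#} (tensor_mult {#y#} {#z#})"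
      by (cases x; cases y; cases z) (simp add: tensor_mult_single mult.assoc)
    with add show ?case
      by (simp add: tensor_mult_add_mset_right[of _ z K] tensor_mult_add_right)
  qed simp
  have 2: "tensor_mult (tensor_mult {#x#} N) K = tensor_mult {#x#} (tensor_mult N K)"
    for x :: "'a \<times> 'b"
  proof (induction N)
    case (add y N)
    then show ?case
      by (simp add: tensor_mult_add_mset_right[of _ y N] tensor_mult_add_mset_left[of y N]
          tensor_mult_add_left tensor_mult_add_right 1)
  qed simp
  show ?thesis
  proof (induction M)
    case (add x M)
    then show ?case
      by (simp add: tensor_mult_add_mset_left[of x M] tensor_mult_add_left 2)
  qed simp
qed

lemma tensor_zero_right: "tensor_rel {#(a, 0)#} {#}"
proof -
  have "tensor_rel {#(a, 0 *\<^sub>C 0)#} {#(0 *\<^sub>C a, 0)#}"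
    by (rule tensor_sym[OF tensor_scale])
  moreover have "tensor_rel {#(0, 0)#} {#}" by (rule tensor_zero)
  ultimately show ?thesis by (metis cvec.scale_zero_left tensor_trans)
qed

lemma tensor_mult_rel_left:
  assumes "tensor_rel M M'"
  shows "tensor_rel (tensor_mult M N) (tensor_mult M' N)"
proof (induction N)
  case empty
  show ?case by (simp add: tensor_refl)
next
  case (add y N)
  obtain p q where y: "y = (p, q)" by (cases y)
  have "tensor_rel (tensor_mult M {#y#}) (tensor_mult M' {#y#})"
    using assms
  proof induction
    case (tensor_refl M)
    show ?case by (rule tensor_rel.tensor_refl)
  next
    case (tensor_sym M N)
    then show ?case by (blast intro: tensor_rel.tensor_sym)
  next
    case (tensor_trans M N K)
    then show ?case by (blast intro: tensor_rel.tensor_trans)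
  next
    case (tensor_cong M N K)
    then show ?case by (simp add: tensor_mult_add_left tensor_rel.tensor_cong)
  next
    case (tensor_add_left a a' b)
    show ?case
      using tensor_rel.tensor_add_left[of "a * p" "a' * p" "b * q"]
      by (simp add: y tensor_mult_add_mset_left[of _ "{#_#}"] tensor_mult_single distrib_right
          add_mset_commute)
  next
    case (tensor_add_right a b b')
    show ?case
      using tensor_rel.tensor_add_right[of "a * p" "b * q" "b' * q"]
      by (simp add: y tensor_mult_add_mset_left[of _ "{#_#}"] tensor_mult_single distrib_right
          add_mset_commute)
  next
    case (tensor_scale c a b)
    show ?case
      using tensor_rel.tensor_scale[of c "a * p" "b * q"]
      by (simp add: y tensor_mult_single mult_scaleC_left)
  next
    case (tensor_zero b)
    show ?case
      using tensor_rel.tensor_zero[of "b * q"] by (simp add: y tensor_mult_single)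
  qed
  then show ?case
    using add by (simp add: tensor_mult_add_mset_right[of _ y N] tensor_cong2)
qed

lemma tensor_mult_rel_right:
  assumes "tensor_rel N N'"
  shows "tensor_rel (tensor_mult M N) (tensor_mult M N')"
proof (induction M)
  case empty
  show ?case by (simp add: tensor_refl)
next
  case (add x M)
  obtain p q where x: "x = (p, q)" by (cases x)
  have "tensor_rel (tensor_mult {#x#} N) (tensor_mult {#x#} N')"
    using assms
  proof induction
    case (tensor_refl M)
    show ?case by (rule tensor_rel.tensor_refl)
  next
    case (tensor_sym M N)
    then show ?case by (blast intro: tensor_rel.tensor_sym)
  next
    case (tensor_trans M N K)
    then show ?case by (blast intro: tensor_rel.tensor_trans)
  next
    case (tensor_cong M N K)
    then show ?case by (simp add: tensor_mult_add_right tensor_rel.tensor_cong)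
  next
    case (tensor_add_left a a' b)
    show ?case
      using tensor_rel.tensor_add_left[of "p * a" "p * a'" "q * b"]
      by (simp add: x tensor_mult_add_mset_right[of _ _ "{#_#}"] tensor_mult_single distrib_left
          add_mset_commute)
  next
    case (tensor_add_right a b b')
    show ?case
      using tensor_rel.tensor_add_right[of "p * a" "q * b" "q * b'"]
      by (simp add: x tensor_mult_add_mset_right[of _ _ "{#_#}"] tensor_mult_single distrib_left
          add_mset_commute)
  next
    case (tensor_scale c a b)
    show ?case
      using tensor_rel.tensor_scale[of c "p * a" "q * b"]
      by (simp add: x tensor_mult_single mult_scaleC_right)
  next
    case (tensor_zero b)
    show ?case
      using tensor_rel.tensor_zero[of "q * b"] by (simp add: x tensor_mult_single)
  qed
  then show ?case
    using add by (simp add: tensor_mult_add_mset_left[of x M] tensor_cong2)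
qed

definition tensor_scaleC ::
  "complex \<Rightarrow> ('a::complex_algebra \<times> 'b::complex_algebra) multiset \<Rightarrow> ('a \<times> 'b) multiset"
  where "tensor_scaleC c M = image_mset (\<lambda>(a, b). (c *\<^sub>C a, b)) M"

lemma tensor_scaleC_rel:
  assumes "tensor_rel M M'"
  shows "tensor_rel (tensor_scaleC c M) (tensor_scaleC c M')"
proof -
  have eq: "tensor_scaleC c M = tensor_mult {#(c *\<^sub>C 1, 1)#} M"
    for M :: "('a \<times> 'b) multiset"
    by (induction M) (auto simp: tensor_scaleC_def tensor_mult_def mult_scaleC_left)
  show ?thesis unfolding eq by (rule tensor_mult_rel_right[OF assms])
qed

quotient_type (overloaded) ('a, 'b) tensor =
    "('a::complex_algebra \<times> 'b::complex_algebra) multiset" / tensor_rel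
  by (rule equivp_tensor_rel)

instantiation tensor :: (complex_algebra, complex_algebra) complex_algebra
begin

lift_definition zero_tensor :: "('a, 'b) tensor" is "{#}" .
lift_definition one_tensor :: "('a, 'b) tensor" is "{#(1, 1)#}" .
lift_definition plus_tensor :: "('a, 'b) tensor \<Rightarrow> ('a, 'b) tensor \<Rightarrow> ('a, 'b) tensor" is "(+)"
  by (rule tensor_cong2)
lift_definition times_tensor :: "('a, 'b) tensor \<Rightarrow> ('a, 'b) tensor \<Rightarrow> ('a, 'b) tensor"
  is tensor_mult
  by (blast intro: tensor_trans tensor_mult_rel_left tensor_mult_rel_right)
lift_definition scaleC_tensor :: "complex \<Rightarrow> ('a, 'b) tensor \<Rightarrow> ('a, 'b) tensor"
  is tensor_scaleC
  by (rule tensor_scaleC_rel)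
definition uminus_tensor :: "('a, 'b) tensor \<Rightarrow> ('a, 'b) tensor" where
  "uminus_tensor t = (- 1) *\<^sub>C t"
definition minus_tensor :: "('a, 'b) tensor \<Rightarrow> ('a, 'b) tensor \<Rightarrow> ('a, 'b) tensor" where
  "minus_tensor s t = s + - t"

instance
proof -
  have eq: "M = N \<Longrightarrow> tensor_rel M N" for M N :: "('a \<times> 'b) multiset"
    by (simp add: tensor_refl)
  have add_left: "tensor_rel (tensor_scaleC (x + y) M) (tensor_scaleC x M + tensor_scaleC y M)"
    for x y and M :: "('a \<times> 'b) multiset"
  proof (induction M)
    case empty
    show ?case by (simp add: tensor_scaleC_def tensor_refl)
  next
    case (add z M)
    obtain a b where z: "z = (a, b)" by (cases z)
    have "tensor_rel ({#((x + y) *\<^sub>C a, b)#} + tensor_scaleC (x + y) M)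
        ({#(x *\<^sub>C a, b), (y *\<^sub>C a, b)#} + (tensor_scaleC x M + tensor_scaleC y M))"
      by (rule tensor_cong2[OF _ add]) (simp add: scaleC_add_left tensor_add_left)
    then show ?case by (simp add: tensor_scaleC_def z add_mset_commute)
  qed
  have zero: "tensor_rel (tensor_scaleC 0 M) {#}" for M :: "('a \<times> 'b) multiset"
  proof (induction M)
    case empty
    show ?case by (simp add: tensor_scaleC_def tensor_refl)
  next
    case (add z M)
    obtain a b where z: "z = (a, b)" by (cases z)
    have "tensor_rel ({#(0, b)#} + tensor_scaleC 0 M) ({#} + {#})"
      by (rule tensor_cong2[OF tensor_zero add])
    then show ?case by (simp add: tensor_scaleC_def z)
  qed
  have one: "tensor_scaleC 1 M = M" for M :: "('a \<times> 'b) multiset"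
    by (induction M) (auto simp: tensor_scaleC_def scaleC_one)
  have mult_one: "tensor_mult {#(1, 1)#} M = M" "tensor_mult M {#(1, 1)#} = M"
    for M :: "('a \<times> 'b) multiset"
    by (induction M) (auto simp: tensor_mult_def)
  have scale_add_mset:
    "tensor_scaleC x (add_mset m M) = add_mset (x *\<^sub>C fst m, snd m) (tensor_scaleC x M)"
    for x and m and M :: "('a \<times> 'b) multiset"
    by (simp add: tensor_scaleC_def case_prod_beta)
  have scale_scale: "tensor_scaleC x (tensor_scaleC y M) = tensor_scaleC (x * y) M"
    for x y and M :: "('a \<times> 'b) multiset"
    by (induction M) (auto simp: tensor_scaleC_def scaleC_scaleC)
  have scale_plus: "tensor_scaleC x (M + N) = tensor_scaleC x M + tensor_scaleC x N"
    for x and M N :: "('a \<times> 'b) multiset"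
    by (simp add: tensor_scaleC_def)
  have scale_mult_left: "tensor_mult (tensor_scaleC x M) N = tensor_scaleC x (tensor_mult M N)"
    for x and M N :: "('a \<times> 'b) multiset"
  proof (induction M)
    case (add m M)
    have "tensor_mult {#(x *\<^sub>C fst m, snd m)#} N = tensor_scaleC x (tensor_mult {#m#} N)"
      by (induction N) (auto simp: tensor_mult_def tensor_scaleC_def mult_scaleC_left)
    with add show ?case
      by (simp only: scale_add_mset scale_plus tensor_mult_add_mset_left[of m M]
          tensor_mult_add_mset_left[of _ "tensor_scaleC x M"])
  qed (simp add: tensor_scaleC_def)
  have scale_mult_right: "tensor_mult M (tensor_scaleC x N) = tensor_scaleC x (tensor_mult M N)"
    for x and M N :: "('a \<times> 'b) multiset"
  proof (induction N)
    case (add n N)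
    have "tensor_mult M {#(x *\<^sub>C fst n, snd n)#} = tensor_scaleC x (tensor_mult M {#n#})"
      by (induction M) (auto simp: tensor_mult_def tensor_scaleC_def mult_scaleC_right)
    with add show ?case
      by (simp only: scale_add_mset scale_plus tensor_mult_add_mset_right[of _ n N]
          tensor_mult_add_mset_right[of _ _ "tensor_scaleC x N"])
  qed (simp add: tensor_scaleC_def)
  have scale_add: "x *\<^sub>C (a + b) = x *\<^sub>C a + x *\<^sub>C b" for x and a b :: "('a, 'b) tensor"
    by transfer (rule eq, simp add: tensor_scaleC_def)
  have scale_add_left: "(x + y) *\<^sub>C a = x *\<^sub>C a + y *\<^sub>C a" for x y and a :: "('a, 'b) tensor"
    by transfer (rule add_left)
  have scale_zero: "0 *\<^sub>C a = 0" for a :: "('a, 'b) tensor"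
    by transfer (rule zero)
  have scale_one: "1 *\<^sub>C a = a" for a :: "('a, 'b) tensor"
    by transfer (rule eq, rule one)
  show "OFCLASS(('a, 'b) tensor, complex_algebra_class)"
  proof
    fix a b c :: "('a, 'b) tensor" and x y :: complex
    show "a + b + c = a + (b + c)" by transfer (rule eq, simp add: add.assoc)
    show "a + b = b + a" by transfer (rule eq, simp add: add.commute)
    show "0 + a = a" by transfer (rule eq, simp)
    show "- a + a = 0"
      using scale_add_left[of "- 1" 1 a] by (simp add: uminus_tensor_def scale_one scale_zero)
    show "a - b = a + - b" by (rule minus_tensor_def)
    show "a * b * c = a * (b * c)" by transfer (rule eq, rule tensor_mult_assoc)
    show "(a + b) * c = a * c + b * c" by transfer (rule eq, rule tensor_mult_add_left)
    show "a * (b + c) = a * b + a * c" by transfer (rule eq, rule tensor_mult_add_right)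
    show "1 * a = a" by transfer (rule eq, rule mult_one)
    show "a * 1 = a" by transfer (rule eq, rule mult_one)
    show "x *\<^sub>C (a + b) = x *\<^sub>C a + x *\<^sub>C b" by (rule scale_add)
    show "(x + y) *\<^sub>C a = x *\<^sub>C a + y *\<^sub>C a" by (rule scale_add_left)
    show "x *\<^sub>C (y *\<^sub>C a) = (x * y) *\<^sub>C a"
      by transfer (rule eq, rule scale_scale)
    show "1 *\<^sub>C a = a" by (rule scale_one)
    show "(x *\<^sub>C a) * b = x *\<^sub>C (a * b)" by transfer (rule eq, rule scale_mult_left)
    show "a * (x *\<^sub>C b) = x *\<^sub>C (a * b)" by transfer (rule eq, rule scale_mult_right)
  qed
qed

end

lift_definition elem_tensor ::
  "'a::complex_algebra \<Rightarrow> 'b::complex_algebra \<Rightarrow> ('a, 'b) tensor" (infixr \<open>\<otimes>\<^sub>C\<close> 70)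
  is "\<lambda>a b. {#(a, b)#}" .

(* slice_left h and slice_right h are the maps h \<otimes> id and id \<otimes> h. Outside linear functionals h
   they are irrelevant; the guard makes the lifting total. *)
lift_definition slice_left ::
  "('a::complex_algebra \<Rightarrow> complex) \<Rightarrow> ('a, 'b::complex_algebra) tensor \<Rightarrow> 'b"
  is "\<lambda>h M. if clinear_functional h then (\<Sum>(a, b)\<in>#M. h a *\<^sub>C b) else 0"
proof -
  fix h :: "'a \<Rightarrow> complex" and M N :: "('a \<times> 'b) multiset"
  assume "tensor_rel M N"
  then show "(if clinear_functional h then (\<Sum>(a, b)\<in>#M. h a *\<^sub>C b) else 0)
      = (if clinear_functional h then (\<Sum>(a, b)\<in>#N. h a *\<^sub>C b) else 0)"
  proof induction
    case (tensor_zero b)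
    have "h 0 = 0" if "clinear_functional h"
      using that unfolding clinear_functional_def by (metis cvec.scale_zero_left mult_zero_left)
    then show ?case by simp
  qed (auto simp: clinear_functional_def scaleC_add_left scaleC_add_right scaleC_scaleC mult.commute
      split: if_splits)
qed

lift_definition slice_right ::
  "('b::complex_algebra \<Rightarrow> complex) \<Rightarrow> ('a::complex_algebra, 'b) tensor \<Rightarrow> 'a"
  is "\<lambda>h M. if clinear_functional h then (\<Sum>(a, b)\<in>#M. h b *\<^sub>C a) else 0"
proof -
  fix h :: "'b \<Rightarrow> complex" and M N :: "('a \<times> 'b) multiset"
  assume "tensor_rel M N"
  then show "(if clinear_functional h then (\<Sum>(a, b)\<in>#M. h b *\<^sub>C a) else 0)
      = (if clinear_functional h then (\<Sum>(a, b)\<in>#N. h b *\<^sub>C a) else 0)"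
    by induction
      (auto simp: clinear_functional_def scaleC_add_left scaleC_add_right scaleC_scaleC mult.commute
      split: if_splits)
qed


section \<open>Comultiplication and Haar state\<close>

lemma elem_tensor_mult: "(a \<otimes>\<^sub>C b) * (c \<otimes>\<^sub>C d) = (a * c) \<otimes>\<^sub>C (b * d)"
  by transfer (simp add: tensor_mult_single tensor_refl)

lemma elem_tensor_add_left: "(a + a') \<otimes>\<^sub>C b = a \<otimes>\<^sub>C b + a' \<otimes>\<^sub>C b"
  by transfer (use tensor_add_left in \<open>simp add: add_mset_commute\<close>)

lemma elem_tensor_add_right: "a \<otimes>\<^sub>C (b + b') = a \<otimes>\<^sub>C b + a \<otimes>\<^sub>C b'"
  by transfer (use tensor_add_right in \<open>simp add: add_mset_commute\<close>)

lemma elem_tensor_scale_left: "(c *\<^sub>C a) \<otimes>\<^sub>C b = c *\<^sub>C (a \<otimes>\<^sub>C b)"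
  by transfer (simp add: tensor_scaleC_def tensor_refl)

lemma elem_tensor_scale_right: "a \<otimes>\<^sub>C (c *\<^sub>C b) = c *\<^sub>C (a \<otimes>\<^sub>C b)"
  by transfer (simp add: tensor_scaleC_def tensor_sym[OF tensor_scale])

lemma elem_tensor_zero [simp]: "0 \<otimes>\<^sub>C b = 0" "a \<otimes>\<^sub>C 0 = 0"
  by (transfer, rule tensor_zero) (transfer, rule tensor_zero_right)

lemma elem_tensor_one: "1 \<otimes>\<^sub>C 1 = 1"
  by transfer (rule tensor_refl)

lemma elem_tensor_sum_left: "(\<Sum>k\<in>A. f k) \<otimes>\<^sub>C b = (\<Sum>k\<in>A. f k \<otimes>\<^sub>C b)"
  by (induction A rule: infinite_finite_induct) (simp_all add: elem_tensor_add_left)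

lemma elem_tensor_sum_right: "a \<otimes>\<^sub>C (\<Sum>k\<in>A. f k) = (\<Sum>k\<in>A. a \<otimes>\<^sub>C f k)"
  by (induction A rule: infinite_finite_induct) (simp_all add: elem_tensor_add_right)

lemma abs_quantum_algebra_sum:
  "abs_quantum_algebra (\<Sum>k\<in>A. f k) = (\<Sum>k\<in>A. abs_quantum_algebra (f k))"
  by (induction A rule: infinite_finite_induct)
    (simp_all add: plus_quantum_algebra.abs_eq[symmetric] zero_quantum_algebra_def[symmetric])

lemma abs_quantum_algebra_eqI:
  assumes "p - q \<in> quantum_ideal (liberation_of TYPE('k))"
  shows "abs_quantum_algebra p = (abs_quantum_algebra q :: ('n::finite, 'k::liberation_kind) quantum_algebra)"
  using assms by (simp add: quantum_algebra.abs_eq_iff quantum_rel_def)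

lemma quantum_ideal_orthogonality: "r \<in> orthogonality_relations \<Longrightarrow> r \<in> quantum_ideal l"
  by (simp add: quantum_ideal_def gen_ideal_rel)

lemma quantum_ideal_liberation: "r \<in> liberation_relations l \<Longrightarrow> r \<in> quantum_ideal l"
  by (simp add: quantum_ideal_def gen_ideal_rel)

lemma abs_quantum_algebra_const:
  "abs_quantum_algebra (free_const c) = c *\<^sub>C (1 :: ('n::finite, 'k::liberation_kind) quantum_algebra)"
  by (simp add: one_quantum_algebra_def scaleC_quantum_algebra.abs_eq)

lemma u_gen_row:
  "(\<Sum>k\<in>UNIV. u_gen i k * u_gen j k)
     = of_bool (i = j) *\<^sub>C (1 :: ('n::finite, 'k::liberation_kind) quantum_algebra)"
proof -
  have "(\<Sum>k\<in>UNIV. free_gen (i, k) * free_gen (j, k)) - free_const (of_bool (i = j))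
      \<in> quantum_ideal (liberation_of TYPE('k))"
    by (rule quantum_ideal_orthogonality, rule row_relation)
  from abs_quantum_algebra_eqI[OF this] show ?thesis
    by (simp add: abs_quantum_algebra_sum abs_quantum_algebra_const u_gen.abs_eq
        times_quantum_algebra.abs_eq)
qed

lemma u_gen_column:
  "(\<Sum>k\<in>UNIV. u_gen k i * u_gen k j)
     = of_bool (i = j) *\<^sub>C (1 :: ('n::finite, 'k::liberation_kind) quantum_algebra)"
proof -
  have "(\<Sum>k\<in>UNIV. free_gen (k, i) * free_gen (k, j)) - free_const (of_bool (i = j))
      \<in> quantum_ideal (liberation_of TYPE('k))"
    by (rule quantum_ideal_orthogonality, rule column_relation)
  from abs_quantum_algebra_eqI[OF this] show ?thesis
    by (simp add: abs_quantum_algebra_sum abs_quantum_algebra_const u_gen.abs_eq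
        times_quantum_algebra.abs_eq)
qed

lemma u_gen_commute:
  assumes "liberation_of TYPE('k) = Classical"
  shows "u_gen i j * u_gen k l = u_gen k l * (u_gen i j :: ('n::finite, 'k::liberation_kind) quantum_algebra)"
proof -
  have "free_gen (i, j) * free_gen (k, l) - free_gen (k, l) * free_gen (i, j)
      \<in> quantum_ideal (liberation_of TYPE('k))"
    unfolding assms by (rule quantum_ideal_liberation, rule classical_relation)
  from abs_quantum_algebra_eqI[OF this] show ?thesis
    by (simp add: u_gen.abs_eq times_quantum_algebra.abs_eq)
qed

lemma u_gen_half_commute:
  assumes "liberation_of TYPE('k) = Half_Liberated"
  shows "u_gen i j * u_gen k l * u_gen m n
    = u_gen m n * u_gen k l * (u_gen i j :: ('n::finite, 'k::liberation_kind) quantum_algebra)"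
proof -
  have "free_gen (i, j) * free_gen (k, l) * free_gen (m, n)
      - free_gen (m, n) * free_gen (k, l) * free_gen (i, j)
      \<in> quantum_ideal (liberation_of TYPE('k))"
    unfolding assms by (rule quantum_ideal_liberation, rule half_liberated_relation)
  from abs_quantum_algebra_eqI[OF this] show ?thesis
    by (simp add: u_gen.abs_eq times_quantum_algebra.abs_eq)
qed

definition comult_gen ::
  "'n \<times> 'n \<Rightarrow> (('n::finite, 'k::liberation_kind) quantum_algebra, ('n, 'k) quantum_algebra) tensor"
  where "comult_gen = (\<lambda>(i, j). \<Sum>k\<in>UNIV. u_gen i k \<otimes>\<^sub>C u_gen k j)"

lemma comult_gen_row:
  "(\<Sum>k\<in>UNIV. comult_gen (i, k) * comult_gen (j, k))
    = of_bool (i = j) *\<^sub>C (1 :: (('n::finite, 'k::liberation_kind) quantum_algebra, ('n, 'k) quantum_algebra) tensor)"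
proof -
  let ?u = "u_gen :: 'n \<Rightarrow> 'n \<Rightarrow> ('n, 'k) quantum_algebra"
  have "(\<Sum>k\<in>UNIV. comult_gen (i, k) * comult_gen (j, k))
      = (\<Sum>k\<in>UNIV. \<Sum>a\<in>UNIV. \<Sum>b\<in>UNIV. (?u i a * ?u j b) \<otimes>\<^sub>C (?u a k * ?u b k))"
    by (simp add: comult_gen_def sum_product elem_tensor_mult)
  also have "\<dots> = (\<Sum>a\<in>UNIV. \<Sum>b\<in>UNIV. \<Sum>k\<in>UNIV. (?u i a * ?u j b) \<otimes>\<^sub>C (?u a k * ?u b k))"
    by (subst sum.swap, rule sum.cong[OF refl], rule sum.swap)
  also have "\<dots> = (\<Sum>a\<in>UNIV. \<Sum>b\<in>UNIV. of_bool (a = b) *\<^sub>C ((?u i a * ?u j b) \<otimes>\<^sub>C 1))"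
    by (simp add: elem_tensor_sum_right[symmetric] u_gen_row elem_tensor_scale_right)
  also have "\<dots> = (\<Sum>a\<in>UNIV. \<Sum>b\<in>UNIV. if a = b then (?u i a * ?u j b) \<otimes>\<^sub>C 1 else 0)"
    by (intro sum.cong refl) (simp add: scaleC_one)
  also have "\<dots> = of_bool (i = j) *\<^sub>C 1"
    by (simp add: elem_tensor_sum_left[symmetric] u_gen_row elem_tensor_scale_left elem_tensor_one)
  finally show ?thesis .
qed

lemma comult_gen_column:
  "(\<Sum>k\<in>UNIV. comult_gen (k, i) * comult_gen (k, j))
    = of_bool (i = j) *\<^sub>C (1 :: (('n::finite, 'k::liberation_kind) quantum_algebra, ('n, 'k) quantum_algebra) tensor)"
proof -
  let ?u = "u_gen :: 'n \<Rightarrow> 'n \<Rightarrow> ('n, 'k) quantum_algebra"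
  have "(\<Sum>k\<in>UNIV. comult_gen (k, i) * comult_gen (k, j))
      = (\<Sum>k\<in>UNIV. \<Sum>a\<in>UNIV. \<Sum>b\<in>UNIV. (?u k a * ?u k b) \<otimes>\<^sub>C (?u a i * ?u b j))"
    by (simp add: comult_gen_def sum_product elem_tensor_mult)
  also have "\<dots> = (\<Sum>a\<in>UNIV. \<Sum>b\<in>UNIV. \<Sum>k\<in>UNIV. (?u k a * ?u k b) \<otimes>\<^sub>C (?u a i * ?u b j))"
    by (subst sum.swap, rule sum.cong[OF refl], rule sum.swap)
  also have "\<dots> = (\<Sum>a\<in>UNIV. \<Sum>b\<in>UNIV. of_bool (a = b) *\<^sub>C (1 \<otimes>\<^sub>C (?u a i * ?u b j)))"
    by (simp add: elem_tensor_sum_left[symmetric] u_gen_column elem_tensor_scale_left)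
  also have "\<dots> = (\<Sum>a\<in>UNIV. \<Sum>b\<in>UNIV. if a = b then 1 \<otimes>\<^sub>C (?u a i * ?u b j) else 0)"
    by (intro sum.cong refl) (simp add: scaleC_one)
  also have "\<dots> = of_bool (i = j) *\<^sub>C 1"
    by (simp add: elem_tensor_sum_right[symmetric] u_gen_column elem_tensor_scale_right elem_tensor_one)
  finally show ?thesis .
qed

lemma comult_gen_commute:
  assumes "liberation_of TYPE('k) = Classical"
  shows "comult_gen a * comult_gen b
    = comult_gen b * (comult_gen a ::
        (('n::finite, 'k::liberation_kind) quantum_algebra, ('n, 'k) quantum_algebra) tensor)"
proof -
  obtain i j k l where ab: "a = (i, j)" "b = (k, l)" by (cases a; cases b)
  show ?thesis
    by (simp add: ab comult_gen_def sum_product elem_tensor_mult)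
      (subst sum.swap, intro sum.cong refl arg_cong2[of _ _ _ _ elem_tensor] u_gen_commute assms)
qed

lemma comult_gen_half_commute:
  assumes "liberation_of TYPE('k) = Half_Liberated"
  shows "comult_gen a * comult_gen b * comult_gen c
    = comult_gen c * comult_gen b * (comult_gen a ::
        (('n::finite, 'k::liberation_kind) quantum_algebra, ('n, 'k) quantum_algebra) tensor)"
proof -
  let ?u = "u_gen :: 'n \<Rightarrow> 'n \<Rightarrow> ('n, 'k) quantum_algebra"
  obtain i j k l m n where abc: "a = (i, j)" "b = (k, l)" "c = (m, n)" by (cases a; cases b; cases c)
  have expand: "comult_gen (i, j) * comult_gen (k, l) * comult_gen (m, n)
      = (\<Sum>x\<in>UNIV. \<Sum>y\<in>UNIV. \<Sum>z\<in>UNIV.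
          (?u i x * ?u k y * ?u m z) \<otimes>\<^sub>C (?u x j * ?u y l * ?u z n))" for i j k l m n
  proof -
    have "comult_gen (i, j) * comult_gen (k, l)
        = (\<Sum>x\<in>UNIV. \<Sum>y\<in>UNIV. (?u i x * ?u k y) \<otimes>\<^sub>C (?u x j * ?u y l))"
      by (simp add: comult_gen_def sum_product elem_tensor_mult)
    then show ?thesis
      by (simp only: sum_distrib_right)
        (simp add: comult_gen_def sum_distrib_left elem_tensor_mult)
  qed
  have "(\<Sum>x\<in>UNIV. \<Sum>y\<in>UNIV. \<Sum>z\<in>UNIV.
          (?u i x * ?u k y * ?u m z) \<otimes>\<^sub>C (?u x j * ?u y l * ?u z n))
      = (\<Sum>x\<in>UNIV. \<Sum>y\<in>UNIV. \<Sum>z\<in>UNIV.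
          (?u m z * ?u k y * ?u i x) \<otimes>\<^sub>C (?u z n * ?u y l * ?u x j))"
    by (intro sum.cong refl arg_cong2[of _ _ _ _ elem_tensor] u_gen_half_commute assms)
  also have "\<dots> = (\<Sum>x\<in>UNIV. \<Sum>z\<in>UNIV. \<Sum>y\<in>UNIV.
          (?u m z * ?u k y * ?u i x) \<otimes>\<^sub>C (?u z n * ?u y l * ?u x j))"
    by (rule sum.cong[OF refl], rule sum.swap)
  also have "\<dots> = (\<Sum>z\<in>UNIV. \<Sum>x\<in>UNIV. \<Sum>y\<in>UNIV.
          (?u m z * ?u k y * ?u i x) \<otimes>\<^sub>C (?u z n * ?u y l * ?u x j))"
    by (rule sum.swap)
  also have "\<dots> = (\<Sum>z\<in>UNIV. \<Sum>y\<in>UNIV. \<Sum>x\<in>UNIV.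
          (?u m z * ?u k y * ?u i x) \<otimes>\<^sub>C (?u z n * ?u y l * ?u x j))"
    by (rule sum.cong[OF refl], rule sum.swap)
  finally show ?thesis unfolding abc expand .
qed

lemma free_eval_comult_ideal:
  assumes "p \<in> quantum_ideal (liberation_of TYPE('k))"
  shows "free_eval comult_gen p
    = (0 :: (('n::finite, 'k::liberation_kind) quantum_algebra, ('n, 'k) quantum_algebra) tensor)"
  using assms unfolding quantum_ideal_def
proof induction
  case (gen_ideal_rel r)
  then consider "r \<in> orthogonality_relations" | "r \<in> liberation_relations (liberation_of TYPE('k))"
    by blast
  then show ?case
  proof cases
    case 1
    then show ?thesis
      by (cases rule: orthogonality_relations_cases)
        (simp_all add: free_eval_diff free_eval_sum free_eval_mult free_eval_gen free_eval_const
          comult_gen_row comult_gen_column)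
  next
    case 2
    show ?thesis
    proof (cases "liberation_of TYPE('k)")
      case Classical
      from 2 obtain a b where "r = free_gen a * free_gen b - free_gen b * free_gen a"
        unfolding Classical liberation_relations.simps by blast
      then show ?thesis
        by (simp add: free_eval_diff free_eval_mult free_eval_gen comult_gen_commute[OF Classical, of a b])
    next
      case Half_Liberated
      from 2 obtain a b c where
        "r = free_gen a * free_gen b * free_gen c - free_gen c * free_gen b * free_gen a"
        unfolding Half_Liberated liberation_relations.simps by blast
      then show ?thesis
        by (simp only: free_eval_diff free_eval_mult free_eval_gen
            comult_gen_half_commute[OF Half_Liberated, of a b c] diff_self)
    next
      case Free
      with 2 show ?thesis by simp
    qed
  qed
qed (simp_all add: free_eval_zero free_eval_add free_eval_mult)

(* The unital algebra homomorphism with u i j \<mapsto> \<Sum>k. u i k \<otimes> u k j. *)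
lift_definition comult ::
  "('n::finite, 'k::liberation_kind) quantum_algebra
    \<Rightarrow> (('n, 'k) quantum_algebra, ('n, 'k) quantum_algebra) tensor"
  is "free_eval comult_gen"
  unfolding quantum_rel_def
  by (drule free_eval_comult_ideal) (simp add: free_eval_diff)

definition haar_state :: "(('n::finite, 'k::liberation_kind) quantum_algebra \<Rightarrow> complex) \<Rightarrow> bool" where
  "haar_state h \<longleftrightarrow>
     clinear_functional h \<and> h 1 = 1 \<and>
     (\<forall>a. h (qstar a * a) \<in> \<real> \<and> 0 \<le> Re (h (qstar a * a))) \<and>
     (\<forall>a. slice_left h (comult a) = h a *\<^sub>C 1) \<and>
     (\<forall>a. slice_right h (comult a) = h a *\<^sub>C 1)"


section \<open>Spheres and their spectral dimension\<close>

inductive_set star_subalgebra ::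
  "('n::finite, 'k::liberation_kind) quantum_algebra set \<Rightarrow> ('n, 'k) quantum_algebra set"
  for X :: "('n, 'k) quantum_algebra set" where
  "a \<in> X \<Longrightarrow> a \<in> star_subalgebra X"
| "1 \<in> star_subalgebra X"
| "a \<in> star_subalgebra X \<Longrightarrow> b \<in> star_subalgebra X \<Longrightarrow> a + b \<in> star_subalgebra X"
| "a \<in> star_subalgebra X \<Longrightarrow> c *\<^sub>C a \<in> star_subalgebra X"
| "a \<in> star_subalgebra X \<Longrightarrow> b \<in> star_subalgebra X \<Longrightarrow> a * b \<in> star_subalgebra X"
| "a \<in> star_subalgebra X \<Longrightarrow> qstar a \<in> star_subalgebra X"

(* Throughout, e :: 'n plays the role of the index 1: x_i = u_{1i} is u_gen e i. *)

definition sphere_algebra ::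
  "'n \<Rightarrow> ('n::finite, 'k::liberation_kind) quantum_algebra set" where
  "sphere_algebra e = star_subalgebra (range (u_gen e))"

definition sphere_H :: "'n \<Rightarrow> nat \<Rightarrow> ('n::finite, 'k::liberation_kind) quantum_algebra set" where
  "sphere_H e k = cspan {prod_list (map (u_gen e) is) | is. length is \<le> k}"

(* H_{-1} = 0, so that D_0 = H_0 = C 1. *)
definition sphere_D ::
  "'n \<Rightarrow> (('n::finite, 'k::liberation_kind) quantum_algebra \<Rightarrow> complex) \<Rightarrow> nat
    \<Rightarrow> ('n, 'k) quantum_algebra set" where
  "sphere_D e h k =
     {a \<in> sphere_H e k. k > 0 \<longrightarrow> (\<forall>b\<in>sphere_H e (k - 1). h (qstar b * a) = 0)}"

definition is_distribution ::
  "('a::complex_algebra \<Rightarrow> complex) \<Rightarrow> 'a \<Rightarrow> real measure \<Rightarrow> bool" where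
  "is_distribution h a \<mu> \<longleftrightarrow>
     prob_space \<mu> \<and> sets \<mu> = sets borel \<and> emeasure \<mu> {-1..1} = 1 \<and>
     (\<forall>p :: complex poly. h (eval_poly p a) = (\<integral>x. poly p (complex_of_real x) \<partial>\<mu>))"

definition normalized_orthogonal_polys :: "real measure \<Rightarrow> (nat \<Rightarrow> real poly) \<Rightarrow> bool" where
  "normalized_orthogonal_polys \<mu> q \<longleftrightarrow>
     (\<forall>s. degree (q s) = s \<and> poly (q s) 1 = 1) \<and>
     (\<forall>s t. s \<noteq> t \<longrightarrow> (\<integral>x. poly (q s) x * poly (q t) x \<partial>\<mu>) = 0)"

definition sphere_eigenvalue :: "(nat \<Rightarrow> real poly) \<Rightarrow> nat \<Rightarrow> real" where
  "sphere_eigenvalue q s = - poly (pderiv (q s)) 1"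

definition sphere_operator ::
  "'n \<Rightarrow> (('n::finite, 'k::liberation_kind) quantum_algebra \<Rightarrow> complex) \<Rightarrow> (nat \<Rightarrow> real poly)
    \<Rightarrow> (('n, 'k) quantum_algebra \<Rightarrow> ('n, 'k) quantum_algebra) \<Rightarrow> bool" where
  "sphere_operator e h q L \<longleftrightarrow>
     (\<forall>a\<in>sphere_algebra e. \<forall>b\<in>sphere_algebra e. L (a + b) = L a + L b) \<and>
     (\<forall>c. \<forall>a\<in>sphere_algebra e. L (c *\<^sub>C a) = c *\<^sub>C L a) \<and>
     (\<forall>s. \<forall>a\<in>sphere_D e h s. L a = complex_of_real (sphere_eigenvalue q s) *\<^sub>C a)"

definition sphere_data ::
  "'n \<Rightarrow> (('n::finite, 'k::liberation_kind) quantum_algebra \<Rightarrow> complex) \<Rightarrow> real measure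
    \<Rightarrow> (nat \<Rightarrow> real poly) \<Rightarrow> (('n, 'k) quantum_algebra \<Rightarrow> ('n, 'k) quantum_algebra) \<Rightarrow> bool" where
  "sphere_data e h \<mu> q L \<longleftrightarrow>
     haar_state h \<and> is_distribution h (u_gen e e) \<mu> \<and>
     normalized_orthogonal_polys \<mu> q \<and> sphere_operator e h q L"

(* The infimum of the empty set is \<infinity>. The powers are meant for lam s < 0 (s \<ge> 1), which holds
   for the eigenvalues of the spheres; 0 powr x = 0 plays no role. *)
definition spectral_dimension :: "(nat \<Rightarrow> nat) \<Rightarrow> (nat \<Rightarrow> real) \<Rightarrow> ereal" where
  "spectral_dimension m lam =
     Inf (ereal ` {d. d > 0 \<and> summable (\<lambda>s. real (m (Suc s)) * (- lam (Suc s)) powr (- d / 2))})"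

definition sphere_dimension ::
  "'n \<Rightarrow> (('n::finite, 'k::liberation_kind) quantum_algebra \<Rightarrow> complex) \<Rightarrow> (nat \<Rightarrow> real poly) \<Rightarrow> ereal"
  where "sphere_dimension e h q =
     spectral_dimension (\<lambda>s. cdim (sphere_D e h s)) (sphere_eigenvalue q)"

end

theory Submission
  imports Defs "HOL-Library.Function_Algebras" "HOL-Real_Asymp.Real_Asymp"
    "HOL-Computational_Algebra.Fundamental_Theorem_Algebra"
begin

text \<open>
  Let \<open>H\<^sub>s\<close> be the span of the words of length at most \<open>s\<close> in \<open>x\<^sub>j = u e j\<close>. The Haar state is faithful on
  the sphere algebra, so \<open>dim D\<^sub>s = dim H\<^sub>s - dim H\<^sub>s\<^sub>-\<^sub>1\<close>, and by summation over dyadic blocks the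
  spectral dimension depends only on two orders of growth: \<open>dim H\<^sub>s \<approx> s\<^sup>a\<close> and \<open>-\<lambda>\<^sub>s \<approx> s\<^sup>2\<close>
  give \<open>d\<^sub>L = a\<close>, whereas exponential growth of \<open>dim H\<^sub>s\<close> against polynomial growth of \<open>-\<lambda>\<^sub>s\<close> gives
  \<open>d\<^sub>L = \<infinity>\<close>.

  Faithfulness (\<open>sphere_H_faithful\<close>) is a matrix argument. For the orthogonal matrix \<open>V\<close> of words of fixed
  length, invariance makes \<open>E = h(V)\<close> an orthogonal projection and makes the Gram matrix of the words
  commute with \<open>V\<close>; a null vector can therefore be written with a coefficient \<open>p\<^sup>* V p\<close> that is null as
  well, and this forces \<open>p = 0\<close>, because \<open>V\<^sup>* \<otimes> V\<close> fixes \<open>\<Sum>J. J \<otimes> J\<close>.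

  Everything else comes from homomorphisms \<open>\<Phi>\<close> of the quantum group algebra to operators, either through the
  invariance \<open>(h \<otimes> \<Phi>) \<Delta> = h(\<cdot>) 1\<close> (\<open>h_spread\<close>) or by separating words.

  In the classical and the half-liberated case, \<open>\<Phi>\<close> over the dual numbers yields the vanishing of \<open>h\<close> on
  derivations of words (\<open>h_variation\<close>), hence a two-term recursion for the moments of \<open>u e e\<close>. It says that
  an explicit second-order operator on polynomials is symmetric for the distribution of
  \<open>u e e\<close>; its eigenvectors are the orthogonal polynomials, and its value at 1 is a multiple of \<open>p'(1)\<close>,
  which gives \<open>\<lambda>\<^sub>s\<close> exactly (\<open>eigenvalue_formula\<close>). The dimension of \<open>H\<^sub>s\<close> is bounded above by normal forms of
  words and below by evaluation at classical points, respectively at points of \<open>GL\<^sub>N\<close>, which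
  represent the half-liberated algebra by 2x2 blocks. For \<open>N = 2\<close> the relation \<open>x\<^sup>2 + y\<^sup>2 = 1\<close> makes
  the generators of the free sphere half-commute, and the same argument applies.

  In the free case with \<open>N \<ge> 3\<close>, \<open>\<Phi>\<close> is \<open>u = o diag(g) o\<^sup>t\<close> with an orthogonal matrix \<open>o\<close> and free
  reflections \<open>g\<^sub>a\<close>, which act on the reduced words, that is, on a tree. The reduced words are separated by
  \<open>\<Phi>\<close>, so \<open>dim H\<^sub>s\<close> grows exponentially. The image of \<open>u e e\<close> is an adjacency operator of the tree with
  coefficients \<open>y\<^sub>a\<close>, where \<open>\<Sum>a. y\<^sub>a\<^sup>2 = 1\<close>, and Cauchy-Schwarz on the edges bounds it by some \<open>\<rho> < 1\<close>
  (\<open>gap\<close>). All roots of the orthogonal polynomials are then at most \<open>\<rho>\<close>, and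
  \<open>-\<lambda>\<^sub>s = \<Sum> 1 / (1 - z)\<close>, the sum over the roots \<open>z\<close>, is at most \<open>s / (1 - \<rho>)\<close>.
\<close>

section \<open>Semi-inner products\<close>

locale semi_inner = vector_space scale for scale :: "complex \<Rightarrow> 'v::ab_group_add \<Rightarrow> 'v" +
  fixes ip :: "'v \<Rightarrow> 'v \<Rightarrow> complex"
  assumes ip_add_right: "ip x (y + z) = ip x y + ip x z"
    and ip_scale_right: "ip x (scale c y) = c * ip x y"
    and ip_add_left: "ip (x + y) z = ip x z + ip y z"
    and ip_scale_left: "ip (scale c x) y = cnj c * ip x y"
    and ip_self: "ip x x \<in> \<real> \<and> 0 \<le> Re (ip x x)"
begin

lemma ip_zero [simp]: "ip x 0 = 0" "ip 0 x = 0"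
  using ip_scale_right[of x 0 0] ip_scale_left[of 0 0 x] by simp_all

lemma ip_minus_right: "ip x (- y) = - ip x y"
  using ip_scale_right[of x "-1" y] by (simp add: scale_minus_left)

lemma ip_diff_right: "ip x (y - z) = ip x y - ip x z"
  using ip_add_right[of x y "- z"] by (simp add: ip_minus_right)

lemma ip_sum_right: "ip x (\<Sum>i\<in>A. f i) = (\<Sum>i\<in>A. ip x (f i))"
  by (induction A rule: infinite_finite_induct) (simp_all add: ip_add_right)

lemma ip_sum_left: "ip (\<Sum>i\<in>A. f i) x = (\<Sum>i\<in>A. ip (f i) x)"
  by (induction A rule: infinite_finite_induct) (simp_all add: ip_add_left)

lemma ip_commute: "ip y x = cnj (ip x y)"
proof -
  have im: "Im (ip z z) = 0" for z using ip_self[of z] by (simp add: complex_is_Real_iff)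
  have 1: "Im (ip x y + ip y x) = 0"
    using im[of "x + y"] im[of x] im[of y] by (simp add: ip_add_right ip_add_left)
  have 2: "Im (\<i> * ip x y - \<i> * ip y x) = 0"
    using im[of "x + scale \<i> y"] im[of x] im[of y]
    by (simp add: ip_add_right ip_add_left ip_scale_left ip_scale_right)
  show ?thesis using 1 2 by (simp add: complex_eq_iff)
qed

text \<open>Otherwise \<open>y - t \<cdot> cnj (ip y x) \<cdot> x\<close> would have negative square norm for large \<open>t\<close>.\<close>
lemma ip_null:
  assumes "ip x x = 0"
  shows "ip y x = 0" "ip x y = 0"
proof -
  define b where "b = ip y x"
  have bx: "ip x y = cnj b" by (simp add: b_def ip_commute[of x y])
  have "Re (ip y y) - 2 * t * (cmod b)\<^sup>2 \<ge> 0" for t :: real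
  proof -
    define c where "c = - of_real t * cnj b"
    let ?z = "y + scale c x"
    have z: "ip ?z ?z = ip y y + c * b + cnj c * cnj b"
      using assms by (simp add: ip_add_right ip_add_left ip_scale_left ip_scale_right bx b_def[symmetric])
    have "Re (ip ?z ?z) = Re (ip y y) - 2 * t * (cmod b)\<^sup>2"
      unfolding z by (simp add: c_def cmod_power2 power2_eq_square[of "Re b"] power2_eq_square[of "Im b"] algebra_simps)
    then show ?thesis using ip_self[of ?z] by simp
  qed
  from this[of "(Re (ip y y) + 1) / (2 * (cmod b)\<^sup>2)"] have "b = 0"
    by (cases "b = 0") (auto simp: field_simps)
  then show "ip y x = 0" "ip x y = 0" using bx by (simp_all add: b_def)
qed

lemma orthogonal_span:
  assumes "\<And>s. s \<in> S \<Longrightarrow> ip s v = 0" "w \<in> span S"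
  shows "ip w v = 0"
  using assms(2)
  by (induction rule: span_induct_alt) (simp_all add: ip_add_left ip_scale_left assms(1))

text \<open>Gram-Schmidt; a generator whose component orthogonal to the previous ones is a null vector
  contributes nothing.\<close>
lemma orthogonal_decomposition:
  assumes "finite S"
  obtains w where "w \<in> span S" "\<And>s. s \<in> S \<Longrightarrow> ip s (v - w) = 0"
proof -
  have "\<exists>w\<in>span S. \<forall>s\<in>S. ip s (v - w) = 0"
    using assms
  proof (induction S arbitrary: v)
    case empty
    show ?case by (auto intro: span_zero)
  next
    case (insert b S)
    obtain wb where wb: "wb \<in> span S" "\<forall>s\<in>S. ip s (b - wb) = 0" using insert.IH by blast
    obtain wv where wv: "wv \<in> span S" "\<forall>s\<in>S. ip s (v - wv) = 0" using insert.IH by blast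
    define b' where "b' = b - wb"
    define c where "c = ip b' (v - wv) / ip b' b'"
    define w where "w = wv + scale c b'"
    have sub: "span S \<subseteq> span (insert b S)" by (rule span_mono) blast
    have "b' \<in> span (insert b S)"
      unfolding b'_def by (rule span_diff[OF span_base]) (use sub wb(1) in auto)
    then have w: "w \<in> span (insert b S)"
      unfolding w_def using sub wv(1) by (intro span_add span_scale) auto
    have S: "ip s (v - w) = 0" if "s \<in> S" for s
      using that wb(2) wv(2)
      by (simp add: w_def b'_def diff_diff_add[symmetric] ip_diff_right ip_scale_right)
    have "ip b' (v - w) = 0"
    proof (cases "ip b' b' = 0")
      case True
      then show ?thesis by (rule ip_null(2))
    next
      case False
      have "v - w = (v - wv) - scale c b'" by (simp add: w_def)
      with False show ?thesis by (simp only: ip_diff_right[of b' "v - wv"] ip_scale_right) (simp add: c_def)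
    qed
    moreover have "ip wb (v - w) = 0" by (rule orthogonal_span[OF S wb(1)])
    moreover have "b = b' + wb" by (simp add: b'_def)
    ultimately have "ip b (v - w) = 0" by (simp only: ip_add_left add_0)
    with w S show ?case by (intro bexI[of _ w]) auto
  qed
  then show ?thesis using that by blast
qed

lemma span_image_finite:
  assumes "finite I" "w \<in> span (g ` I)"
  obtains r where "w = (\<Sum>i\<in>I. scale (r i) (g i))"
proof -
  from assms(2) have "\<exists>r. w = (\<Sum>i\<in>I. scale (r i) (g i))"
  proof (induction rule: span_induct_alt)
    case base
    show ?case by (rule exI[of _ "\<lambda>_. 0"]) simp
  next
    case (step c x y)
    then obtain r j where r: "y = (\<Sum>i\<in>I. scale (r i) (g i))" and j: "j \<in> I" "x = g j" by blast
    have "scale c x = (\<Sum>i\<in>I. scale (if i = j then c else 0) (g i))"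
      using assms(1) j by (simp add: if_distrib[of "\<lambda>c. scale c _"] cong: if_cong)
    then have "scale c x + y = (\<Sum>i\<in>I. scale ((if i = j then c else 0) + r i) (g i))"
      by (simp only: r scale_left_distrib sum.distrib)
    then show ?case by (rule exI[of _ "\<lambda>i. (if i = j then c else 0) + r i"])
  qed
  then show ?thesis using that by blast
qed

end

section \<open>Representations of the algebras by linear operators\<close>

text \<open>Every homomorphism used below takes its values in the linear operators on the functions on some index
  set: a point for characters, pairs of flags for 2x2 blocks over the dual numbers, and words.\<close>
typedef 'w linop =
  "{T :: ('w \<Rightarrow> complex) \<Rightarrow> 'w \<Rightarrow> complex. \<forall>c u v. T (\<lambda>x. c * u x + v x) = (\<lambda>x. c * T u x + T v x)}"
  morphisms app Linop
  by (rule exI[of _ "\<lambda>v. v"]) simp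

setup_lifting type_definition_linop

instantiation linop :: (type) complex_algebra
begin
lift_definition zero_linop :: "'a linop" is "\<lambda>v x. 0" by simp
lift_definition one_linop :: "'a linop" is "\<lambda>v. v" by simp
lift_definition plus_linop :: "'a linop \<Rightarrow> 'a linop \<Rightarrow> 'a linop" is "\<lambda>S T v x. S v x + T v x"
  by (simp add: fun_eq_iff algebra_simps)
lift_definition uminus_linop :: "'a linop \<Rightarrow> 'a linop" is "\<lambda>S v x. - S v x"
  by (simp add: fun_eq_iff algebra_simps)
lift_definition minus_linop :: "'a linop \<Rightarrow> 'a linop \<Rightarrow> 'a linop" is "\<lambda>S T v x. S v x - T v x"
  by (simp add: fun_eq_iff algebra_simps)
lift_definition times_linop :: "'a linop \<Rightarrow> 'a linop \<Rightarrow> 'a linop" is "\<lambda>S T v. S (T v)"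
  by simp
lift_definition scaleC_linop :: "complex \<Rightarrow> 'a linop \<Rightarrow> 'a linop" is "\<lambda>c S v x. c * S v x"
  by (simp add: fun_eq_iff algebra_simps)
instance
proof
  fix a b c :: "'a linop" and x y :: complex
  have lin: "S (\<lambda>x. u x + v x) = (\<lambda>x. S u x + S v x)" "S (\<lambda>x. z * u x) = (\<lambda>x. z * S u x)"
    if "\<forall>c u v. S (\<lambda>x. c * u x + v x) = (\<lambda>x. c * S u x + S v x)"
    for S :: "('a \<Rightarrow> complex) \<Rightarrow> 'a \<Rightarrow> complex" and u v z
  proof -
    show add: "S (\<lambda>x. u x + v x) = (\<lambda>x. S u x + S v x)" for u v
      using that[rule_format, of 1 u v] by simp
    have "S (\<lambda>x. 0) = (\<lambda>x. 0)"
      using add[of "\<lambda>x. 0" "\<lambda>x. 0"] by (simp add: fun_eq_iff)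
    then show "S (\<lambda>x. z * u x) = (\<lambda>x. z * S u x)"
      using that[rule_format, of z u "\<lambda>x. 0"] by simp
  qed
  show "a + b + c = a + (b + c)" by transfer (simp add: add.assoc)
  show "a + b = b + a" by transfer (simp add: add.commute)
  show "0 + a = a" by transfer simp
  show "- a + a = 0" by transfer simp
  show "a - b = a + - b" by transfer simp
  show "a * b * c = a * (b * c)" by transfer simp
  show "(a + b) * c = a * c + b * c" by transfer simp
  show "a * (b + c) = a * b + a * c" by transfer (simp add: lin)
  show "1 * a = a" by transfer simp
  show "a * 1 = a" by transfer simp
  show "x *\<^sub>C (a + b) = x *\<^sub>C a + x *\<^sub>C b" by transfer (simp add: algebra_simps)
  show "(x + y) *\<^sub>C a = x *\<^sub>C a + y *\<^sub>C a" by transfer (simp add: algebra_simps)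
  show "x *\<^sub>C (y *\<^sub>C a) = (x * y) *\<^sub>C a" by transfer (simp add: algebra_simps)
  show "1 *\<^sub>C a = a" by transfer simp
  show "(x *\<^sub>C a) * b = x *\<^sub>C (a * b)" by transfer simp
  show "a * (x *\<^sub>C b) = x *\<^sub>C (a * b)" by transfer (simp add: lin)
qed
end

lemma app_sum: "app (\<Sum>i\<in>A. f i) v x = (\<Sum>i\<in>A. app (f i) v x)"
  by (induction A rule: infinite_finite_induct) (simp_all add: zero_linop.rep_eq plus_linop.rep_eq)

lemmas app_simps = zero_linop.rep_eq one_linop.rep_eq plus_linop.rep_eq times_linop.rep_eq
  scaleC_linop.rep_eq app_sum

lemma scaleC_sum_left: "(\<Sum>i\<in>A. f i) *\<^sub>C (a::'a::complex_algebra) = (\<Sum>i\<in>A. f i *\<^sub>C a)"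
  by (rule cvec.scale_sum_left)

definition algebra_hom :: "('a::complex_algebra \<Rightarrow> 'b::complex_algebra) \<Rightarrow> bool" where
  "algebra_hom \<Phi> \<longleftrightarrow> (\<forall>a b. \<Phi> (a + b) = \<Phi> a + \<Phi> b) \<and> (\<forall>c a. \<Phi> (c *\<^sub>C a) = c *\<^sub>C \<Phi> a) \<and>
     (\<forall>a b. \<Phi> (a * b) = \<Phi> a * \<Phi> b) \<and> \<Phi> 1 = 1"

lemma algebra_homD:
  assumes "algebra_hom \<Phi>"
  shows "\<Phi> (a + b) = \<Phi> a + \<Phi> b" "\<Phi> (c *\<^sub>C a) = c *\<^sub>C \<Phi> a" "\<Phi> (a * b) = \<Phi> a * \<Phi> b" "\<Phi> 1 = 1"
    "\<Phi> (\<Sum>i\<in>A. f i) = (\<Sum>i\<in>A. \<Phi> (f i))"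
proof -
  show add: "\<Phi> (a + b) = \<Phi> a + \<Phi> b" for a b using assms by (simp add: algebra_hom_def)
  show scale: "\<Phi> (c *\<^sub>C a) = c *\<^sub>C \<Phi> a" for c a using assms by (simp add: algebra_hom_def)
  show "\<Phi> (a * b) = \<Phi> a * \<Phi> b" "\<Phi> 1 = 1" using assms by (auto simp: algebra_hom_def)
  have "\<Phi> 0 = 0" using scale[of 0 0] by simp
  then show "\<Phi> (\<Sum>i\<in>A. f i) = (\<Sum>i\<in>A. \<Phi> (f i))"
    by (induction A rule: infinite_finite_induct) (simp_all add: add)
qed

text \<open>The universal property of the algebra given by generators and relations.\<close>
lemma quantum_algebra_hom:
  fixes g :: "'n::finite \<Rightarrow> 'n \<Rightarrow> 'b::complex_algebra"
  assumes row: "\<And>i j. (\<Sum>k\<in>UNIV. g i k * g j k) = of_bool (i = j) *\<^sub>C 1"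
    and column: "\<And>i j. (\<Sum>k\<in>UNIV. g k i * g k j) = of_bool (i = j) *\<^sub>C 1"
    and commute: "\<And>i j k l. liberation_of TYPE('k) = Classical \<Longrightarrow> g i j * g k l = g k l * g i j"
    and half_commute: "\<And>i j k l m n. liberation_of TYPE('k) = Half_Liberated \<Longrightarrow>
        g i j * g k l * g m n = g m n * g k l * g i j"
  shows "\<exists>\<Phi> :: ('n, 'k::liberation_kind) quantum_algebra \<Rightarrow> 'b.
    algebra_hom \<Phi> \<and> (\<forall>i j. \<Phi> (u_gen i j) = g i j)"
proof -
  define G where "G = (\<lambda>(i, j). g i j)"
  have ideal: "free_eval G p = 0" if "p \<in> quantum_ideal (liberation_of TYPE('k))" for p
    using that unfolding quantum_ideal_def
  proof induction
    case (gen_ideal_rel r)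
    then consider "r \<in> orthogonality_relations" | "r \<in> liberation_relations (liberation_of TYPE('k))"
      by blast
    then show ?case
    proof cases
      case 1
      then show ?thesis
        by (cases rule: orthogonality_relations_cases)
          (simp_all add: free_eval_diff free_eval_sum free_eval_mult free_eval_gen free_eval_const
            G_def row column)
    next
      case 2
      show ?thesis
      proof (cases "liberation_of TYPE('k)")
        case Classical
        from 2 obtain a b where "r = free_gen a * free_gen b - free_gen b * free_gen a"
          unfolding Classical liberation_relations.simps by blast
        then show ?thesis
          by (cases a; cases b)
            (simp add: free_eval_diff free_eval_mult free_eval_gen G_def commute[OF Classical])
      next
        case Half_Liberated
        from 2 obtain a b c where
          "r = free_gen a * free_gen b * free_gen c - free_gen c * free_gen b * free_gen a"
          unfolding Half_Liberated liberation_relations.simps by blast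
        then show ?thesis
          using half_commute[OF Half_Liberated, of "fst a" "snd a" "fst b" "snd b" "fst c" "snd c"]
          by (simp add: free_eval_diff free_eval_mult free_eval_gen G_def case_prod_beta)
      next
        case Free
        with 2 show ?thesis by simp
      qed
    qed
  qed (simp_all add: free_eval_zero free_eval_add free_eval_mult)
  define \<Phi> where "\<Phi> = (\<lambda>a :: ('n, 'k) quantum_algebra. free_eval G (rep_quantum_algebra a))"
  have abs: "\<Phi> (abs_quantum_algebra p) = free_eval G p" for p
  proof -
    have "quantum_rel TYPE('k) (rep_quantum_algebra (abs_quantum_algebra p :: ('n, 'k) quantum_algebra)) p"
      by (rule Quotient3_rep_abs[OF Quotient3_quantum_algebra])
        (rule equivp_reflp[OF equivp_quantum_rel])
    then have "free_eval G (rep_quantum_algebra (abs_quantum_algebra p :: ('n, 'k) quantum_algebra) - p) = 0"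
      unfolding quantum_rel_def by (rule ideal)
    then show ?thesis by (simp add: \<Phi>_def free_eval_diff)
  qed
  have ex: "\<exists>p. a = abs_quantum_algebra p" for a :: "('n, 'k) quantum_algebra"
    by (rule exI[of _ "rep_quantum_algebra a"]) (simp add: Quotient3_abs_rep[OF Quotient3_quantum_algebra])
  show ?thesis
  proof (intro exI[of _ \<Phi>] conjI allI, unfold algebra_hom_def, intro conjI allI)
    fix a b :: "('n, 'k) quantum_algebra" and c i j
    obtain p q where pq: "a = abs_quantum_algebra p" "b = abs_quantum_algebra q" using ex by blast
    show "\<Phi> (a + b) = \<Phi> a + \<Phi> b" by (simp add: pq plus_quantum_algebra.abs_eq abs free_eval_add)
    show "\<Phi> (a * b) = \<Phi> a * \<Phi> b" by (simp add: pq times_quantum_algebra.abs_eq abs free_eval_mult)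
    show "\<Phi> (c *\<^sub>C a) = c *\<^sub>C \<Phi> a"
      by (simp add: pq scaleC_quantum_algebra.abs_eq abs free_eval_mult free_eval_const mult_scaleC_left)
    show "\<Phi> 1 = 1"
      using abs[of 1] free_eval_const[of G 1] by (simp add: one_quantum_algebra_def const_one scaleC_one)
    show "\<Phi> (u_gen i j) = g i j" by (simp add: u_gen.abs_eq abs free_eval_gen G_def)
  qed
qed

section \<open>Involution, comultiplication and Haar state\<close>

lemma quantum_rel_refl: "quantum_rel k p p"
  by (rule equivp_reflp[OF equivp_quantum_rel])

lemma quantum_rel_eqI: "p = q \<Longrightarrow> quantum_rel k p q"
  by (simp add: quantum_rel_refl)

lemma free_star_free_star: "free_star (free_star p) = p"
  by (induction p rule: free_induct) (simp_all add: free_star_zero free_star_add free_star_single)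

lemma qstar_add: "qstar (a + b) = qstar a + qstar b"
  by transfer (rule quantum_rel_eqI, rule free_star_add)

lemma qstar_mult: "qstar (a * b) = qstar b * qstar a"
  by transfer (rule quantum_rel_eqI, rule free_star_mult)

lemma qstar_scale: "qstar (c *\<^sub>C a) = cnj c *\<^sub>C qstar a"
  by transfer (rule quantum_rel_eqI, simp only: free_star_mult free_star_const const_central)

lemma qstar_qstar [simp]: "qstar (qstar a) = a"
  by transfer (rule quantum_rel_eqI, rule free_star_free_star)

lemma qstar_u [simp]: "qstar (u_gen i j) = u_gen i j"
  by transfer (rule quantum_rel_eqI, rule free_star_gen)

lemma qstar_zero [simp]: "qstar 0 = 0"
  by transfer (rule quantum_rel_eqI, rule free_star_zero)

lemma qstar_one [simp]: "qstar 1 = 1"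
  by transfer (rule quantum_rel_eqI, metis const_one free_star_const complex_cnj_one)

lemma qstar_sum: "qstar (\<Sum>i\<in>A. f i) = (\<Sum>i\<in>A. qstar (f i))"
  by (induction A rule: infinite_finite_induct) (simp_all add: qstar_add)

lemma quantum_algebra_exhaust: "\<exists>p. a = abs_quantum_algebra p"
  by (rule exI[of _ "rep_quantum_algebra a"]) (simp add: Quotient3_abs_rep[OF Quotient3_quantum_algebra])

lemma comult_mult: "comult (a * b) = comult a * comult b"
proof -
  obtain p q where "a = abs_quantum_algebra p" "b = abs_quantum_algebra q"
    using quantum_algebra_exhaust by blast
  then show ?thesis by (simp add: times_quantum_algebra.abs_eq comult.abs_eq free_eval_mult)
qed

lemma comult_one: "comult 1 = 1"
  using free_eval_const[of comult_gen 1] by (simp add: one_quantum_algebra_def comult.abs_eq const_one scaleC_one)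

lemma comult_u: "comult (u_gen i j) = (\<Sum>k\<in>UNIV. u_gen i k \<otimes>\<^sub>C u_gen k j)"
  by (simp add: u_gen.abs_eq comult.abs_eq free_eval_gen comult_gen_def)

lemma slice_left_zero: "slice_left h 0 = 0"
  by transfer simp

lemma slice_left_add: "slice_left h (s + t) = slice_left h s + slice_left h t"
  by transfer simp

lemma slice_left_sum: "slice_left h (\<Sum>i\<in>A. f i) = (\<Sum>i\<in>A. slice_left h (f i))"
  by (induction A rule: infinite_finite_induct) (simp_all add: slice_left_zero slice_left_add)

lemma slice_left_tensor: "clinear_functional h \<Longrightarrow> slice_left h (a \<otimes>\<^sub>C b) = h a *\<^sub>C b"
  by transfer simp

locale haar =
  fixes h :: "('n::finite, 'k::liberation_kind) quantum_algebra \<Rightarrow> complex"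
  assumes haar: "haar_state h"
begin

lemma linear: "clinear_functional h"
  and h_one: "h 1 = 1"
  and invariant: "slice_left h (comult a) = h a *\<^sub>C 1"
  using haar unfolding haar_state_def by auto

lemma h_add: "h (a + b) = h a + h b" and h_scale: "h (c *\<^sub>C a) = c * h a"
  using linear unfolding clinear_functional_def by auto

lemma h_zero: "h 0 = 0"
  using h_scale[of 0 0] by simp

lemma h_uminus: "h (- a) = - h a"
  using h_add[of a "- a"] by (simp add: h_zero eq_neg_iff_add_eq_0 add.commute)

lemma h_diff: "h (a - b) = h a - h b"
  using h_add[of a "- b"] by (simp add: h_uminus)

lemma h_sum: "h (\<Sum>i\<in>A. f i) = (\<Sum>i\<in>A. h (f i))"
  by (induction A rule: infinite_finite_induct) (simp_all add: h_zero h_add)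

sublocale ip: semi_inner scaleC "\<lambda>a b. h (qstar a * b)"
proof unfold_locales
  fix x y z :: "('n, 'k) quantum_algebra" and c
  show "h (qstar x * (y + z)) = h (qstar x * y) + h (qstar x * z)" by (simp add: distrib_left h_add)
  show "h (qstar x * c *\<^sub>C y) = c * h (qstar x * y)" by (simp add: mult_scaleC_right h_scale)
  show "h (qstar (x + y) * z) = h (qstar x * z) + h (qstar y * z)"
    by (simp add: qstar_add distrib_right h_add)
  show "h (qstar (c *\<^sub>C x) * y) = cnj c * h (qstar x * y)"
    by (simp add: qstar_scale mult_scaleC_left h_scale)
  show "h (qstar x * x) \<in> \<real> \<and> 0 \<le> Re (h (qstar x * x))"
    using haar unfolding haar_state_def by blast
qed

lemma h_qstar: "h (qstar a) = cnj (h a)"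
  using ip.ip_commute[of a 1] by simp

end

section \<open>Words in the coefficients of an orthogonal corepresentation\<close>

text \<open>The matrix with the entries \<open>word v I J\<close> is the tensor power of the corepresentation \<open>v\<close>, with index set
  \<open>words n\<close>.\<close>
definition words :: "nat \<Rightarrow> 'm list set" where "words n = {w. length w = n}"

lemma in_words [simp]: "w \<in> words n \<longleftrightarrow> length w = n"
  by (simp add: words_def)

lemma finite_words [simp]: "finite (words n :: 'm::finite list set)"
  unfolding words_def using finite_lists_length_eq[of "UNIV :: 'm set" n] by simp

lemma words_0 [simp]: "words 0 = {[]}"
  by auto

lemma sum_words_Suc:
  "(\<Sum>w\<in>words (Suc n). F w) = (\<Sum>k\<in>(UNIV :: 'm::finite set). \<Sum>w\<in>words n. F (k # w))"
proof -
  have "words (Suc n) = (\<lambda>(k, w). k # w) ` ((UNIV :: 'm set) \<times> words n)"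
    by (auto simp: length_Suc_conv image_iff)
  moreover have "inj_on (\<lambda>(k, w). k # w) ((UNIV :: 'm set) \<times> words n)"
    by (auto simp: inj_on_def)
  ultimately have "(\<Sum>w\<in>words (Suc n). F w) = (\<Sum>(k, w)\<in>(UNIV :: 'm set) \<times> words n. F (k # w))"
    using sum.reindex[of "\<lambda>(k, w). k # w" "(UNIV :: 'm set) \<times> words n" F]
    by (simp add: case_prod_beta o_def)
  then show ?thesis by (simp add: sum.cartesian_product)
qed

lemma sum_rotate:
  "(\<Sum>k\<in>A. \<Sum>l\<in>B. \<Sum>i\<in>C. \<Sum>j\<in>D. G i j k l) = (\<Sum>i\<in>C. \<Sum>k\<in>A. \<Sum>j\<in>D. \<Sum>l\<in>B. G i j k l)"
proof -
  have "(\<Sum>k\<in>A. \<Sum>l\<in>B. \<Sum>i\<in>C. \<Sum>j\<in>D. G i j k l) = (\<Sum>k\<in>A. \<Sum>i\<in>C. \<Sum>l\<in>B. \<Sum>j\<in>D. G i j k l)"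
    by (intro sum.cong refl) (rule sum.swap)
  also have "\<dots> = (\<Sum>k\<in>A. \<Sum>i\<in>C. \<Sum>j\<in>D. \<Sum>l\<in>B. G i j k l)"
    by (intro sum.cong refl) (rule sum.swap)
  also have "\<dots> = (\<Sum>i\<in>C. \<Sum>k\<in>A. \<Sum>j\<in>D. \<Sum>l\<in>B. G i j k l)"
    by (rule sum.swap)
  finally show ?thesis .
qed

lemma sum_swap2:
  "(\<Sum>k\<in>A. \<Sum>l\<in>B. \<Sum>i\<in>C. \<Sum>j\<in>D. G i j k l) = (\<Sum>i\<in>C. \<Sum>j\<in>D. \<Sum>k\<in>A. \<Sum>l\<in>B. G i j k l)"
  by (subst sum_rotate) (intro sum.cong refl, rule sum.swap)

lemma sum_words_add:
  fixes F :: "'m::finite list \<Rightarrow> 'b::comm_monoid_add"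
  shows "(\<Sum>w\<in>words (m + n). F w) = (\<Sum>a\<in>words m. \<Sum>b\<in>words n. F (a @ b))"
  by (induction m arbitrary: F) (simp_all add: sum_words_Suc)

lemma sum_words_rev:
  fixes F :: "'m::finite list \<Rightarrow> 'b::comm_monoid_add"
  shows "(\<Sum>w\<in>words n. F (rev w)) = (\<Sum>w\<in>words n. F w)"
  by (rule sum.reindex_bij_witness[of _ rev rev]) auto

lemma sum_words_double:
  fixes F :: "'m::finite list \<Rightarrow> 'b::comm_monoid_add"
  shows "(\<Sum>W\<in>words (n + n). F W) = (\<Sum>J\<in>words n. \<Sum>L\<in>words n. F (rev J @ L))"
  by (simp add: sum_words_add sum_words_rev[of "\<lambda>J. \<Sum>L\<in>words n. F (J @ L)" n, symmetric])

definition word :: "('m \<Rightarrow> 'm \<Rightarrow> 'a::monoid_mult) \<Rightarrow> 'm list \<Rightarrow> 'm list \<Rightarrow> 'a" where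
  "word v I J = prod_list (map2 v I J)"

lemma word_simps [simp]: "word v [] J = 1" "word v (i # I) (j # J) = v i j * word v I J"
  by (simp_all add: word_def)

lemma word_append:
  "length I = length J \<Longrightarrow> word v (I @ I') (J @ J') = word v I J * word v I' J'"
  by (simp add: word_def)

lemma sum_of_bool_scale:
  fixes a :: "'m::finite \<Rightarrow> 'a::complex_algebra"
  shows "(\<Sum>k\<in>UNIV. of_bool (k = i) *\<^sub>C a k) = a i" "(\<Sum>k\<in>UNIV. of_bool (i = k) *\<^sub>C a k) = a i"
  by (simp_all add: of_bool_def if_distrib[of "\<lambda>c. c *\<^sub>C _"] scaleC_one cong: if_cong)

locale corep = haar h
  for h :: "('n::finite, 'k::liberation_kind) quantum_algebra \<Rightarrow> complex" +
  fixes v :: "'m::finite \<Rightarrow> 'm \<Rightarrow> ('n, 'k) quantum_algebra"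
  assumes v_star: "qstar (v i j) = v i j"
    and v_row: "(\<Sum>k\<in>UNIV. v i k * v j k) = of_bool (i = j) *\<^sub>C 1"
    and v_comult: "comult (v i j) = (\<Sum>k\<in>UNIV. v i k \<otimes>\<^sub>C v k j)"
begin

lemma comult_word:
  "length I = length J \<Longrightarrow>
    comult (word v I J) = (\<Sum>K\<in>words (length I). word v I K \<otimes>\<^sub>C word v K J)"
proof (induction I J rule: list_induct2)
  case Nil
  show ?case by (simp add: comult_one elem_tensor_one)
next
  case (Cons i I j J)
  then show ?case
    by (simp add: comult_mult v_comult sum_product elem_tensor_mult sum_words_Suc)
qed

lemma invariance:
  assumes "length I = length J"
  shows "(\<Sum>K\<in>words (length I). h (word v I K) *\<^sub>C word v K J) = h (word v I J) *\<^sub>C 1"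
  using invariant[of "word v I J"]
  by (simp add: comult_word[OF assms] slice_left_sum slice_left_tensor linear)

lemma qstar_word: "length I = length J \<Longrightarrow> qstar (word v I J) = word v (rev I) (rev J)"
  by (induction I J rule: list_induct2) (simp_all add: qstar_mult v_star word_append)

text \<open>The entries of \<open>V\<^sup>* \<otimes> V\<close> are entries of a tensor power of \<open>v\<close> because the generators are
  self-adjoint.\<close>
lemma word_double:
  "length I = length J \<Longrightarrow> word v (rev I @ K) (rev J @ L) = qstar (word v I J) * word v K L"
  by (simp add: word_append qstar_word)

lemma word_row:
  "length I = length K \<Longrightarrow>
    (\<Sum>J\<in>words (length I). word v I J * qstar (word v K J)) = of_bool (I = K) *\<^sub>C 1"
proof (induction I K rule: list_induct2)
  case Nil
  show ?case by (simp add: scaleC_one)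
next
  case (Cons i I j K)
  have "(\<Sum>J\<in>words (length (i # I)). word v (i # I) J * qstar (word v (j # K) J))
      = (\<Sum>k\<in>UNIV. v i k * (\<Sum>J\<in>words (length I). word v I J * qstar (word v K J)) * v j k)"
    by (simp add: sum_words_Suc qstar_mult v_star sum_distrib_left sum_distrib_right mult.assoc)
  also have "\<dots> = of_bool (I = K) *\<^sub>C (\<Sum>k\<in>UNIV. v i k * v j k)"
    by (simp add: Cons.IH mult_scaleC_left mult_scaleC_right cvec.scale_sum_right)
  also have "\<dots> = of_bool (i # I = j # K) *\<^sub>C 1"
    by (auto simp: v_row scaleC_one)
  finally show ?case .
qed

lemma word_row':
  "length I = length K \<Longrightarrow>
    (\<Sum>J\<in>words (length I). qstar (word v I J) * word v K J) = of_bool (I = K) *\<^sub>C 1"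
proof (induction I K rule: list_induct2)
  case Nil
  show ?case by (simp add: scaleC_one)
next
  case (Cons i I j K)
  have "(\<Sum>J\<in>words (length (i # I)). qstar (word v (i # I) J) * word v (j # K) J)
      = (\<Sum>J\<in>words (length I). \<Sum>k\<in>UNIV. qstar (word v I J) * (v i k * v j k) * word v K J)"
    by (subst sum.swap) (simp add: sum_words_Suc qstar_mult v_star mult.assoc)
  also have "\<dots> = (\<Sum>J\<in>words (length I). qstar (word v I J) * (\<Sum>k\<in>UNIV. v i k * v j k) * word v K J)"
    by (simp add: sum_distrib_left sum_distrib_right)
  also have "\<dots> = of_bool (i # I = j # K) *\<^sub>C 1"
    by (simp add: v_row mult_scaleC_left mult_scaleC_right cvec.scale_sum_right[symmetric] Cons.IH)
  finally show ?case .
qed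

text \<open>The matrix \<open>E = h(V)\<close> satisfies \<open>E V = E\<close>; multiplying by \<open>V\<^sup>*\<close> and applying \<open>h\<close> gives
  \<open>E E\<^sup>* = E\<close>: it is an orthogonal projection.\<close>
lemma haar_projection:
  assumes len: "length I = n" "length P = n"
  shows "(\<Sum>J\<in>words n. h (word v I J) * cnj (h (word v P J))) = h (word v I P)"
proof -
  have inv: "(\<Sum>K\<in>words n. h (word v I K) *\<^sub>C word v K J) = h (word v I J) *\<^sub>C 1"
    if "length J = n" for J
    using invariance[of I J] that len by simp
  have row: "(\<Sum>J\<in>words n. word v K J * qstar (word v P J)) = of_bool (K = P) *\<^sub>C 1"
    if "length K = n" for K
    using word_row[of K P] that len by simp
  have "(\<Sum>J\<in>words n. h (word v I J) *\<^sub>C qstar (word v P J))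
      = (\<Sum>J\<in>words n. (\<Sum>K\<in>words n. h (word v I K) *\<^sub>C word v K J) * qstar (word v P J))"
    using len by (intro sum.cong refl) (simp add: inv mult_scaleC_left)
  also have "\<dots> = (\<Sum>K\<in>words n. h (word v I K) *\<^sub>C (\<Sum>J\<in>words n. word v K J * qstar (word v P J)))"
    by (simp only: cvec.scale_sum_right sum_distrib_right mult_scaleC_left) (rule sum.swap)
  also have "\<dots> = (\<Sum>K\<in>words n. h (word v I K) *\<^sub>C of_bool (K = P) *\<^sub>C 1)"
    using row by (intro sum.cong refl) simp
  also have "\<dots> = (\<Sum>K\<in>words n. if K = P then h (word v I K) *\<^sub>C 1 else 0)"
    by (intro sum.cong refl) (simp add: scaleC_one)
  also have "\<dots> = h (word v I P) *\<^sub>C 1"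
    using len by simp
  finally have "h (\<Sum>J\<in>words n. h (word v I J) *\<^sub>C qstar (word v P J)) = h (h (word v I P) *\<^sub>C 1)"
    by simp
  then show ?thesis by (simp add: h_sum h_scale h_qstar h_one)
qed

text \<open>By the previous lemma, \<open>\<langle>\<eta>, E \<eta>\<rangle> = \<parallel>E\<^sup>* \<eta>\<parallel>\<^sup>2\<close>.\<close>
lemma haar_form_zero:
  assumes zero: "(\<Sum>I\<in>words n. \<Sum>K\<in>words n. cnj (\<eta> I) * h (word v I K) * \<eta> K) = 0"
    and J: "length J = n"
  shows "(\<Sum>I\<in>words n. cnj (\<eta> I) * h (word v I J)) = 0"
proof -
  define c where "c = (\<lambda>J. \<Sum>I\<in>words n. cnj (\<eta> I) * h (word v I J))"
  have "(\<Sum>I\<in>words n. \<Sum>K\<in>words n. cnj (\<eta> I) * h (word v I K) * \<eta> K)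
      = (\<Sum>I\<in>words n. \<Sum>K\<in>words n. \<Sum>J\<in>words n.
          (cnj (\<eta> I) * h (word v I J)) * cnj (cnj (\<eta> K) * h (word v K J)))"
  proof (intro sum.cong refl)
    fix I K :: "'m list" assume "I \<in> words n" "K \<in> words n"
    moreover have "(\<Sum>J\<in>words n. (cnj (\<eta> I) * h (word v I J)) * cnj (cnj (\<eta> K) * h (word v K J)))
        = cnj (\<eta> I) * (\<Sum>J\<in>words n. h (word v I J) * cnj (h (word v K J))) * \<eta> K"
      by (simp add: sum_distrib_left sum_distrib_right mult_ac)
    ultimately show "cnj (\<eta> I) * h (word v I K) * \<eta> K
        = (\<Sum>J\<in>words n. (cnj (\<eta> I) * h (word v I J)) * cnj (cnj (\<eta> K) * h (word v K J)))"
      by (simp only: haar_projection in_words)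
  qed
  also have "\<dots> = (\<Sum>I\<in>words n. \<Sum>J\<in>words n. \<Sum>K\<in>words n.
          (cnj (\<eta> I) * h (word v I J)) * cnj (cnj (\<eta> K) * h (word v K J)))"
    by (rule sum.cong[OF refl], rule sum.swap)
  also have "\<dots> = (\<Sum>J\<in>words n. c J * cnj (c J))"
    by (subst sum.swap) (simp only: c_def cnj_sum sum_product)
  also have "\<dots> = of_real (\<Sum>J\<in>words n. (cmod (c J))\<^sup>2)"
    by (simp add: complex_norm_square[symmetric])
  finally have "(\<Sum>J\<in>words n. (cmod (c J))\<^sup>2) = 0" using zero by (metis of_real_eq_0_iff)
  then have "(cmod (c J))\<^sup>2 = 0"
    using J by (subst (asm) sum_nonneg_eq_0_iff) auto
  then show ?thesis by (simp add: c_def)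
qed

text \<open>Since \<open>V\<^sup>* \<otimes> V\<close> fixes the vector \<open>\<Sum>J. J \<otimes> J\<close>, its Haar projection does not annihilate
  \<open>p\<^sup>* \<otimes> p\<close> for \<open>p \<noteq> 0\<close>.\<close>
lemma diagonal_coefficient_null:
  assumes null: "h (qstar b * b) = 0"
    and b: "b = (\<Sum>I\<in>words n. \<Sum>J\<in>words n. (cnj (p I) * p J) *\<^sub>C word v I J)"
    and I: "length I = n"
  shows "p I = 0"
proof -
  define \<eta> where "\<eta> = (\<lambda>W. cnj (p (rev (take n W))) * p (drop n W))"
  define \<xi> where "\<xi> = (\<lambda>W :: 'm list. of_bool (rev (take n W) = drop n W) :: complex)"
  have "h (qstar b * b) = (\<Sum>K\<in>words n. \<Sum>L\<in>words n. \<Sum>I\<in>words n. \<Sum>J\<in>words n.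
      (p I * cnj (p J)) * ((cnj (p K) * p L) * h (qstar (word v I J) * word v K L)))"
    unfolding b ip.ip_sum_left ip.ip_sum_right
    by (simp add: qstar_scale mult_scaleC_left mult_scaleC_right h_scale mult_ac)
  also have "\<dots> = (\<Sum>I\<in>words n. \<Sum>K\<in>words n. \<Sum>J\<in>words n. \<Sum>L\<in>words n.
      cnj (\<eta> (rev I @ K)) * h (word v (rev I @ K) (rev J @ L)) * \<eta> (rev J @ L))"
    by (subst sum_rotate) (intro sum.cong refl, simp add: \<eta>_def word_double mult_ac)
  also have "\<dots> = (\<Sum>W\<in>words (n + n). \<Sum>Z\<in>words (n + n). cnj (\<eta> W) * h (word v W Z) * \<eta> Z)"
    by (simp only: sum_words_double)
  finally have zero: "\<dots> = 0" using null by simp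
  have fixed: "(\<Sum>Z\<in>words (n + n). \<xi> Z * h (word v W Z)) = \<xi> W" if W: "length W = n + n" for W
  proof -
    obtain A B where AB: "W = rev A @ B" "length A = n" "length B = n"
      using W by (intro that[of "rev (take n W)" "drop n W"]) auto
    have "(\<Sum>Z\<in>words (n + n). \<xi> Z * h (word v W Z))
        = (\<Sum>J\<in>words n. \<Sum>L\<in>words n. if L = J then h (qstar (word v A J) * word v B L) else 0)"
      unfolding sum_words_double by (intro sum.cong refl) (auto simp: \<xi>_def AB word_double)
    also have "\<dots> = h (\<Sum>J\<in>words n. qstar (word v A J) * word v B J)"
      by (simp add: h_sum)
    also have "\<dots> = \<xi> W"
      using word_row'[of A B] AB by (auto simp add: \<xi>_def h_scale h_one)
    finally show ?thesis .
  qed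
  have "(\<Sum>W\<in>words (n + n). cnj (\<eta> W) * \<xi> W)
      = (\<Sum>W\<in>words (n + n). cnj (\<eta> W) * (\<Sum>Z\<in>words (n + n). \<xi> Z * h (word v W Z)))"
    by (intro sum.cong refl) (simp add: fixed)
  also have "\<dots> = (\<Sum>Z\<in>words (n + n). \<xi> Z * (\<Sum>W\<in>words (n + n). cnj (\<eta> W) * h (word v W Z)))"
    by (simp only: sum_distrib_left, subst sum.swap) (simp add: mult_ac)
  also have "\<dots> = 0"
    by (rule sum.neutral) (use haar_form_zero[OF zero] in simp)
  finally have "(\<Sum>W\<in>words (n + n). cnj (\<eta> W) * \<xi> W) = 0" .
  moreover have "(\<Sum>W\<in>words (n + n). cnj (\<eta> W) * \<xi> W)
      = (\<Sum>J\<in>words n. \<Sum>L\<in>words n. if L = J then p J * cnj (p L) else 0)"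
    unfolding sum_words_double by (intro sum.cong refl) (auto simp: \<xi>_def \<eta>_def)
  moreover have "\<dots> = of_real (\<Sum>J\<in>words n. (cmod (p J))\<^sup>2)"
    by (simp add: complex_norm_square[symmetric])
  ultimately have "(\<Sum>J\<in>words n. (cmod (p J))\<^sup>2) = 0" by (metis of_real_eq_0_iff)
  then show ?thesis using I by (subst (asm) sum_nonneg_eq_0_iff) auto
qed

definition row_vector :: "nat \<Rightarrow> ('m list \<Rightarrow> complex) \<Rightarrow> 'm list \<Rightarrow> ('n, 'k) quantum_algebra" where
  "row_vector n r J = (\<Sum>I\<in>words n. r I *\<^sub>C word v I J)"

definition gram :: "nat \<Rightarrow> ('m list \<Rightarrow> complex) \<Rightarrow> 'm list \<Rightarrow> 'm list \<Rightarrow> complex" where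
  "gram n r J K = h (qstar (row_vector n r J) * row_vector n r K)"

lemma gram_invariant:
  assumes len: "length J = n" "length K = n"
  shows "(\<Sum>P\<in>words n. \<Sum>Q\<in>words n. gram n r P Q *\<^sub>C (qstar (word v P J) * word v Q K))
    = gram n r J K *\<^sub>C 1"
proof -
  have gram: "gram n r J K = (\<Sum>B\<in>words n. \<Sum>A\<in>words n.
      (cnj (r A) * r B) * h (qstar (word v A J) * word v B K))" for J K
    unfolding gram_def row_vector_def ip.ip_sum_left ip.ip_sum_right
    by (simp add: qstar_scale mult_scaleC_left mult_scaleC_right h_scale mult_ac)
  have inv: "(\<Sum>P\<in>words n. \<Sum>Q\<in>words n.
      h (qstar (word v A P) * word v B Q) *\<^sub>C (qstar (word v P J) * word v Q K))
    = h (qstar (word v A J) * word v B K) *\<^sub>C 1" if "length A = n" "length B = n" for A B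
  proof -
    have "(\<Sum>W\<in>words (n + n). h (word v (rev A @ B) W) *\<^sub>C word v W (rev J @ K))
        = h (word v (rev A @ B) (rev J @ K)) *\<^sub>C 1"
      using invariance[of "rev A @ B" "rev J @ K"] len that by simp
    then show ?thesis
      using len that by (simp add: sum_words_double word_double cong: sum.cong_simp)
  qed
  have "(\<Sum>P\<in>words n. \<Sum>Q\<in>words n. gram n r P Q *\<^sub>C (qstar (word v P J) * word v Q K))
      = (\<Sum>P\<in>words n. \<Sum>Q\<in>words n. \<Sum>B\<in>words n. \<Sum>A\<in>words n. (cnj (r A) * r B) *\<^sub>C
          (h (qstar (word v A P) * word v B Q) *\<^sub>C (qstar (word v P J) * word v Q K)))"
    by (simp add: gram cvec.scale_sum_left scaleC_scaleC)
  also have "\<dots> = (\<Sum>B\<in>words n. \<Sum>A\<in>words n. \<Sum>P\<in>words n. \<Sum>Q\<in>words n. (cnj (r A) * r B) *\<^sub>C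
          (h (qstar (word v A P) * word v B Q) *\<^sub>C (qstar (word v P J) * word v Q K)))"
    by (rule sum_swap2)
  also have "\<dots> = (\<Sum>B\<in>words n. \<Sum>A\<in>words n. (cnj (r A) * r B) *\<^sub>C
          (h (qstar (word v A J) * word v B K) *\<^sub>C 1))"
    by (intro sum.cong refl) (simp only: cvec.scale_sum_right[symmetric] inv in_words)
  also have "\<dots> = gram n r J K *\<^sub>C 1"
    by (simp add: gram cvec.scale_sum_left scaleC_scaleC)
  finally show ?thesis .
qed

text \<open>Invariance of the Gram matrix \<open>M\<close> reads \<open>V\<^sup>* M V = M\<close>, and \<open>V\<close> is unitary.\<close>
lemma gram_commute:
  assumes len: "length P = n" "length K = n"
  shows "(\<Sum>Q\<in>words n. gram n r P Q *\<^sub>C word v Q K) = (\<Sum>J\<in>words n. gram n r J K *\<^sub>C word v P J)"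
proof -
  have row: "(\<Sum>J\<in>words n. word v P J * qstar (word v A J)) = of_bool (P = A) *\<^sub>C 1"
    if "length A = n" for A
    using word_row[of P A] that len by simp
  have "(\<Sum>J\<in>words n. gram n r J K *\<^sub>C word v P J)
      = (\<Sum>J\<in>words n. word v P J * (gram n r J K *\<^sub>C 1))"
    by (simp add: mult_scaleC_right)
  also have "\<dots> = (\<Sum>J\<in>words n. \<Sum>A\<in>words n. \<Sum>Q\<in>words n.
      gram n r A Q *\<^sub>C (word v P J * qstar (word v A J) * word v Q K))"
    using len by (intro sum.cong refl)
      (simp add: gram_invariant[symmetric] sum_distrib_left mult_scaleC_right mult.assoc)
  also have "\<dots> = (\<Sum>A\<in>words n. \<Sum>Q\<in>words n. \<Sum>J\<in>words n.
      gram n r A Q *\<^sub>C (word v P J * qstar (word v A J) * word v Q K))"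
    by (subst sum.swap, rule sum.cong[OF refl], rule sum.swap)
  also have "\<dots> = (\<Sum>A\<in>words n. \<Sum>Q\<in>words n. gram n r A Q *\<^sub>C (of_bool (P = A) *\<^sub>C word v Q K))"
    by (intro sum.cong refl)
      (simp add: cvec.scale_sum_right[symmetric] sum_distrib_right[symmetric] row mult_scaleC_left)
  also have "\<dots> = (\<Sum>A\<in>words n. if A = P then \<Sum>Q\<in>words n. gram n r A Q *\<^sub>C word v Q K else 0)"
    by (intro sum.cong refl) (auto simp: scaleC_one)
  also have "\<dots> = (\<Sum>Q\<in>words n. gram n r P Q *\<^sub>C word v Q K)"
    using len by simp
  finally show ?thesis by simp
qed

text \<open>Decompose the conjugate of the row \<open>r\<close> as \<open>p + M s\<close> with \<open>M p = 0\<close> for the Gram matrix \<open>M\<close>.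
  As \<open>M\<close> commutes with \<open>V\<close>, replacing \<open>r\<close> by \<open>p\<close> does not change the coefficients \<open>r V c\<close> with
  \<open>M c = 0\<close>. In particular \<open>p\<^sup>* V p\<close> is a null vector, so that \<open>p = 0\<close>.\<close>
lemma row_faithful:
  assumes null: "h (qstar a * a) = 0" and a: "a = (\<Sum>J\<in>words n. c J *\<^sub>C row_vector n r J)"
  shows "a = 0"
proof -
  let ?M = "gram n r"
  interpret F: semi_inner "\<lambda>c (x :: 'm list \<Rightarrow> complex) J. c * x J"
    "\<lambda>x y. \<Sum>J\<in>words n. cnj (x J) * y J"
  proof unfold_locales
    fix x :: "'m list \<Rightarrow> complex"
    have "(\<Sum>J\<in>words n. cnj (x J) * x J) = of_real (\<Sum>J\<in>words n. (cmod (x J))\<^sup>2)"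
      by (simp add: complex_norm_square[symmetric] mult.commute)
    then show "(\<Sum>J\<in>words n. cnj (x J) * x J) \<in> \<real> \<and> 0 \<le> Re (\<Sum>J\<in>words n. cnj (x J) * x J)"
      by (simp add: sum_nonneg)
  qed (auto simp: fun_eq_iff algebra_simps sum.distrib sum_distrib_left)
  have M_cnj: "cnj (?M J K) = ?M K J" for J K
    unfolding gram_def by (rule ip.ip_commute[symmetric])
  obtain w where w: "w \<in> F.span ((\<lambda>K J. ?M J K) ` words n)"
    "\<And>s. s \<in> (\<lambda>K J. ?M J K) ` words n \<Longrightarrow> (\<Sum>J\<in>words n. cnj (s J) * ((\<lambda>J. cnj (r J)) - w) J) = 0"
    using F.orthogonal_decomposition[of "(\<lambda>K J. ?M J K) ` words n" "\<lambda>J. cnj (r J)"] by auto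
  obtain s where s: "w = (\<Sum>K\<in>words n. (\<lambda>J. s K * ?M J K))"
    using F.span_image_finite[OF finite_words w(1)] by auto
  define p where "p = (\<lambda>J. cnj (r J) - w J)"
  have Mp: "(\<Sum>J\<in>words n. ?M K J * p J) = 0" if "length K = n" for K
    using w(2)[of "\<lambda>J. ?M J K"] that by (auto simp: p_def M_cnj)
  have r: "r I = cnj (p I) + (\<Sum>K\<in>words n. cnj (s K) * ?M K I)" for I
  proof -
    have "(\<Sum>K\<in>A. F K) I = (\<Sum>K\<in>A. F K I)" for A and F :: "'m list \<Rightarrow> 'm list \<Rightarrow> complex"
      by (induction A rule: infinite_finite_induct) simp_all
    then have "w I = (\<Sum>K\<in>words n. s K * ?M I K)" by (simp add: s)
    then show ?thesis by (simp add: p_def M_cnj)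
  qed
  have swap: "(\<Sum>J\<in>words n. d J *\<^sub>C row_vector n r J)
      = (\<Sum>I\<in>words n. \<Sum>J\<in>words n. (cnj (p I) * d J) *\<^sub>C word v I J)"
    if d: "\<And>K. length K = n \<Longrightarrow> (\<Sum>J\<in>words n. ?M K J * d J) = 0" for d
  proof -
    have "(\<Sum>J\<in>words n. \<Sum>I\<in>words n. (\<Sum>K\<in>words n. d J * (cnj (s K) * ?M K I)) *\<^sub>C word v I J)
        = (\<Sum>J\<in>words n. \<Sum>K\<in>words n. (d J * cnj (s K)) *\<^sub>C (\<Sum>I\<in>words n. ?M K I *\<^sub>C word v I J))"
      by (rule sum.cong[OF refl])
        (simp add: cvec.scale_sum_left cvec.scale_sum_right scaleC_scaleC mult.assoc, rule sum.swap)
    also have "\<dots> = (\<Sum>J\<in>words n. \<Sum>K\<in>words n. \<Sum>I\<in>words n. (cnj (s K) * (?M I J * d J)) *\<^sub>C word v K I)"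
      by (intro sum.cong refl) (simp add: gram_commute cvec.scale_sum_right scaleC_scaleC mult_ac)
    also have "\<dots> = (\<Sum>K\<in>words n. \<Sum>I\<in>words n. \<Sum>J\<in>words n. (cnj (s K) * (?M I J * d J)) *\<^sub>C word v K I)"
      by (subst sum.swap, rule sum.cong[OF refl], rule sum.swap)
    also have "\<dots> = 0"
      by (simp add: cvec.scale_sum_left[symmetric] sum_distrib_left[symmetric] d)
    finally have zero: "(\<Sum>J\<in>words n. \<Sum>I\<in>words n. (\<Sum>K\<in>words n. d J * (cnj (s K) * ?M K I)) *\<^sub>C word v I J) = 0" .
    have "(\<Sum>J\<in>words n. d J *\<^sub>C row_vector n r J)
        = (\<Sum>J\<in>words n. \<Sum>I\<in>words n. (d J * cnj (p I)) *\<^sub>C word v I J)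
          + (\<Sum>J\<in>words n. \<Sum>I\<in>words n. (\<Sum>K\<in>words n. d J * (cnj (s K) * ?M K I)) *\<^sub>C word v I J)"
      by (simp add: row_vector_def cvec.scale_sum_right scaleC_scaleC r distrib_left scaleC_add_left
          scaleC_add_right sum.distrib sum_distrib_left)
    also have "\<dots> = (\<Sum>I\<in>words n. \<Sum>J\<in>words n. (cnj (p I) * d J) *\<^sub>C word v I J)"
      unfolding zero by (subst sum.swap) (simp add: mult.commute)
    finally show ?thesis .
  qed
  have "(\<Sum>J\<in>words n. ?M K J * c J) = 0" if "length K = n" for K
    using ip.ip_null(1)[OF null, of "row_vector n r K"]
    unfolding gram_def by (simp add: a ip.ip_sum_right mult_scaleC_right h_scale mult.commute sum_distrib_left h_sum)
  then have a': "a = (\<Sum>I\<in>words n. \<Sum>J\<in>words n. (cnj (p I) * c J) *\<^sub>C word v I J)"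
    unfolding a by (rule swap)
  define b where "b = (\<Sum>J\<in>words n. p J *\<^sub>C row_vector n r J)"
  have "h (qstar b * b) = (\<Sum>J\<in>words n. p J * h (qstar b * row_vector n r J))"
    unfolding b_def ip.ip_sum_right by (simp add: mult_scaleC_right h_scale)
  also have "\<dots> = (\<Sum>J\<in>words n. \<Sum>K\<in>words n. p J * (cnj (p K) * ?M K J))"
    unfolding b_def ip.ip_sum_left gram_def
    by (simp add: qstar_scale mult_scaleC_left h_scale sum_distrib_left)
  also have "\<dots> = (\<Sum>K\<in>words n. cnj (p K) * (\<Sum>J\<in>words n. ?M K J * p J))"
    by (subst sum.swap) (simp add: sum_distrib_left mult_ac)
  also have "\<dots> = 0" by (rule sum.neutral) (simp add: Mp)
  finally have "h (qstar b * b) = 0" .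
  then have "p I = 0" if "length I = n" for I
    using diagonal_coefficient_null[of b p n I] swap[of p] Mp that by (simp add: b_def)
  then show ?thesis by (simp add: a')
qed

end

section \<open>Dimensions\<close>

context vector_space
begin

lemma card_le_dim_family:
  assumes "finite P" "finite F" "V \<subseteq> span F" "a ` P \<subseteq> V"
    and zero: "\<And>k p. (\<Sum>p\<in>P. scale (k p) (a p)) = 0 \<Longrightarrow> p \<in> P \<Longrightarrow> k p = 0"
  shows "card P \<le> dim V"
proof -
  have inj: "inj_on a P"
  proof (rule inj_onI, rule ccontr)
    fix p q assume pq: "p \<in> P" "q \<in> P" "a p = a q" "p \<noteq> q"
    have "(\<Sum>x\<in>P. scale (of_bool (x = p) - of_bool (x = q)) (a x)) = 0"
      using pq assms(1)
      by (simp add: scale_left_diff_distrib sum_subtractf of_bool_def if_distrib[of "\<lambda>c. scale c _"] cong: if_cong)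
    from zero[OF this pq(1)] pq(4) show False by simp
  qed
  have indep: "independent (a ` P)"
  proof (rule independent_if_scalars_zero)
    fix f x assume "(\<Sum>x\<in>a ` P. scale (f x) x) = 0" "x \<in> a ` P"
    then show "f x = 0" using zero[of "\<lambda>p. f (a p)"] by (auto simp: sum.reindex[OF inj])
  qed (use assms(1) in simp)
  obtain B where B: "B \<subseteq> V" "independent B" "V \<subseteq> span B" "card B = dim V"
    using basis_exists by blast
  have "finite B" using independent_span_bound[OF assms(2) B(2)] B(1) assms(3) by blast
  then have "card (a ` P) \<le> card B"
    using independent_span_bound[OF _ indep, of B] assms(4) B(3) by blast
  then show ?thesis by (simp add: card_image[OF inj] B(4))
qed

lemma dim_direct_sum:
  assumes F: "finite F" "V = span F" and U: "subspace U" "U \<subseteq> V" and W: "subspace W" "W \<subseteq> V"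
    and zero: "\<And>x. x \<in> U \<Longrightarrow> x \<in> W \<Longrightarrow> x = 0"
    and sum: "\<And>x. x \<in> V \<Longrightarrow> \<exists>u\<in>U. x - u \<in> W"
  shows "dim V = dim U + dim W"
proof -
  obtain B where B: "B \<subseteq> U" "independent B" "U \<subseteq> span B" "card B = dim U"
    using basis_exists by blast
  obtain C where C: "C \<subseteq> W" "independent C" "W \<subseteq> span C" "card C = dim W"
    using basis_exists by blast
  have fB: "finite B" using independent_span_bound[OF F(1) B(2)] B(1) U(2) F(2) by blast
  have fC: "finite C" using independent_span_bound[OF F(1) C(2)] C(1) W(2) F(2) by blast
  have spanB: "span B = U" using span_minimal[OF B(1) U(1)] B(3) by blast
  have spanC: "span C = W" using span_minimal[OF C(1) W(1)] C(3) by blast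
  have "independent (B \<union> C') \<and> B \<inter> C' = {}" if "finite C'" "C' \<subseteq> C" for C'
    using that
  proof (induction C')
    case empty
    then show ?case using B(2) by simp
  next
    case (insert c C')
    have "c \<notin> span (C - {c})" using insert.prems C(2) unfolding dependent_def by blast
    moreover have "span C' \<subseteq> span (C - {c})" using insert by (intro span_mono) auto
    ultimately have c: "c \<notin> span C'" by blast
    have c': "c \<notin> span (B \<union> C')"
    proof
      assume "c \<in> span (B \<union> C')"
      then obtain x y where xy: "c = x + y" "x \<in> U" "y \<in> span C'" by (auto simp: span_Un spanB)
      have "y \<in> W" using xy(3) insert.prems span_mono[of C' C] spanC by blast
      moreover have "c \<in> W" using insert.prems C(1) by blast
      ultimately have "c - y \<in> W" using W(1) by (simp add: subspace_diff)
      then have "x = 0" using xy zero[of x] by simp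
      then show False using xy c by simp
    qed
    then have "c \<notin> B" using span_base[of c "B \<union> C'"] by blast
    moreover have "independent (insert c (B \<union> C'))"
      using c' insert by (intro independent_insertI) auto
    ultimately show ?case using insert by simp
  qed
  from this[OF fC] have BC: "independent (B \<union> C)" "B \<inter> C = {}" by auto
  have "V \<subseteq> span (B \<union> C)"
  proof
    fix x assume "x \<in> V"
    then obtain u where "u \<in> U" "x - u \<in> W" using sum by blast
    moreover have "x = u + (x - u)" by simp
    ultimately show "x \<in> span (B \<union> C)" unfolding span_Un spanB spanC by blast
  qed
  then have "dim V = card (B \<union> C)"
    using BC B(1) C(1) U(2) W(2) by (intro dim_unique) auto
  also have "\<dots> = dim U + dim W" using fB fC BC(2) B(4) C(4) by (simp add: card_Un_disjoint)
  finally show ?thesis .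
qed

end

abbreviation row_word :: "'n \<Rightarrow> 'n list \<Rightarrow> ('n::finite, 'k::liberation_kind) quantum_algebra" where
  "row_word e J \<equiv> prod_list (map (u_gen e) J)"

lemma sphere_H_eq: "sphere_H e k = cspan (row_word e ` {J. length J \<le> k})"
  unfolding sphere_H_def by (rule arg_cong[of _ _ cspan]) auto

lemma finite_short_words [simp]: "finite {J :: 'n::finite list. length J \<le> k}"
  using finite_lists_length_le[of "UNIV :: 'n set" k] by simp

lemma row_word_in_H: "length J \<le> k \<Longrightarrow> row_word e J \<in> sphere_H e k"
  unfolding sphere_H_eq by (rule cvec.span_base) auto

lemma sphere_H_mono: "k \<le> l \<Longrightarrow> sphere_H e k \<subseteq> sphere_H e l"
  unfolding sphere_H_eq by (rule cvec.span_mono) auto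

lemma subspace_sphere_H: "cvec.subspace (sphere_H e k)"
  unfolding sphere_H_eq by (rule cvec.subspace_span)

text \<open>The direct sum of the trivial and the fundamental corepresentation: words of length \<open>k\<close> in its
  coefficients account for all words of length at most \<open>k\<close> in the generators.\<close>
fun augmented :: "'n option \<Rightarrow> 'n option \<Rightarrow> ('n::finite, 'k::liberation_kind) quantum_algebra" where
  "augmented (Some i) (Some j) = u_gen i j"
| "augmented None None = 1"
| "augmented _ _ = 0"

lemma sum_option: "(\<Sum>k\<in>UNIV. F k) = F None + (\<Sum>k\<in>(UNIV :: 'n::finite set). F (Some k))"
  unfolding UNIV_option_conv by (simp add: sum.reindex)

context haar
begin

sublocale aug: corep h augmented
proof
  fix i j :: "'n option"
  show "qstar (augmented i j) = (augmented i j :: ('n, 'k) quantum_algebra)"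
    by (cases i; cases j) auto
  show "(\<Sum>k\<in>UNIV. augmented i k * augmented j k) = of_bool (i = j) *\<^sub>C (1 :: ('n, 'k) quantum_algebra)"
    by (cases i; cases j) (simp_all add: sum_option u_gen_row scaleC_one)
  show "comult (augmented i j) =
      (\<Sum>k\<in>UNIV. augmented i k \<otimes>\<^sub>C (augmented k j :: ('n, 'k) quantum_algebra))"
    by (cases i; cases j)
      (simp_all add: sum_option comult_u comult_one elem_tensor_one,
       simp_all add: comult.abs_eq zero_quantum_algebra_def free_eval_zero)
qed

sublocale fund: corep h u_gen
  by unfold_locales (simp_all add: u_gen_row comult_u)

text \<open>The first row is the vector \<open>None + e\<close> contracted with the augmented corepresentation.\<close>
lemma sphere_H_faithful:
  assumes a: "a \<in> sphere_H e k" and null: "h (qstar a * a) = 0"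
  shows "a = 0"
proof -
  define \<rho> where "\<rho> = (\<lambda>j. (case j of None \<Rightarrow> 1 | Some i \<Rightarrow> of_bool (i = e)) :: complex)"
  define y where "y = (\<lambda>j. (case j of None \<Rightarrow> 1 | Some j \<Rightarrow> u_gen e j) :: ('n, 'k) quantum_algebra)"
  define r where "r = (\<lambda>I. prod_list (map \<rho> I))"
  have y: "y j = (\<Sum>i\<in>UNIV. \<rho> i *\<^sub>C augmented i j)" for j
    by (cases j) (simp_all add: sum_option y_def \<rho>_def scaleC_one sum_of_bool_scale)
  have row: "aug.row_vector n r J = prod_list (map y J)" if "length J = n" for n J
    using that
  proof (induction J arbitrary: n)
    case Nil
    then show ?case by (simp add: aug.row_vector_def r_def scaleC_one)
  next
    case (Cons j J)
    then obtain m where m: "n = Suc m" "length J = m" by auto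
    have "aug.row_vector n r (j # J)
        = (\<Sum>i\<in>UNIV. \<Sum>I\<in>words m. (\<rho> i *\<^sub>C augmented i j) * (r I *\<^sub>C word augmented I J))"
      by (simp add: aug.row_vector_def m(1) sum_words_Suc r_def mult_scaleC_left mult_scaleC_right scaleC_scaleC mult.commute)
    also have "\<dots> = y j * aug.row_vector m r J"
      by (simp add: y aug.row_vector_def sum_product)
    finally show ?case using Cons.IH[OF m(2)] by simp
  qed
  have "row_word e ` {J. length J \<le> k} \<subseteq> aug.row_vector k r ` words k"
  proof clarify
    fix J :: "'n list" assume J: "length J \<le> k"
    let ?J = "map Some J @ replicate (k - length J) None"
    have "row_word e J = prod_list (map y ?J)" by (simp add: y_def o_def prod_list_replicate)
    also have "\<dots> = aug.row_vector k r ?J" by (rule row[symmetric]) (use J in simp)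
    finally show "row_word e J \<in> aug.row_vector k r ` words k" using J by auto
  qed
  then have "a \<in> cspan (aug.row_vector k r ` words k)"
    using a cvec.span_mono unfolding sphere_H_eq by blast
  then obtain c where "a = (\<Sum>J\<in>words k. c J *\<^sub>C aug.row_vector k r J)"
    using ip.span_image_finite[OF finite_words] unfolding cspan_def by metis
  then show ?thesis by (rule aug.row_faithful[OF null])
qed

lemma subspace_sphere_D: "cvec.subspace (sphere_D e h s)"
  unfolding sphere_D_def cvec.subspace_def
  using subspace_sphere_H[of e s] by (auto simp: cvec.subspace_def h_zero distrib_left h_add mult_scaleC_right h_scale)

lemma dim_sphere_H_Suc:
  "cdim (sphere_H e (Suc s) :: ('n, 'k) quantum_algebra set) = cdim (sphere_H e s :: ('n, 'k) quantum_algebra set) + cdim (sphere_D e h (Suc s))"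
proof (rule cvec.dim_direct_sum)
  show "finite (row_word e ` {J. length J \<le> Suc s} :: ('n, 'k) quantum_algebra set)" by simp
  show "sphere_H e (Suc s) = cspan (row_word e ` {J. length J \<le> Suc s} :: ('n, 'k) quantum_algebra set)"
    by (rule sphere_H_eq)
  show "sphere_H e s \<subseteq> (sphere_H e (Suc s) :: ('n, 'k) quantum_algebra set)" by (rule sphere_H_mono) simp
  show "sphere_D e h (Suc s) \<subseteq> sphere_H e (Suc s)" by (auto simp: sphere_D_def)
  show "x = 0" if "x \<in> sphere_H e s" "x \<in> sphere_D e h (Suc s)" for x
    by (rule sphere_H_faithful[OF that(1)]) (use that in \<open>auto simp: sphere_D_def\<close>)
  show "\<exists>u\<in>sphere_H e s. x - u \<in> sphere_D e h (Suc s)" if x: "x \<in> sphere_H e (Suc s)" for x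
  proof -
    let ?S = "row_word e ` {J. length J \<le> s} :: ('n, 'k) quantum_algebra set"
    obtain u where u: "u \<in> cvec.span ?S" "\<And>b. b \<in> ?S \<Longrightarrow> h (qstar b * (x - u)) = 0"
      using ip.orthogonal_decomposition[of ?S x] unfolding cspan_def by auto
    have uH: "u \<in> sphere_H e s" using u(1) by (simp add: sphere_H_eq cspan_def)
    have "u \<in> sphere_H e (Suc s)" using uH sphere_H_mono[of s "Suc s" e] by auto
    then have "x - u \<in> sphere_H e (Suc s)" using x subspace_sphere_H cvec.subspace_diff by blast
    moreover have "h (qstar b * (x - u)) = 0" if "b \<in> sphere_H e s" for b
      using ip.orthogonal_span[of ?S "x - u" b] u(2) that by (auto simp: sphere_H_eq cspan_def)
    ultimately have "x - u \<in> sphere_D e h (Suc s)" by (simp add: sphere_D_def)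
    with uH show ?thesis by blast
  qed
qed (rule subspace_sphere_H subspace_sphere_D)+

lemma dim_sphere_H:
  "cdim (sphere_H e S :: ('n, 'k) quantum_algebra set) = cdim (sphere_H e 0 :: ('n, 'k) quantum_algebra set) + (\<Sum>s=1..S. cdim (sphere_D e h s))"
  by (induction S) (simp_all add: dim_sphere_H_Suc)

end

section \<open>Growth and spectral dimension\<close>

lemma spectral_dimension_eqI:
  assumes "0 \<le> a"
    and lower: "\<And>d. 0 < d \<Longrightarrow> summable (\<lambda>s. real (m (Suc s)) * (- lam (Suc s)) powr (- d / 2)) \<Longrightarrow> a \<le> d"
    and upper: "\<And>d. a < d \<Longrightarrow> summable (\<lambda>s. real (m (Suc s)) * (- lam (Suc s)) powr (- d / 2))"
  shows "spectral_dimension m lam = ereal a"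
  unfolding spectral_dimension_def
proof (rule antisym)
  let ?D = "ereal ` {d. d > 0 \<and> summable (\<lambda>s. real (m (Suc s)) * (- lam (Suc s)) powr (- d / 2))}"
  show "ereal a \<le> Inf ?D" by (rule Inf_greatest) (use lower in auto)
  show "Inf ?D \<le> ereal a"
  proof (rule ereal_le_epsilon2)
    fix r :: real assume "0 < r"
    have "0 < a + r" "a < a + r" using assms(1) \<open>0 < r\<close> by simp_all
    then have "ereal (a + r) \<in> ?D" using upper by (intro imageI CollectI conjI) blast+
    then show "Inf ?D \<le> ereal a + ereal r" by (simp add: Inf_lower)
  qed
qed

text \<open>Among the first \<open>S\<close> terms, no weight is smaller than \<open>(B S\<^sup>r)\<^bsup>-d/2\<^esup>\<close>.\<close>
lemma summable_imp_growth_bound: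
  assumes lam: "\<And>s. 1 \<le> s \<Longrightarrow> 0 < - lam s \<and> - lam s \<le> B * real s ^ r"
    and "0 < d" and sum: "summable (\<lambda>s. real (m (Suc s)) * (- lam (Suc s)) powr (- d / 2))"
  shows "\<exists>C\<ge>0. \<forall>S\<ge>1. real (\<Sum>s=1..S. m s) \<le> C * real S powr (real r * d / 2)"
proof -
  define f where "f = (\<lambda>s. real (m (Suc s)) * (- lam (Suc s)) powr (- d / 2))"
  have f: "summable f" "\<And>s. 0 \<le> f s" using sum by (auto simp: f_def)
  have B: "0 < B" using lam[of 1] by simp
  have "real (\<Sum>s=1..S. m s) \<le> (suminf f * B powr (d / 2)) * real S powr (real r * d / 2)" if S: "S \<ge> 1" for S
  proof -
    define b where "b = B * real S ^ r"
    have b: "b > 0" using B S by (simp add: b_def)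
    have "real (\<Sum>s=1..S. m s) * b powr (- d / 2) = (\<Sum>s<S. real (m (Suc s)) * b powr (- d / 2))"
      by (simp add: sum_distrib_right sum.atLeast1_atMost_eq)
    also have "\<dots> \<le> (\<Sum>s<S. f s)"
    proof (rule sum_mono)
      fix s assume s: "s \<in> {..<S}"
      have "- lam (Suc s) \<le> B * real (Suc s) ^ r" using lam[of "Suc s"] by simp
      also have "\<dots> \<le> b" unfolding b_def using B s by (intro mult_left_mono power_mono) auto
      finally have "b powr (- d / 2) \<le> (- lam (Suc s)) powr (- d / 2)"
        using lam[of "Suc s"] \<open>0 < d\<close> by (intro powr_mono2') auto
      then show "real (m (Suc s)) * b powr (- d / 2) \<le> f s" by (simp add: f_def mult_left_mono)
    qed
    also have "\<dots> \<le> suminf f" using f by (intro sum_le_suminf) auto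
    finally have "real (\<Sum>s=1..S. m s) \<le> suminf f * b powr (d / 2)"
      using b by (simp add: powr_minus field_simps)
    also have "b powr (d / 2) = B powr (d / 2) * real S powr (real r * d / 2)"
      using B S by (simp add: b_def powr_mult powr_realpow[symmetric] powr_powr)
    finally show ?thesis by (simp add: mult.assoc)
  qed
  then show ?thesis using f by (intro exI[of _ "suminf f * B powr (d / 2)"]) (simp add: suminf_nonneg)
qed

lemma power_le_powr_imp_le:
  assumes "\<And>k::nat. 1 \<le> k \<Longrightarrow> real k ^ a \<le> c + C * real k powr d" "0 \<le> c" "0 \<le> d"
  shows "real a \<le> d"
proof (rule ccontr)
  assume "\<not> real a \<le> d"
  then have "filterlim (\<lambda>k::nat. real k powr (real a - d)) at_top sequentially"
    by real_asymp
  then have "eventually (\<lambda>k. real k powr (real a - d) > c + C) sequentially"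
    by (simp add: filterlim_at_top_dense)
  moreover have "eventually (\<lambda>k. k \<ge> (1::nat)) sequentially" by (rule eventually_ge_at_top)
  ultimately have "eventually (\<lambda>k. real k powr (real a - d) > c + C \<and> k \<ge> 1) sequentially"
    by (rule eventually_conj)
  from eventually_happens'[OF sequentially_bot this]
  obtain k :: nat where k: "real k powr (real a - d) > c + C" "k \<ge> 1"
    by blast
  have "real k powr (real a - d) * real k powr d = real k ^ a"
    using k(2) by (simp add: powr_add[symmetric] powr_realpow)
  moreover have "(c + C) * real k powr d < real k powr (real a - d) * real k powr d"
    using k by (intro mult_strict_right_mono) auto
  moreover have "c * 1 \<le> c * real k powr d"
    using k(2) assms by (intro mult_left_mono ge_one_powr_ge_zero) auto
  ultimately show False using assms(1)[OF k(2)] by (simp add: algebra_simps)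
qed

text \<open>Summation over the dyadic blocks \<open>2\<^sup>k \<le> s < 2\<^sup>k\<^sup>+\<^sup>1\<close>.\<close>
lemma growth_bound_imp_summable:
  assumes lam: "\<And>s. 1 \<le> s \<Longrightarrow> A * real s ^ 2 \<le> - lam s" "0 < A"
    and growth: "\<And>S. real (\<Sum>s=1..S. m s) \<le> C * (real S + 1) ^ a" and d: "real a < d"
  shows "summable (\<lambda>s. real (m (Suc s)) * (- lam (Suc s)) powr (- d / 2))"
proof -
  define g where "g = (\<lambda>s. real (m s) * real s powr (- d))"
  define q where "q = 2 powr (real a - d)"
  have q: "0 \<le> q" "q < 1" using d by (auto simp: q_def powr_less_one)
  have C: "0 \<le> C" using growth[of 0] by simp
  have block: "(\<Sum>s\<in>{2 ^ k..<2 ^ Suc k}. g s) \<le> C * 2 ^ a * q ^ k" for k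
  proof -
    have "(\<Sum>s\<in>{2 ^ k..<2 ^ Suc k}. g s) \<le> (\<Sum>s\<in>{2 ^ k..<2 ^ Suc k}. real (m s) * (2 ^ k) powr (- d))"
      unfolding g_def
    proof (intro sum_mono mult_left_mono)
      fix s :: nat assume "s \<in> {2 ^ k..<2 ^ Suc k}"
      then have "2 ^ k \<le> real s" by (metis atLeastLessThan_iff of_nat_le_iff of_nat_numeral of_nat_power)
      then show "real s powr (- d) \<le> (2 ^ k) powr (- d)" using d by (intro powr_mono2') auto
    qed simp
    also have "\<dots> = real (\<Sum>s\<in>{2 ^ k..<2 ^ Suc k}. m s) * (2 ^ k) powr (- d)"
      by (simp add: sum_distrib_right)
    also have "\<dots> \<le> real (\<Sum>s=1..2 ^ Suc k - 1. m s) * (2 ^ k) powr (- d)"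
      by (intro mult_right_mono of_nat_mono sum_mono2) auto
    also have "\<dots> \<le> C * (real (2 ^ Suc k - 1) + 1) ^ a * (2 ^ k) powr (- d)"
      by (intro mult_right_mono growth) simp
    also have "real (2 ^ Suc k - 1) + 1 = 2 ^ Suc k"
      by (simp add: of_nat_diff)
    also have "C * (2 ^ Suc k) ^ a * (2 ^ k) powr (- d) = C * 2 ^ a * ((2 ^ k) powr real a * (2 ^ k) powr (- d))"
      by (simp add: powr_realpow power_mult_distrib)
    also have "(2 ^ k) powr real a * (2 ^ k) powr (- d) = q ^ k"
      by (simp add: q_def powr_add[symmetric] powr_realpow[symmetric] powr_powr algebra_simps)
    finally show ?thesis .
  qed
  have blocks: "(\<Sum>s\<in>{1..<2 ^ K}. g s) \<le> (\<Sum>k<K. C * 2 ^ a * q ^ k)" for K :: nat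
  proof (induction K)
    case (Suc K)
    have "{1..<2 ^ Suc K} = {1..<2 ^ K} \<union> {2 ^ K..<(2::nat) ^ Suc K}" by auto
    then have "(\<Sum>s\<in>{1..<2 ^ Suc K}. g s) = (\<Sum>s\<in>{1..<2 ^ K}. g s) + (\<Sum>s\<in>{2 ^ K..<2 ^ Suc K}. g s)"
      by (simp add: sum.union_disjoint)
    with Suc block[of K] show ?case by simp
  qed simp
  have "summable (\<lambda>s. g (Suc s))"
  proof (rule summableI_nonneg_bounded)
    fix n
    have "(\<Sum>s<n. g (Suc s)) = (\<Sum>s=1..n. g s)" by (simp add: sum.atLeast1_atMost_eq)
    also have "\<dots> \<le> (\<Sum>s\<in>{1..<2 ^ n}. g s)"
    proof (rule sum_mono2)
      show "{1..n} \<subseteq> {1..<2 ^ n}"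
      proof
        fix s assume "s \<in> {1..n}"
        then show "s \<in> {1..<2 ^ n}" using less_exp[of n] by (simp, linarith)
      qed
    qed (auto simp: g_def)
    also have "\<dots> \<le> (\<Sum>k<n. C * 2 ^ a * q ^ k)" by (rule blocks)
    also have "\<dots> \<le> suminf (\<lambda>k. C * 2 ^ a * q ^ k)"
      using q C by (intro sum_le_suminf summable_mult summable_geometric) auto
    finally show "(\<Sum>s<n. g (Suc s)) \<le> suminf (\<lambda>k. C * 2 ^ a * q ^ k)" .
  qed (simp add: g_def)
  then have "summable (\<lambda>s. A powr (- d / 2) * g (Suc s))" by (rule summable_mult)
  then show ?thesis
  proof (rule summable_comparison_test[rotated], intro exI allI impI)
    fix s
    have "(- lam (Suc s)) powr (- d / 2) \<le> (A * real (Suc s) ^ 2) powr (- d / 2)"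
      using lam(1)[of "Suc s"] lam(2) d by (intro powr_mono2') auto
    also have "\<dots> = A powr (- d / 2) * real (Suc s) powr (- d)"
    proof -
      have "real (Suc s) ^ 2 = real (Suc s) powr 2" by simp
      then show ?thesis using lam(2) by (simp only: powr_mult powr_powr) simp
    qed
    finally show "norm (real (m (Suc s)) * (- lam (Suc s)) powr (- d / 2)) \<le> A powr (- d / 2) * g (Suc s)"
      by (simp add: g_def mult_left_mono mult.left_commute[of "A powr _"] del: of_nat_Suc)
  qed
qed

section \<open>Polynomials in one generator\<close>

lemma eval_poly_superset:
  assumes "degree p \<le> n"
  shows "eval_poly p a = (\<Sum>i\<le>n. coeff p i *\<^sub>C a ^ i)"
  unfolding eval_poly_def
  by (rule sum.mono_neutral_left) (use assms in \<open>auto simp: coeff_eq_0\<close>)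

lemma eval_poly_zero [simp]: "eval_poly 0 a = 0"
  by (simp add: eval_poly_def)

lemma eval_poly_pCons: "eval_poly (pCons c p) a = c *\<^sub>C 1 + a * eval_poly p a"
proof -
  have "eval_poly (pCons c p) a = (\<Sum>i\<le>Suc (degree p). coeff (pCons c p) i *\<^sub>C a ^ i)"
    by (rule eval_poly_superset) (rule degree_pCons_le)
  also have "\<dots> = c *\<^sub>C 1 + (\<Sum>i\<le>degree p. coeff p i *\<^sub>C (a * a ^ i))"
    by (subst sum.atMost_Suc_shift) simp
  finally show ?thesis by (simp add: eval_poly_def sum_distrib_left mult_scaleC_right)
qed

lemma eval_poly_add: "eval_poly (p + q) a = eval_poly p a + eval_poly q a"
proof -
  let ?n = "max (degree p) (degree q)"
  show ?thesis
    by (simp add: eval_poly_superset[of _ ?n] degree_add_le_max scaleC_add_left sum.distrib)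
qed

lemma eval_poly_smult: "eval_poly (smult c p) a = c *\<^sub>C eval_poly p a"
  by (induction p) (simp_all add: eval_poly_pCons scaleC_add_right scaleC_scaleC mult_scaleC_right)

lemma eval_poly_diff: "eval_poly (p - q) a = eval_poly p a - eval_poly q a"
  using eval_poly_add[of "p - q" q a] by (simp add: algebra_simps)

lemma eval_poly_sum: "eval_poly (\<Sum>i\<in>A. f i) a = (\<Sum>i\<in>A. eval_poly (f i) a)"
  by (induction A rule: infinite_finite_induct) (simp_all add: eval_poly_add)

lemma eval_poly_mult: "eval_poly (p * q) a = eval_poly p a * eval_poly q a"
  by (induction p)
    (simp_all add: eval_poly_pCons eval_poly_add eval_poly_smult distrib_right mult_scaleC_left scaleC_one mult.assoc)

lemma eval_poly_monom: "eval_poly (monom c n) a = c *\<^sub>C a ^ n"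
  by (induction n) (simp_all add: monom_0 monom_Suc eval_poly_pCons mult_scaleC_right)

lemma eval_poly_commute: "a * eval_poly p a = eval_poly p a * a"
  by (induction p) (simp_all add: eval_poly_pCons distrib_left distrib_right mult_scaleC_left mult_scaleC_right mult.assoc[symmetric])

lemma qstar_eval_poly: "qstar (eval_poly p (u_gen e e)) = eval_poly (map_poly cnj p) (u_gen e e)"
  by (induction p) (simp_all add: eval_poly_pCons qstar_add qstar_scale qstar_mult map_poly_pCons eval_poly_commute)

lemma eval_poly_in_sphere_H: "degree p \<le> k \<Longrightarrow> eval_poly p (u_gen e e) \<in> sphere_H e k"
proof -
  assume k: "degree p \<le> k"
  have "u_gen e e ^ i \<in> (sphere_H e k :: ('a, 'b) quantum_algebra set)" if "i \<le> k" for i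
    using row_word_in_H[of "replicate i e" k e] that by (simp add: prod_list_replicate)
  then show ?thesis
    unfolding eval_poly_def using k subspace_sphere_H
    by (intro cvec.subspace_sum cvec.subspace_scale) auto
qed

text \<open>The reflection in the hyperplane orthogonal to \<open>\<delta>\<^sub>e - v\<close> has \<open>v\<close> as its row with index \<open>e\<close>.\<close>
lemma householder:
  fixes v :: "'n::finite \<Rightarrow> real"
  assumes v: "(\<Sum>j\<in>UNIV. (v j)\<^sup>2) = 1" "v e \<noteq> 1"
  obtains G where "\<And>i j. G i j = (G j i :: real)" "\<And>i j. (\<Sum>k\<in>UNIV. G i k * G j k) = of_bool (i = j)"
    "\<And>j. G e j = v j"
proof -
  define w where "w = (\<lambda>j. of_bool (j = e) - v j)"
  define G where "G = (\<lambda>i j. of_bool (i = j) - w i * w j / (1 - v e))"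
  have "(\<Sum>k\<in>UNIV. w k * w k) = (\<Sum>k\<in>UNIV. of_bool (k = e) - 2 * (if k = e then v k else 0) + (v k)\<^sup>2)"
    by (intro sum.cong refl) (auto simp: w_def power2_eq_square algebra_simps)
  also have "\<dots> = 2 * (1 - v e)"
    by (simp add: sum.distrib sum_subtractf v sum_distrib_left[symmetric] of_bool_def)
  finally have ww: "(\<Sum>k\<in>UNIV. w k * w k) = 2 * (1 - v e)" .
  show ?thesis
  proof (rule that[of G])
    show "G i j = G j i" for i j by (auto simp: G_def)
    show "G e j = v j" for j using v(2) by (auto simp: G_def w_def field_simps)
    show "(\<Sum>k\<in>UNIV. G i k * G j k) = of_bool (i = j)" for i j
    proof -
      have "(\<Sum>k\<in>UNIV. G i k * G j k) = (\<Sum>k\<in>UNIV. (if k = i then of_bool (i = j) else 0)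
          - (if k = i then w j * w i / (1 - v e) else 0) - (if k = j then w i * w j / (1 - v e) else 0)
          + w i * w j / (1 - v e)\<^sup>2 * (w k * w k))"
        by (intro sum.cong refl) (auto simp: G_def algebra_simps power2_eq_square)
      also have "\<dots> = of_bool (i = j) - 2 * (w i * w j / (1 - v e)) + w i * w j / (1 - v e)\<^sup>2 * (2 * (1 - v e))"
        unfolding sum.distrib sum_distrib_left[symmetric] ww by (simp add: sum_subtractf mult.commute)
      also have "w i * w j / (1 - v e)\<^sup>2 * (2 * (1 - v e)) = 2 * (w i * w j / (1 - v e))"
        using v(2) by (simp add: divide_simps power2_eq_square)
      also have "of_bool (i = j) - 2 * (w i * w j / (1 - v e)) + 2 * (w i * w j / (1 - v e)) = of_bool (i = j)"
        by simp
      finally show ?thesis .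
    qed
  qed
qed

text \<open>A classical point of the quantum group, i.e. an orthogonal matrix, with prescribed row.\<close>
lemma character:
  fixes v :: "'n::finite \<Rightarrow> real"
  assumes v: "(\<Sum>j\<in>UNIV. (v j)\<^sup>2) = 1" "v e \<noteq> 1"
  obtains \<psi> :: "('n, 'k::liberation_kind) quantum_algebra \<Rightarrow> complex"
  where "\<And>a b. \<psi> (a + b) = \<psi> a + \<psi> b" "\<And>c a. \<psi> (c *\<^sub>C a) = c * \<psi> a"
    "\<And>a b. \<psi> (a * b) = \<psi> a * \<psi> b" "\<psi> 1 = 1" "\<And>j. \<psi> (u_gen e j) = of_real (v j)"
proof -
  obtain G where G: "\<And>i j. G i j = G j i" "\<And>i j. (\<Sum>k\<in>UNIV. G i k * G j k) = of_bool (i = j)"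
    "\<And>j. G e j = v j"
    using householder[OF v] by blast
  have GG: "(\<Sum>k\<in>UNIV. complex_of_real (G i k) * complex_of_real (G j k)) = of_bool (i = j)" for i j
    using arg_cong[OF G(2)[of i j], of complex_of_real] by simp
  define g where "g = (\<lambda>i j. of_real (G i j) *\<^sub>C (1 :: unit linop))"
  have gg: "g i j * g k l = (of_real (G i j) * of_real (G k l)) *\<^sub>C 1" for i j k l
    by (simp add: g_def mult_scaleC_left scaleC_scaleC)
  have row: "(\<Sum>k\<in>UNIV. g i k * g j k) = of_bool (i = j) *\<^sub>C 1" for i j
    by (simp only: gg scaleC_sum_left[symmetric] GG)
  have column: "(\<Sum>k\<in>UNIV. g k i * g k j) = of_bool (i = j) *\<^sub>C 1" for i j
    using row[of i j] by (simp only: g_def G(1)[of _ i] G(1)[of _ j])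
  have commute: "g i j * g k l = g k l * g i j" for i j k l
    by (simp only: gg mult.commute)
  have half_commute: "g i j * g k l * g m n = g m n * g k l * g i j" for i j k l m n
    by (simp add: gg) (simp add: g_def mult_scaleC_left scaleC_scaleC mult_ac)
  obtain \<Phi> :: "('n, 'k) quantum_algebra \<Rightarrow> unit linop"
    where \<Phi>: "algebra_hom \<Phi>" "\<And>i j. \<Phi> (u_gen i j) = g i j"
    using quantum_algebra_hom[of g, OF row column commute half_commute] by blast
  have app: "app T v () = v () * app T (\<lambda>_. 1) ()" for T :: "unit linop" and v
  proof -
    have lin: "app T (\<lambda>x. c * u x + v x) = (\<lambda>x. c * app T u x + app T v x)" for c u v
      using app[of T] by blast
    have zero: "app T (\<lambda>_. 0) () = 0"
      using fun_cong[OF lin[of 1 "\<lambda>_. 0" "\<lambda>_. 0"], of "()"] by simp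
    have "(\<lambda>x. v () * 1 + 0) = v" by auto
    then show ?thesis using fun_cong[OF lin[of "v ()" "\<lambda>_. 1" "\<lambda>_. 0"], of "()"] zero by simp
  qed
  show ?thesis
  proof (rule that[of "\<lambda>a. app (\<Phi> a) (\<lambda>_. 1) ()"])
    show "app (\<Phi> (a * b)) (\<lambda>_. 1) () = app (\<Phi> a) (\<lambda>_. 1) () * app (\<Phi> b) (\<lambda>_. 1) ()" for a b
      using app[of "\<Phi> a" "app (\<Phi> b) (\<lambda>_. 1)"] by (simp add: algebra_homD[OF \<Phi>(1)] app_simps)
  qed (simp_all add: algebra_homD[OF \<Phi>(1)] \<Phi>(2) app_simps G(3) g_def)
qed

lemma poly_map_of_real: "poly (map_poly complex_of_real p) (of_real x) = of_real (poly p x)"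
  by (induction p) (simp_all add: map_poly_pCons)

lemma pderiv_map_of_real: "pderiv (map_poly complex_of_real p) = map_poly complex_of_real (pderiv p)"
  by (rule poly_eqI) (simp add: coeff_pderiv coeff_map_poly)

lemma pderiv_sum: "pderiv (\<Sum>i\<in>A. f i) = (\<Sum>i\<in>A. pderiv (f i))"
  by (induction A rule: infinite_finite_induct) (simp_all add: pderiv_add)

lemma poly_pderiv_1: "poly (pderiv p) 1 = (\<Sum>i\<le>degree p. of_nat i * coeff p i)"
  for p :: "complex poly"
proof -
  have "pderiv p = (\<Sum>i\<le>degree p. monom (of_nat i * coeff p i) (i - 1))"
    by (subst poly_as_sum_of_monoms[of p, symmetric]) (simp only: pderiv_sum pderiv_monom)
  then show ?thesis by (simp add: poly_sum poly_monom)
qed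

text \<open>The orthogonal polynomials are treated over the complex numbers, where all of their roots are available.\<close>
locale zonal = haar h
  for h :: "('n::finite, 'k::liberation_kind) quantum_algebra \<Rightarrow> complex" +
  fixes e :: 'n and \<mu> q L
  assumes data: "sphere_data e h \<mu> q L" and card: "CARD('n) \<ge> 2"
begin

definition mom :: "complex poly \<Rightarrow> complex" where "mom p = h (eval_poly p (u_gen e e))"

definition Q :: "nat \<Rightarrow> complex poly" where "Q s = map_poly of_real (q s)"

lemma mom_add: "mom (p + r) = mom p + mom r"
  and mom_smult: "mom (smult c p) = c * mom p"
  and mom_diff: "mom (p - r) = mom p - mom r"
  and mom_sum: "mom (\<Sum>i\<in>A. f i) = (\<Sum>i\<in>A. mom (f i))"
  and mom_zero: "mom 0 = 0"
  by (simp_all add: mom_def eval_poly_add eval_poly_smult eval_poly_diff eval_poly_sum h_add h_scale h_diff h_sum h_zero)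

lemma mom_bilinear:
  "mom ((\<Sum>i\<in>A. smult (a i) (p i)) * (\<Sum>j\<in>B. smult (b j) (r j)))
    = (\<Sum>i\<in>A. \<Sum>j\<in>B. b j * (a i * mom (p i * r j)))"
  by (simp only: sum_product mom_sum mult_smult_left mult_smult_right mom_smult)

lemma normalized: "degree (q s) = s" "poly (q s) 1 = 1"
  and orthogonal: "s \<noteq> t \<Longrightarrow> (\<integral>x. poly (q s) x * poly (q t) x \<partial>\<mu>) = 0"
  using data unfolding sphere_data_def normalized_orthogonal_polys_def by auto

lemma degree_Q: "degree (Q s) = s" and poly_Q_1: "poly (Q s) 1 = 1"
  and pderiv_Q_1: "poly (pderiv (Q s)) 1 = of_real (- sphere_eigenvalue q s)"
  and coeff_Q: "coeff (Q s) s \<noteq> 0"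
proof -
  show deg: "degree (Q s) = s" by (simp add: Q_def degree_map_poly normalized)
  show Q1: "poly (Q s) 1 = 1" using poly_map_of_real[of "q s" 1] by (simp add: Q_def normalized)
  show "poly (pderiv (Q s)) 1 = of_real (- sphere_eigenvalue q s)"
    using poly_map_of_real[of "pderiv (q s)" 1]
    by (simp add: Q_def pderiv_map_of_real sphere_eigenvalue_def)
  have "Q s \<noteq> 0" using Q1 by auto
  then show "coeff (Q s) s \<noteq> 0" using leading_coeff_0_iff[of "Q s"] deg by simp
qed

lemma mom_Q_Q: "s \<noteq> t \<Longrightarrow> mom (Q s * Q t) = 0"
proof -
  assume st: "s \<noteq> t"
  have "mom (Q s * Q t) = (\<integral>x. poly (Q s * Q t) (complex_of_real x) \<partial>\<mu>)"
    using data unfolding sphere_data_def is_distribution_def mom_def by blast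
  also have "\<dots> = (\<integral>x. complex_of_real (poly (q s) x * poly (q t) x) \<partial>\<mu>)"
    by (simp add: Q_def poly_map_of_real)
  also have "\<dots> = 0" using orthogonal[OF st] by (simp only: integral_complex_of_real of_real_0)
  finally show ?thesis .
qed

lemma mom_Q_lower:
  assumes "\<And>i. s \<le> i \<Longrightarrow> coeff p i = 0"
  shows "mom (Q s * p) = 0"
proof -
  have "mom (Q s * p) = 0" if "n \<le> s" "\<And>i. n \<le> i \<Longrightarrow> coeff p i = 0" for n p
    using that
  proof (induction n arbitrary: p)
    case 0
    then have "p = 0" by (intro poly_eqI) simp
    then show ?case by (simp add: mom_zero)
  next
    case (Suc n)
    define c where "c = coeff p n / coeff (Q n) n"
    have "coeff (p - smult c (Q n)) i = 0" if "n \<le> i" for i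
    proof (cases "i = n")
      case True
      then show ?thesis using coeff_Q[of n] by (simp add: c_def)
    next
      case False
      then show ?thesis using that Suc.prems(2)[of i] by (simp add: coeff_eq_0 degree_Q)
    qed
    then have "mom (Q s * (p - smult c (Q n))) = 0" using Suc by simp
    then show ?case
      using mom_Q_Q[of s n] Suc.prems(1) by (simp add: right_diff_distrib mom_diff mom_smult)
  qed
  then show ?thesis using assms by blast
qed

lemma mom_positive: "mom (map_poly cnj p * p) \<in> \<real>" "0 \<le> Re (mom (map_poly cnj p * p))"
  using ip.ip_self[of "eval_poly p (u_gen e e)"]
  by (auto simp: mom_def eval_poly_mult qstar_eval_poly)

text \<open>A polynomial that is null for the Haar state vanishes in the algebra, hence at the
  classical points, where \<open>u e e\<close> takes all values in \<open>(-1, 1)\<close>.\<close>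
lemma mom_faithful:
  assumes "mom (map_poly cnj p * p) = 0"
  shows "p = 0"
proof (rule ccontr)
  assume "p \<noteq> 0"
  have zero: "eval_poly p (u_gen e e :: ('n, 'k) quantum_algebra) = 0"
    by (rule sphere_H_faithful[OF eval_poly_in_sphere_H[OF order_refl]])
      (use assms in \<open>simp add: mom_def eval_poly_mult qstar_eval_poly\<close>)
  obtain j where j: "j \<noteq> e"
  proof (rule ccontr)
    assume "\<not> thesis"
    then have "(UNIV :: 'n set) = {e}" using that by auto
    then have "CARD('n) = 1" by (metis card_1_singleton_iff One_nat_def)
    then show False using card by simp
  qed
  have "poly p (of_real t) = 0" if t: "-1 < t" "t < 1" for t :: real
  proof -
    define v where "v = (\<lambda>k. if k = e then t else if k = j then sqrt (1 - t\<^sup>2) else 0)"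
    have "t\<^sup>2 \<le> 1" using t by (simp add: abs_square_le_1 abs_le_iff)
    have "(\<Sum>k\<in>UNIV. (v k)\<^sup>2) = (\<Sum>k\<in>{e, j}. (v k)\<^sup>2)"
      by (rule sum.mono_neutral_right) (auto simp: v_def)
    then have "(\<Sum>k\<in>UNIV. (v k)\<^sup>2) = 1" using j \<open>t\<^sup>2 \<le> 1\<close> by (simp add: v_def)
    moreover have "v e \<noteq> 1" using t by (simp add: v_def)
    ultimately obtain \<psi> :: "('n, 'k) quantum_algebra \<Rightarrow> complex" where
      \<psi>: "\<And>a b. \<psi> (a + b) = \<psi> a + \<psi> b" "\<And>c a. \<psi> (c *\<^sub>C a) = c * \<psi> a"
        "\<And>a b. \<psi> (a * b) = \<psi> a * \<psi> b" "\<psi> 1 = 1" "\<And>j. \<psi> (u_gen e j) = of_real (v j)"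
      using character[of v e] by blast
    have \<psi>0: "\<psi> 0 = 0" using \<psi>(2)[of 0 0] by simp
    have "\<psi> (eval_poly p (u_gen e e)) = poly p (\<psi> (u_gen e e))" for p
      by (induction p) (simp_all add: eval_poly_pCons \<psi>(1-4) \<psi>0)
    from this[of p] show ?thesis by (simp add: zero \<psi>0 \<psi>(5) v_def)
  qed
  then have "of_real ` {-1<..<1::real} \<subseteq> {z. poly p z = 0}" by auto
  then have "finite (of_real ` {-1<..<1::real} :: complex set)"
    using poly_roots_finite[OF \<open>p \<noteq> 0\<close>] finite_subset by blast
  then have "finite {-1<..<1::real}"
    by (rule finite_imageD) (auto simp: inj_on_def)
  then show False using infinite_Ioo[of "-1::real" 1] by simp
qed

text \<open>An operator on polynomials that is symmetric for the inner product and triangular with respect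
  to the degree has the orthogonal polynomials as eigenvectors. For the operators below, evaluation
  at 1 extracts the derivative.\<close>
lemma eigenvalue_formula:
  fixes c :: "nat \<Rightarrow> complex"
  defines "\<tau> \<equiv> \<lambda>n. h (u_gen e e ^ n)"
  assumes c0: "c 0 = 0"
    and sym: "\<And>n m. c n * (\<tau> (n - 2 + m) - \<tau> (n + m)) - \<kappa> * of_nat n * \<tau> (n + m)
      = c m * (\<tau> (m - 2 + n) - \<tau> (m + n)) - \<kappa> * of_nat m * \<tau> (m + n)"
  shows "\<kappa> * of_real (- sphere_eigenvalue q s) = c s + \<kappa> * of_nat s"
proof -
  define t where "t = (\<lambda>n. smult (c n) (monom 1 (n - 2) - monom 1 n) - smult (\<kappa> * of_nat n) (monom 1 n))"
  define T where "T = (\<lambda>p. \<Sum>i\<le>degree p. smult (coeff p i) (t i))"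
  have coeff_t: "coeff (t n) i = (if i = n then - (c n + \<kappa> * of_nat n) else 0)" if "n \<le> i" for n i
    using that c0 by (cases "n = 0") (auto simp: t_def)
  have moment: "mom (monom 1 n * monom 1 m) = \<tau> (n + m)" for n m
    by (simp add: mom_def \<tau>_def mult_monom eval_poly_monom scaleC_one)
  have t_sym: "mom (t n * monom 1 m) = mom (monom 1 n * t m)" for n m
    using sym[of n m]
    by (simp add: t_def left_diff_distrib right_diff_distrib mom_diff mom_smult moment add.commute)
  have T_sym: "mom (T a * b) = mom (a * T b)" for a b
  proof -
    have mon: "p = (\<Sum>j\<le>degree p. smult (coeff p j) (monom 1 j))" for p :: "complex poly"
      by (simp add: smult_monom poly_as_sum_of_monoms)
    have "mom (T a * b) = mom (T a * (\<Sum>j\<le>degree b. smult (coeff b j) (monom 1 j)))" using mon[of b] by simp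
    also have "\<dots> = mom ((\<Sum>i\<le>degree a. smult (coeff a i) (monom 1 i)) * T b)"
      unfolding T_def mom_bilinear t_sym ..
    also have "\<dots> = mom (a * T b)" using mon[of a] by simp
    finally show ?thesis .
  qed
  define \<Lambda> where "\<Lambda> = c s + \<kappa> * of_nat s"
  define r where "r = T (Q s) + smult \<Lambda> (Q s)"
  have r_low: "coeff r i = 0" if "s \<le> i" for i
  proof (cases "i = s")
    case True
    have "coeff (T (Q s)) s = (\<Sum>n\<le>s. coeff (Q s) n * coeff (t n) s)"
      by (simp add: T_def degree_Q coeff_sum)
    also have "\<dots> = (\<Sum>n\<le>s. if n = s then coeff (Q s) n * - \<Lambda> else 0)"
      by (intro sum.cong refl) (auto simp: coeff_t \<Lambda>_def)
    finally show ?thesis using True by (simp add: r_def)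
  next
    case False
    then show ?thesis using that by (simp add: r_def T_def degree_Q coeff_sum coeff_t coeff_eq_0)
  qed
  have T_low: "coeff (T p) i = 0" if "\<And>i. s \<le> i \<Longrightarrow> coeff p i = 0" "s \<le> i" for p i
  proof -
    have z: "coeff p n * coeff (t n) i = 0" for n
      using that coeff_t[of n i] by (cases "n < s") auto
    show ?thesis by (simp only: T_def coeff_sum coeff_smult z sum.neutral_const)
  qed
  have "mom (r * p) = 0" if p: "\<And>i. s \<le> i \<Longrightarrow> coeff p i = 0" for p
    using mom_Q_lower[OF T_low[OF p]] mom_Q_lower[OF p]
    by (simp add: r_def distrib_right mom_add T_sym mom_smult)
  from this[of "map_poly cnj r"] have "mom (map_poly cnj r * r) = 0"
    using r_low by (simp add: coeff_map_poly mult.commute)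
  then have "r = 0" by (rule mom_faithful)
  then have "0 = poly r 1" by simp
  also have "\<dots> = - \<kappa> * poly (pderiv (Q s)) 1 + \<Lambda>"
    by (simp add: r_def T_def t_def poly_sum poly_monom poly_Q_1 poly_pderiv_1 sum_distrib_left sum_negf mult_ac)
  finally have "\<kappa> * poly (pderiv (Q s)) 1 = \<Lambda>" by algebra
  then show ?thesis by (simp only: pderiv_Q_1 \<Lambda>_def)
qed

end

section \<open>Invariance under homomorphisms\<close>

lemma linop_eqI: "(\<And>v w. app S v w = app T v w) \<Longrightarrow> S = T"
  by (simp add: app_inject[symmetric] fun_eq_iff)

text \<open>The image of a word in the first row under \<open>(id \<otimes> \<Phi>) \<circ> \<Delta>\<close>, evaluated at a vector.\<close>
definition spread ::
  "'n \<Rightarrow> (('n::finite, 'k::liberation_kind) quantum_algebra \<Rightarrow> 'w linop) \<Rightarrow> ('w \<Rightarrow> complex)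
    \<Rightarrow> 'n list \<Rightarrow> 'w \<Rightarrow> ('n, 'k) quantum_algebra" where
  "spread e \<Phi> v J w = (\<Sum>K\<in>words (length J). app (\<Phi> (word u_gen K J)) v w *\<^sub>C row_word e K)"

lemma spread_Nil: "algebra_hom \<Phi> \<Longrightarrow> spread e \<Phi> v [] w = v w *\<^sub>C 1"
  by (simp add: spread_def algebra_homD app_simps)

lemma spread_Cons:
  assumes \<Phi>: "algebra_hom \<Phi>"
    and act: "\<And>k u. app (\<Phi> (u_gen k j)) u w = (\<Sum>x\<in>S. \<phi> k x * u (\<sigma> x))"
  shows "spread e \<Phi> v (j # J) w = (\<Sum>k\<in>UNIV. \<Sum>x\<in>S. \<phi> k x *\<^sub>C (u_gen e k * spread e \<Phi> v J (\<sigma> x)))"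
proof -
  have "spread e \<Phi> v (j # J) w = (\<Sum>k\<in>UNIV. \<Sum>K\<in>words (length J). \<Sum>x\<in>S.
      (\<phi> k x * app (\<Phi> (word u_gen K J)) v (\<sigma> x)) *\<^sub>C (u_gen e k * row_word e K))"
    by (simp add: spread_def sum_words_Suc algebra_homD[OF \<Phi>] app_simps act cvec.scale_sum_left)
  also have "\<dots> = (\<Sum>k\<in>UNIV. \<Sum>x\<in>S. \<phi> k x *\<^sub>C (u_gen e k * spread e \<Phi> v J (\<sigma> x)))"
    by (rule sum.cong[OF refl], subst sum.swap)
      (simp add: spread_def sum_distrib_left cvec.scale_sum_right mult_scaleC_right scaleC_scaleC)
  finally show ?thesis .
qed

lemma word_replicate: "length K = n \<Longrightarrow> word v (replicate n e) K = prod_list (map (v e) K)"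
  by (induction K arbitrary: n) auto

lemma (in haar) h_spread:
  assumes \<Phi>: "algebra_hom \<Phi>"
  shows "h (spread e \<Phi> v J w) = h (row_word e J) * v w"
proof -
  have "(\<Sum>K\<in>words (length J). h (row_word e K) *\<^sub>C (word u_gen K J :: ('n, 'k) quantum_algebra))
      = (\<Sum>K\<in>words (length J). h (word u_gen (replicate (length J) e) K) *\<^sub>C (word u_gen K J :: ('n, 'k) quantum_algebra))"
    by (intro sum.cong refl) (simp add: word_replicate)
  also have "\<dots> = h (row_word e J) *\<^sub>C 1"
    using fund.invariance[of "replicate (length J) e" J] by (simp add: word_replicate)
  finally have "(\<Sum>K\<in>words (length J). h (row_word e K) *\<^sub>C (word u_gen K J :: ('n, 'k) quantum_algebra)) = h (row_word e J) *\<^sub>C 1" .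
  then have "\<Phi> (\<Sum>K\<in>words (length J). h (row_word e K) *\<^sub>C (word u_gen K J :: ('n, 'k) quantum_algebra)) = \<Phi> (h (row_word e J) *\<^sub>C 1)"
    by simp
  then have "app (\<Sum>K\<in>words (length J). h (row_word e K) *\<^sub>C \<Phi> (word u_gen K J)) v w
      = app (h (row_word e J) *\<^sub>C 1) v w"
    by (simp only: algebra_homD[OF \<Phi>])
  then show ?thesis by (simp add: spread_def h_sum h_scale app_simps mult.commute)
qed

section \<open>Infinitesimal invariance and moments\<close>

definition twisted :: "('n \<Rightarrow> 'n \<Rightarrow> complex) \<Rightarrow> bool \<Rightarrow> 'n \<Rightarrow> 'n \<Rightarrow> complex" where
  "twisted Y p k j = (if p then - Y j k else Y k j)"

text \<open>The derivation that replaces letters in odd position by \<open>Y\<close> and letters in even position by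
  \<open>- Y\<^sup>t\<close>; the flag tells whether the word starts in an even position.\<close>
primrec variation ::
  "'n \<Rightarrow> ('n \<Rightarrow> 'n \<Rightarrow> complex) \<Rightarrow> 'n list \<Rightarrow> bool \<Rightarrow> ('n::finite, 'k::liberation_kind) quantum_algebra" where
  "variation e Y [] p = 0"
| "variation e Y (j # J) p = u_gen e j * variation e Y J (\<not> p)
     + (\<Sum>k\<in>UNIV. twisted Y p k j *\<^sub>C (u_gen e k * row_word e J))"

text \<open>The matrices \<open>1 + \<epsilon> Y\<close> and \<open>1 - \<epsilon> Y\<^sup>t\<close> over the dual numbers form a pair \<open>z, w\<close> with
  \<open>z w\<^sup>t = 1\<close>, and for every such pair the off-diagonal 2x2 block matrices with entries \<open>z i j\<close> and
  \<open>w i j\<close> satisfy the half-liberated relations. In the index \<open>(p, l)\<close> the flag \<open>p\<close> is the block and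
  \<open>l\<close> the power of \<open>\<epsilon>\<close>.\<close>
lemma (in haar) h_variation:
  assumes classical: "liberation_of TYPE('k) = Classical \<Longrightarrow> (\<And>i j. Y j i = - Y i j)"
  shows "h (variation e Y J p) = 0"
proof -
  define g :: "'n \<Rightarrow> 'n \<Rightarrow> (bool \<times> bool) linop" where
    "g = (\<lambda>k j. Linop (\<lambda>v w. of_bool (k = j) * v (\<not> fst w, snd w)
        + of_bool (snd w) * (twisted Y (fst w) k j * v (\<not> fst w, False))))"
  have app_g: "app (g k j) v (p, l) = of_bool (k = j) * v (\<not> p, l)
      + of_bool l * (twisted Y p k j * v (\<not> p, False))" for k j v p l
    unfolding g_def by (subst Linop_inverse) (auto simp: fun_eq_iff algebra_simps)
  have prod: "app (g i j * g k l) v (p, m) = (of_bool (i = j) * of_bool (k = l)) * v (p, m)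
      + of_bool m * ((of_bool (i = j) * twisted Y (\<not> p) k l + of_bool (k = l) * twisted Y p i j) * v (p, False))"
    for i j k l v p m
    by (simp add: times_linop.rep_eq app_g algebra_simps)
  have delta: "(\<Sum>k\<in>UNIV. of_bool (i = k) * f k) = f i" "(\<Sum>k\<in>UNIV. of_bool (k = i) * f k) = f i"
    for i :: 'n and f :: "'n \<Rightarrow> complex"
    by (simp_all add: of_bool_def if_distrib[of "\<lambda>c. c * _"] cong: if_cong)
  have row: "(\<Sum>k\<in>UNIV. g i k * g j k) = of_bool (i = j) *\<^sub>C 1" for i j
    by (rule linop_eqI)
      (auto simp: app_simps(6) prod sum.distrib sum_distrib_left[symmetric] sum_distrib_right[symmetric]
        delta twisted_def app_simps(2,5))
  have column: "(\<Sum>k\<in>UNIV. g k i * g k j) = of_bool (i = j) *\<^sub>C 1" for i j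
    by (rule linop_eqI)
      (auto simp: app_simps(6) prod sum.distrib sum_distrib_left[symmetric] sum_distrib_right[symmetric]
        delta twisted_def app_simps(2,5))
  have commute: "g i j * g k l = g k l * g i j" if "liberation_of TYPE('k) = Classical" for i j k l
  proof -
    have "twisted Y (\<not> p) a b = twisted Y p a b" for p a b
      using classical[OF that, of a b] by (simp add: twisted_def)
    then show ?thesis by (intro linop_eqI) (auto simp: prod algebra_simps)
  qed
  have half_commute: "g i j * g k l * g m n = g m n * g k l * g i j" for i j k l m n
  proof (rule linop_eqI)
    fix v w
    show "app (g i j * g k l * g m n) v w = app (g m n * g k l * g i j) v w"
      by (cases w) (simp add: times_linop.rep_eq app_g algebra_simps)
  qed
  have "\<exists>\<Phi> :: ('n, 'k) quantum_algebra \<Rightarrow> (bool \<times> bool) linop.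
      algebra_hom \<Phi> \<and> (\<forall>i j. \<Phi> (u_gen i j) = g i j)"
    by (rule quantum_algebra_hom) (rule row | rule column | rule half_commute | (rule commute, assumption))+
  then obtain \<Phi> :: "('n, 'k) quantum_algebra \<Rightarrow> (bool \<times> bool) linop"
    where \<Phi>: "algebra_hom \<Phi>" "\<And>i j. \<Phi> (u_gen i j) = g i j"
    by blast
  define F where "F = spread e \<Phi> (\<lambda>w. of_bool (\<not> snd w))"
  have Cons: "F (j # J) (p, l) = u_gen e j * F J (\<not> p, l)
      + of_bool l *\<^sub>C (\<Sum>k\<in>UNIV. twisted Y p k j *\<^sub>C (u_gen e k * F J (\<not> p, False)))" for j J p l
  proof -
    define S where "S = {(\<not> p, l), (\<not> p, False)}"
    define \<phi> where "\<phi> = (\<lambda>k x. of_bool (k = j) * of_bool (x = (\<not> p, l))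
        + of_bool l * (twisted Y p k j * of_bool (x = (\<not> p, False))))"
    have "F (j # J) (p, l) = (\<Sum>k\<in>UNIV. \<Sum>x\<in>S. \<phi> k x *\<^sub>C (u_gen e k * F J x))"
      unfolding F_def by (rule spread_Cons[OF \<Phi>(1), where \<sigma> = "\<lambda>x. x"]) (auto simp: \<Phi>(2) app_g S_def \<phi>_def)
    also have "\<dots> = (\<Sum>k\<in>UNIV. of_bool (k = j) *\<^sub>C (u_gen e k * F J (\<not> p, l))
        + (of_bool l * twisted Y p k j) *\<^sub>C (u_gen e k * F J (\<not> p, False)))"
      by (intro sum.cong refl) (cases l, auto simp: S_def \<phi>_def)
    also have "\<dots> = u_gen e j * F J (\<not> p, l)
      + of_bool l *\<^sub>C (\<Sum>k\<in>UNIV. twisted Y p k j *\<^sub>C (u_gen e k * F J (\<not> p, False)))"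
      by (simp add: sum.distrib sum_of_bool_scale cvec.scale_sum_right scaleC_scaleC)
    finally show ?thesis .
  qed
  have "F J (p, False) = row_word e J" for J p
    by (induction J arbitrary: p) (simp_all add: Cons, simp add: F_def spread_Nil[OF \<Phi>(1)] scaleC_one)
  then have "F J (p, True) = variation e Y J p" for J p
    by (induction J arbitrary: p) (simp_all add: Cons scaleC_one, simp add: F_def spread_Nil[OF \<Phi>(1)])
  moreover have "h (F J (p, True)) = 0" unfolding F_def by (subst h_spread[OF \<Phi>(1)]) simp
  ultimately show ?thesis by simp
qed

context haar
begin

lemma sum_other_squares:
  "(\<Sum>j\<in>UNIV - {e}. h (u_gen e j * u_gen e j * a)) = h a - h (u_gen e e * u_gen e e * a)"
proof -
  have "h ((\<Sum>j\<in>UNIV. u_gen e j * u_gen e j) * a) = h a"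
    by (simp add: u_gen_row scaleC_one)
  then have "(\<Sum>j\<in>UNIV. h (u_gen e j * u_gen e j * a)) = h a"
    by (simp add: sum_distrib_right h_sum)
  then show ?thesis by (simp add: sum_diff1)
qed

text \<open>Summation over \<open>j \<noteq> e\<close>, where the squares of the \<open>x\<^sub>j\<close> add up to \<open>1 - x\<^sub>e\<^sup>2\<close>.\<close>
lemma moment_recursion_from_squares:
  assumes "\<And>j. j \<noteq> e \<Longrightarrow> c * h (u_gen e j * u_gen e j * u_gen e e ^ n) = h (u_gen e e ^ (n + 2))"
  shows "c * (h (u_gen e e ^ n) - h (u_gen e e ^ (n + 2))) = of_nat (CARD('n) - 1) * h (u_gen e e ^ (n + 2))"
proof -
  have "of_nat (CARD('n) - 1) * h (u_gen e e ^ (n + 2))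
      = (\<Sum>j\<in>UNIV - {e}. c * h (u_gen e j * u_gen e j * u_gen e e ^ n))"
    using assms by (simp add: card_Diff_singleton)
  also have "\<dots> = c * (h (u_gen e e ^ n) - h (u_gen e e * u_gen e e * u_gen e e ^ n))"
    by (simp only: sum_distrib_left[symmetric] sum_other_squares)
  finally show ?thesis by (simp add: mult.assoc)
qed

text \<open>The infinitesimal rotation of the coordinates \<open>e\<close> and \<open>j\<close>, applied to \<open>x\<^sub>j x\<^sub>e\<^sup>n\<close>, is
  \<open>n x\<^sub>j\<^sup>2 x\<^sub>e\<^sup>n\<^sup>-\<^sup>1 - x\<^sub>e\<^sup>n\<^sup>+\<^sup>1\<close>.\<close>
lemma classical_moments:
  assumes classical: "liberation_of TYPE('k) = Classical" and card: "CARD('n) \<ge> 2"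
  shows "h (u_gen e e) = 0"
    and "of_nat (n + 1) * (h (u_gen e e ^ n) - h (u_gen e e ^ (n + 2)))
      = of_nat (CARD('n) - 1) * h (u_gen e e ^ (n + 2))"
proof -
  have step: "of_nat n * h (u_gen e j * u_gen e j * u_gen e e ^ (n - 1)) = h (u_gen e e ^ (n + 1))"
    if j: "j \<noteq> e" for n j
  proof -
    define Y :: "'n \<Rightarrow> 'n \<Rightarrow> complex" where
      "Y = (\<lambda>k i. of_bool (k = j) * of_bool (i = e) - of_bool (k = e) * of_bool (i = j))"
    have Y: "twisted Y p k i = Y k i" for p k i by (auto simp: twisted_def Y_def)
    have Ye: "(\<Sum>k\<in>UNIV. Y k e *\<^sub>C a k) = a j" and Yj: "(\<Sum>k\<in>UNIV. Y k j *\<^sub>C a k) = - a e"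
      for a :: "'n \<Rightarrow> ('n, 'k) quantum_algebra"
      using j by (simp_all add: Y_def sum_of_bool_scale sum_negf)
    have "variation e Y (replicate n e) p = (of_nat n *\<^sub>C (u_gen e j * u_gen e e ^ (n - 1)) :: ('n, 'k) quantum_algebra)" for p
    proof (induction n arbitrary: p)
      case (Suc n)
      have "u_gen e e * u_gen e j = (u_gen e j * u_gen e e :: ('n, 'k) quantum_algebra)"
        by (rule u_gen_commute[OF classical])
      then have "u_gen e e * (of_nat n *\<^sub>C (u_gen e j * u_gen e e ^ (n - 1)))
          = of_nat n *\<^sub>C (u_gen e j * u_gen e e ^ n :: ('n, 'k) quantum_algebra)"
        by (cases n) (simp_all add: mult_scaleC_right mult.assoc[symmetric])
      then show ?case
        by (simp add: Suc.IH Y Ye prod_list_replicate scaleC_add_left scaleC_one add.commute)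
    qed simp
    then have eq: "variation e Y (j # replicate n e) False
        = (of_nat n *\<^sub>C (u_gen e j * u_gen e j * u_gen e e ^ (n - 1)) - u_gen e e ^ (n + 1) :: ('n, 'k) quantum_algebra)"
      by (simp add: Y Yj prod_list_replicate mult_scaleC_right mult.assoc)
    have "h (variation e Y (j # replicate n e) False) = 0"
      by (rule h_variation) (simp add: Y_def)
    then show ?thesis unfolding eq by (simp add: h_diff h_scale)
  qed
  have "card (UNIV - {e}) \<noteq> 0" using card by (simp add: card_Diff_singleton)
  then have "UNIV - {e} \<noteq> {}" by (metis card.empty)
  then obtain j where "j \<noteq> e" by blast
  from step[OF this, of 0] show "h (u_gen e e) = 0" by simp
  show "of_nat (n + 1) * (h (u_gen e e ^ n) - h (u_gen e e ^ (n + 2)))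
      = of_nat (CARD('n) - 1) * h (u_gen e e ^ (n + 2))"
    by (rule moment_recursion_from_squares) (use step[of _ "n + 1"] in simp)
qed

text \<open>Odd moments: the diagonal matrix unit at \<open>e\<close> multiplies \<open>x\<^sub>e\<^sup>2\<^sup>m\<^sup>+\<^sup>1\<close> by the number of odd positions minus the
  number of even positions, which is 1. Even moments: replacing \<open>e\<close> by \<open>j\<close> in odd position and \<open>j\<close> by
  \<open>-e\<close> in even position turns \<open>x\<^sub>e x\<^sub>j x\<^sub>e\<^sup>2\<^sup>m\<close> into \<open>(m + 1) x\<^sub>j\<^sup>2 x\<^sub>e\<^sup>2\<^sup>m - x\<^sub>e\<^sup>2\<^sup>m\<^sup>+\<^sup>2\<close>, as squares commute with
  \<open>x\<^sub>e\<close> and \<open>x\<^sub>j\<close>.\<close>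
lemma half_liberated_moments:
  assumes nonclassical: "liberation_of TYPE('k) \<noteq> Classical"
    and half: "\<And>a b c. u_gen e a * u_gen e b * u_gen e c = (u_gen e c * u_gen e b * u_gen e a :: ('n, 'k) quantum_algebra)"
  shows "h (u_gen e e ^ (2 * m + 1)) = 0"
    and "of_nat (m + 1) * (h (u_gen e e ^ (2 * m)) - h (u_gen e e ^ (2 * m + 2)))
      = of_nat (CARD('n) - 1) * h (u_gen e e ^ (2 * m + 2))"
proof -
  let ?x = "u_gen e e :: ('n, 'k) quantum_algebra"
  have vanish: "h (variation e Y J p) = 0" for Y J p
    by (rule h_variation) (use nonclassical in simp)
  define Z :: "'n \<Rightarrow> 'n \<Rightarrow> complex" where "Z = (\<lambda>k i. of_bool (k = e) * of_bool (i = e))"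
  have Z: "(\<Sum>k\<in>UNIV. twisted Z p k e *\<^sub>C a k) = (if p then - a e else a e)"
    for p and a :: "'n \<Rightarrow> ('n, 'k) quantum_algebra"
    by (simp add: twisted_def Z_def sum_of_bool_scale sum_negf)
  have "variation e Z (replicate (2 * m) e) p = (0 :: ('n, 'k) quantum_algebra)" for m p
    by (induction m arbitrary: p) (simp_all add: Z prod_list_replicate)
  then have "variation e Z (replicate (2 * m + 1) e) False = ?x ^ (2 * m + 1)"
    by (simp add: Z prod_list_replicate)
  with vanish[of Z "replicate (2 * m + 1) e" False] show "h (?x ^ (2 * m + 1)) = 0" by simp
  show "of_nat (m + 1) * (h (?x ^ (2 * m)) - h (?x ^ (2 * m + 2)))
      = of_nat (CARD('n) - 1) * h (?x ^ (2 * m + 2))"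
  proof (rule moment_recursion_from_squares)
    fix j assume j: "j \<noteq> e"
    let ?y = "u_gen e j :: ('n, 'k) quantum_algebra"
    define Y :: "'n \<Rightarrow> 'n \<Rightarrow> complex" where "Y = (\<lambda>k i. of_bool (k = j) * of_bool (i = e))"
    have Y: "(\<Sum>k\<in>UNIV. twisted Y False k e *\<^sub>C a k) = a j" "(\<Sum>k\<in>UNIV. twisted Y True k e *\<^sub>C a k) = 0"
        "(\<Sum>k\<in>UNIV. twisted Y True k j *\<^sub>C a k) = - a e"
      for a :: "'n \<Rightarrow> ('n, 'k) quantum_algebra"
      using j by (simp_all add: twisted_def Y_def sum_of_bool_scale sum_negf)
    have even: "variation e Y (replicate (2 * m) e) False = of_nat m *\<^sub>C (?y * ?x ^ (2 * m - 1))" for m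
    proof (induction m)
      case (Suc m)
      have "?x * (?x * (of_nat m *\<^sub>C (?y * ?x ^ (2 * m - 1)))) = of_nat m *\<^sub>C (?y * ?x ^ (2 * m + 1))"
        using half[of e e j] by (cases m) (simp_all add: mult_scaleC_right mult.assoc[symmetric])
      then show ?case
        by (simp add: Suc.IH Y prod_list_replicate scaleC_add_left scaleC_one add.commute)
    qed simp
    have "?x * (?y * (?y * ?x ^ (2 * m - 1))) = ?y * ?y * ?x ^ (2 * m)" if "m \<noteq> 0"
      using half[of e j j] that by (cases m) (simp_all add: mult.assoc[symmetric])
    then have eq: "variation e Y (e # j # replicate (2 * m) e) False
        = of_nat m *\<^sub>C (?y * ?y * ?x ^ (2 * m)) - ?x ^ (2 * m + 2) + ?y * ?y * ?x ^ (2 * m)"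
      by (cases "m = 0")
        (simp_all add: Y even prod_list_replicate mult_scaleC_right right_diff_distrib mult.assoc)
    show "of_nat (m + 1) * h (?y * ?y * ?x ^ (2 * m)) = h (?x ^ (2 * m + 2))"
      using vanish[of Y "e # j # replicate (2 * m) e" False] unfolding eq
      by (simp add: h_add h_diff h_scale algebra_simps)
  qed
qed

end

section \<open>The eigenvalues in the classical and the half-liberated case\<close>

context zonal
begin

text \<open>The symmetric operator is \<open>(1 - x\<^sup>2) p\<^sup>\<prime>\<^sup>\<prime> - (N - 1) x p\<^sup>\<prime>\<close>, with the Gegenbauer polynomials as
  eigenvectors.\<close>
lemma classical_eigenvalue:
  assumes classical: "liberation_of TYPE('k) = Classical"
  shows "real (CARD('n) - 1) * - sphere_eigenvalue q s = real s * (real s - 1) + real (CARD('n) - 1) * real s"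
proof -
  define \<tau> where "\<tau> = (\<lambda>n. h (u_gen e e ^ n))"
  define K :: complex where "K = of_nat (CARD('n) - 1)"
  define c :: "nat \<Rightarrow> complex" where "c = (\<lambda>n. of_nat n * (of_nat n - 1))"
  have \<tau>1: "\<tau> (Suc 0) = 0" using classical_moments(1)[OF classical card] by (simp add: \<tau>_def)
  have rec: "of_nat (n + 1) * (\<tau> n - \<tau> (n + 2)) = K * \<tau> (n + 2)" for n
    using classical_moments(2)[OF classical card] by (simp add: \<tau>_def K_def)
  have form: "of_nat (l + 1) * (c n * (\<tau> (n - 2 + m) - \<tau> (n + m)) - K * of_nat n * \<tau> (n + m))
      = - K * of_nat n * of_nat m * \<tau> (n + m)" if l: "n + m = l + 2" for n m l
  proof (cases "n \<ge> 2")
    case True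
    then have "n - 2 + m = l" using l by simp
    then have H: "of_nat (l + 1) * (c n * (\<tau> (n - 2 + m) - \<tau> (n + m))) = c n * (K * \<tau> (n + m))"
      using rec[of l] l by (simp add: mult.left_commute)
    have L: "of_nat (l + 1) = (of_nat n + of_nat m - 1 :: complex)"
      using arg_cong[OF l, of "of_nat :: nat \<Rightarrow> complex"] by (simp add: algebra_simps)
    show ?thesis
      unfolding right_diff_distrib[of "of_nat (l + 1)"] H unfolding L c_def by algebra
  next
    case False
    then consider "n = 0" | "n = 1" "m = l + 1" using l by linarith
    then show ?thesis by cases (simp_all add: c_def)
  qed
  have sym: "c n * (\<tau> (n - 2 + m) - \<tau> (n + m)) - K * of_nat n * \<tau> (n + m)
      = c m * (\<tau> (m - 2 + n) - \<tau> (m + n)) - K * of_nat m * \<tau> (m + n)" for n m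
    proof (cases "n + m \<ge> 2")
      case True
      then obtain l where l: "n + m = l + 2" using le_Suc_ex[of 2 "n + m"] by (auto simp: add.commute)
      have "of_nat (l + 1) * (c n * (\<tau> (n - 2 + m) - \<tau> (n + m)) - K * of_nat n * \<tau> (n + m))
        = of_nat (l + 1) * (c m * (\<tau> (m - 2 + n) - \<tau> (m + n)) - K * of_nat m * \<tau> (m + n))"
        using form[of n m l] form[of m n l] l by (simp only: add.commute[of m n] mult_ac)
      moreover have "of_nat (l + 1) \<noteq> (0 :: complex)" by (metis of_nat_eq_0_iff add_is_0 one_neq_zero)
      ultimately show ?thesis using mult_left_cancel by blast
    next
      case False
      then consider "n = 0" "m = 0" | "n = 1" "m = 0" | "n = 0" "m = 1" by linarith
      then show ?thesis by cases (simp_all add: c_def \<tau>1)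
    qed
  have "K * of_real (- sphere_eigenvalue q s) = c s + K * of_nat s"
    by (rule eigenvalue_formula[OF _ sym[unfolded \<tau>_def]]) (simp add: c_def)
  then have "complex_of_real (real (CARD('n) - 1) * - sphere_eigenvalue q s)
      = of_real (real s * (real s - 1) + real (CARD('n) - 1) * real s)"
    by (simp add: K_def c_def)
  then show ?thesis by (simp only: of_real_eq_iff)
qed

text \<open>The distribution has the density \<open>\<bar>x\<bar> (1 - x\<^sup>2)\<^sup>N\<^sup>-\<^sup>2\<close> up to a factor. The symmetric operator is
  \<open>(1 - x\<^sup>2) (p\<^sup>\<prime>\<^sup>\<prime> + p\<^sup>\<prime> / x) - 2 (N - 1) x p\<^sup>\<prime>\<close> on even polynomials; on odd ones the term
  \<open>(1 - x\<^sup>2) p / x\<^sup>2\<close> is subtracted to remove the pole.\<close>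
lemma half_liberated_eigenvalue:
  assumes nonclassical: "liberation_of TYPE('k) \<noteq> Classical"
    and half: "\<And>a b c. u_gen e a * u_gen e b * u_gen e c = (u_gen e c * u_gen e b * u_gen e a :: ('n, 'k) quantum_algebra)"
  shows "2 * real (CARD('n) - 1) * - sphere_eigenvalue q s
    = (real s)\<^sup>2 - of_bool (odd s) + 2 * real (CARD('n) - 1) * real s"
proof -
  define \<tau> where "\<tau> = (\<lambda>n. h (u_gen e e ^ n))"
  define K :: complex where "K = of_nat (CARD('n) - 1)"
  define c :: "nat \<Rightarrow> complex" where "c = (\<lambda>n. (of_nat n)\<^sup>2 - of_bool (odd n))"
  have odd: "\<tau> n = 0" if "odd n" for n
    using half_liberated_moments(1)[OF nonclassical half] that by (auto simp: \<tau>_def elim: oddE)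
  have rec: "of_nat (m + 1) * (\<tau> (2 * m) - \<tau> (2 * m + 2)) = K * \<tau> (2 * m + 2)" for m
    using half_liberated_moments(2)[OF nonclassical half] by (simp add: \<tau>_def K_def)
  have c01: "c 0 = 0" "c (Suc 0) = 0" by (simp_all add: c_def)
  have form: "of_nat (l + 1) * (c n * (\<tau> (n - 2 + m) - \<tau> (n + m)) - 2 * K * of_nat n * \<tau> (n + m))
      = K * (c n - of_nat (n + m) * of_nat n) * \<tau> (n + m)" if l: "n + m = 2 * l + 2" for n m l
  proof (cases "n \<ge> 2")
    case True
    then have "n - 2 + m = 2 * l" using l by simp
    then have H: "of_nat (l + 1) * (c n * (\<tau> (n - 2 + m) - \<tau> (n + m))) = c n * (K * \<tau> (n + m))"
      using rec[of l] l by (simp add: mult.left_commute)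
    have L: "of_nat (n + m) = (2 * of_nat (l + 1) :: complex)"
      using l by simp
    show ?thesis
      unfolding right_diff_distrib[of "of_nat (l + 1)"] H L by algebra
  next
    case False
    then consider "n = 0" | "n = 1" by linarith
    then show ?thesis using l by cases (simp_all add: c01 algebra_simps)
  qed
  have sym: "c n * (\<tau> (n - 2 + m) - \<tau> (n + m)) - 2 * K * of_nat n * \<tau> (n + m)
      = c m * (\<tau> (m - 2 + n) - \<tau> (m + n)) - 2 * K * of_nat m * \<tau> (m + n)" for n m
    proof (cases "odd (n + m)")
      case True
      have "c n * \<tau> (n - 2 + m) = 0" if "odd (n + m)" for n m
      proof (cases "n \<ge> 2")
        case True
        then have "odd (n - 2 + m)" using that by simp
        then show ?thesis by (simp add: odd)
      next
        case False
        then have "n = 0 \<or> n = Suc 0" by linarith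
        then show ?thesis using c01 by auto
      qed
      from this[of n m] this[of m n] True
      have "c n * \<tau> (n - 2 + m) = 0" "c m * \<tau> (m - 2 + n) = 0" by (simp_all add: add.commute)
      moreover have "\<tau> (n + m) = 0" "\<tau> (m + n) = 0" using True odd by (simp_all add: add.commute)
      ultimately show ?thesis by (simp only: right_diff_distrib mult_zero_right diff_self)
    next
      case False
      show ?thesis
      proof (cases "n + m = 0")
        case True
        then show ?thesis by (simp add: c01)
      next
        case nz: False
        from False obtain k where k: "n + m = 2 * k" by blast
        define l where "l = k - 1"
        have l: "n + m = 2 * l + 2" using k nz by (simp add: l_def)
        have "c n - of_nat (n + m) * of_nat n = c m - of_nat (m + n) * of_nat m"
          using False by (simp add: c_def power2_eq_square algebra_simps)
        then have "of_nat (l + 1) * (c n * (\<tau> (n - 2 + m) - \<tau> (n + m)) - 2 * K * of_nat n * \<tau> (n + m))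
          = of_nat (l + 1) * (c m * (\<tau> (m - 2 + n) - \<tau> (m + n)) - 2 * K * of_nat m * \<tau> (m + n))"
          using form[of n m l] form[of m n l] l by (simp only: add.commute[of m n])
        moreover have "of_nat (l + 1) \<noteq> (0 :: complex)" by (metis of_nat_eq_0_iff add_is_0 one_neq_zero)
        ultimately show ?thesis using mult_left_cancel by blast
      qed
    qed
  have "(2 * K) * of_real (- sphere_eigenvalue q s) = c s + (2 * K) * of_nat s"
    by (rule eigenvalue_formula[OF c01(1) sym[unfolded \<tau>_def]])
  then have "complex_of_real (2 * real (CARD('n) - 1) * - sphere_eigenvalue q s)
      = of_real ((real s)\<^sup>2 - of_bool (odd s) + 2 * real (CARD('n) - 1) * real s)"
    by (simp add: K_def c_def)
  then show ?thesis by (simp only: of_real_eq_iff)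
qed

end

section \<open>Upper bounds for the dimensions\<close>

lemma cdim_le_card_keys:
  fixes f :: "'w \<Rightarrow> 'a::complex_algebra"
  assumes V: "V \<subseteq> cspan (f ` A)" and fin: "finite (key ` A)"
    and key: "\<And>w w'. w \<in> A \<Longrightarrow> w' \<in> A \<Longrightarrow> key w = key w' \<Longrightarrow> f w = f w'"
  shows "cdim V \<le> card (key ` A)"
proof -
  define g where "g = (\<lambda>\<kappa>. f (SOME w. w \<in> A \<and> key w = \<kappa>))"
  have "f w = g (key w)" if "w \<in> A" for w
    unfolding g_def
  proof (rule someI2[of _ w])
    show "f w = f w'" if "w' \<in> A \<and> key w' = key w" for w'
      using key[of w w'] that \<open>w \<in> A\<close> by simp
  qed (use that in simp)
  then have sub: "f ` A \<subseteq> g ` (key ` A)" by auto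
  have "card (f ` A) \<le> card (g ` (key ` A))" by (rule card_mono[OF finite_imageI[OF fin] sub])
  also have "\<dots> \<le> card (key ` A)" by (rule card_image_le[OF fin])
  finally show ?thesis
    using cvec.dim_le_card[OF V finite_subset[OF sub finite_imageI[OF fin]]] by simp
qed

lemma sphere_H_subset_span:
  fixes A :: "'n::finite list set"
  assumes "\<And>w. length w \<le> S \<Longrightarrow> row_word e w \<in> cspan (row_word e ` A :: ('n, 'k::liberation_kind) quantum_algebra set)"
  shows "sphere_H e S \<subseteq> cspan (row_word e ` A :: ('n, 'k) quantum_algebra set)"
  unfolding sphere_H_eq by (rule cvec.span_minimal) (use assms in auto)

lemma square_expansion:
  "u_gen e e * (u_gen e e * a) = a - (\<Sum>j\<in>UNIV - {e}. u_gen e j * (u_gen e j * a :: ('n::finite, 'k::liberation_kind) quantum_algebra))"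
proof -
  have "(\<Sum>j\<in>UNIV. u_gen e j * u_gen e j) * a = a"
    by (simp add: u_gen_row scaleC_one)
  then have "(\<Sum>j\<in>UNIV. u_gen e j * (u_gen e j * a)) = a"
    by (simp add: sum_distrib_right mult.assoc)
  then show ?thesis by (simp add: sum_diff1)
qed

lemma square_expansion_in_span:
  assumes "a \<in> cspan X" "\<And>j. j \<noteq> e \<Longrightarrow> u_gen e j * (u_gen e j * a) \<in> cspan X"
  shows "u_gen e e * (u_gen e e * a) \<in> cspan (X :: ('n::finite, 'k::liberation_kind) quantum_algebra set)"
  unfolding square_expansion using assms by (intro cvec.span_diff cvec.span_sum) auto

lemma card_functions:
  "card {f :: 'n::finite \<Rightarrow> nat. \<forall>j. f j \<le> (if j = e then b else S)} = (b + 1) * (S + 1) ^ (CARD('n) - 1)"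
  "finite {f :: 'n::finite \<Rightarrow> nat. \<forall>j. f j \<le> (if j = e then b else S)}"
proof -
  have eq: "{f :: 'n \<Rightarrow> nat. \<forall>j. f j \<le> (if j = e then b else S)} = PiE UNIV (\<lambda>j. if j = e then {..b} else {..S})"
    by (auto simp: PiE_def Pi_def split: if_splits)
  show "finite {f :: 'n \<Rightarrow> nat. \<forall>j. f j \<le> (if j = e then b else S)}"
    unfolding eq by (rule finite_PiE) auto
  have "(\<Prod>j\<in>UNIV. card (if j = e then {..b} else {..S})) = (b + 1) * (\<Prod>j\<in>UNIV - {e}. S + 1)"
    by (subst prod.remove[of _ e]) auto
  then show "card {f :: 'n \<Rightarrow> nat. \<forall>j. f j \<le> (if j = e then b else S)} = (b + 1) * (S + 1) ^ (CARD('n) - 1)"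
    unfolding eq by (simp add: card_PiE card_Diff_singleton)
qed

context
  fixes e :: "'n::finite"
  assumes commute: "\<And>a b. u_gen e a * u_gen e b = (u_gen e b * u_gen e a :: ('n, 'k::liberation_kind) quantum_algebra)"
begin

lemma commuting_word_remove:
  "a \<in> set w \<Longrightarrow> row_word e w = (u_gen e a * row_word e (remove1 a w) :: ('n, 'k) quantum_algebra)"
proof (induction w)
  case (Cons b w)
  show ?case
  proof (cases "a = b")
    case False
    then have "row_word e (b # w) = (u_gen e b * u_gen e a * row_word e (remove1 a w) :: ('n, 'k) quantum_algebra)"
      using Cons by (simp add: mult.assoc)
    then show ?thesis using False by (simp add: commute[of b a] mult.assoc)
  qed simp
qed simp

lemma commuting_word_mset:
  "mset w = mset w' \<Longrightarrow> row_word e w = (row_word e w' :: ('n, 'k) quantum_algebra)"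
proof (induction w arbitrary: w')
  case (Cons a w)
  then have a: "a \<in> set w'" by (metis list.set_intros(1) mset_eq_setD)
  have "mset w = mset (remove1 a w')" by (simp flip: Cons.prems)
  from Cons.IH[OF this] show ?case by (simp add: commuting_word_remove[OF a])
qed simp

text \<open>A factor \<open>x\<^sub>e\<^sup>2\<close> can be traded for squares of the other generators.\<close>
lemma commuting_word_reduced:
  "length w \<le> S \<Longrightarrow> row_word e w \<in> cspan (row_word e ` {w. length w \<le> S \<and> count (mset w) e \<le> 1} :: ('n, 'k) quantum_algebra set)"
proof (induction "count (mset w) e" arbitrary: w rule: less_induct)
  case less
  show ?case
  proof (cases "count (mset w) e \<le> 1")
    case True
    then show ?thesis using less.prems by (intro cvec.span_base) auto
  next
    case False
    define w1 w2 where "w1 = remove1 e w" and "w2 = remove1 e w1"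
    have e: "e \<in> set w" using False by (metis count_mset_0_iff le0)
    have "count (mset w1) e \<noteq> 0" using False by (simp add: w1_def)
    then have e1: "e \<in> set w1" by (metis count_mset_0_iff)
    have w: "row_word e w = (u_gen e e * (u_gen e e * row_word e w2) :: ('n, 'k) quantum_algebra)"
      using commuting_word_remove[OF e] commuting_word_remove[OF e1] by (simp add: w1_def w2_def)
    have len: "length w = length w2 + 2"
      using e e1 length_pos_if_in_set[OF e] length_pos_if_in_set[OF e1] by (simp add: w1_def w2_def length_remove1)
    have cnt: "count (mset w2) e < count (mset w) e" using False by (simp add: w2_def w1_def)
    show ?thesis unfolding w
    proof (rule square_expansion_in_span)
      show "row_word e w2 \<in> cspan (row_word e ` {w. length w \<le> S \<and> count (mset w) e \<le> 1} :: ('n, 'k) quantum_algebra set)"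
        using less.hyps[OF cnt] less.prems len by simp
      show "u_gen e j * (u_gen e j * row_word e w2)
          \<in> cspan (row_word e ` {w. length w \<le> S \<and> count (mset w) e \<le> 1} :: ('n, 'k) quantum_algebra set)" if "j \<noteq> e" for j
        using less.hyps[of "j # j # w2"] cnt that less.prems len by simp
    qed
  qed
qed

lemma commuting_dim_upper:
  "cdim (sphere_H e S :: ('n, 'k) quantum_algebra set) \<le> 2 * (S + 1) ^ (CARD('n) - 1)"
proof -
  let ?A = "{w. length w \<le> S \<and> count (mset w) e \<le> 1}"
  let ?K = "{f :: 'n \<Rightarrow> nat. \<forall>j. f j \<le> (if j = e then 1 else S)}"
  have sub: "(\<lambda>w. count (mset w)) ` ?A \<subseteq> ?K"
  proof clarify
    fix w :: "'n list" and j assume w: "length w \<le> S" "count (mset w) e \<le> 1"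
    have "count (mset w) j \<le> length w" using count_le_size[of "mset w" j] by simp
    then show "count (mset w) j \<le> (if j = e then 1 else S)" using w by auto
  qed
  have "cdim (sphere_H e S :: ('n, 'k) quantum_algebra set) \<le> card ((\<lambda>w. count (mset w)) ` ?A)"
  proof (rule cdim_le_card_keys[OF sphere_H_subset_span])
    show "finite ((\<lambda>w. count (mset w)) ` ?A)" using sub card_functions(2) finite_subset by blast
    show "row_word e w = (row_word e w' :: ('n, 'k) quantum_algebra)"
      if "count (mset w) = count (mset w')" for w w'
      by (rule commuting_word_mset, rule multiset_eqI) (simp add: that)
  qed (rule commuting_word_reduced)
  also have "\<dots> \<le> card ?K" by (rule card_mono[OF card_functions(2) sub])
  finally show ?thesis by (simp only: card_functions(1)) simp
qed

end

text \<open>The flag \<open>False\<close> selects the letters in odd position, \<open>True\<close> those in even position.\<close>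
primrec alternate :: "'n list \<Rightarrow> bool \<Rightarrow> 'n multiset" where
  "alternate [] p = {#}"
| "alternate (a # w) p = (if p then {#} else {#a#}) + alternate w (\<not> p)"

lemma size_alternate:
  "size (alternate w False) = (length w + 1) div 2" "size (alternate w True) = length w div 2"
  by (induction w) simp_all

lemma size_eq_sum_count: "size M = (\<Sum>j\<in>UNIV. count M (j :: 'n::finite))"
  unfolding size_multiset_overloaded_eq
  by (rule sum.mono_neutral_left) (auto simp: not_in_iff)

context
  fixes e :: "'n::finite"
  assumes half: "\<And>a b c. u_gen e a * u_gen e b * u_gen e c
    = (u_gen e c * u_gen e b * u_gen e a :: ('n, 'k::liberation_kind) quantum_algebra)"
begin

text \<open>The relation \<open>abc = cba\<close> exchanges letters in positions of the same parity; removing the first letter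
  exchanges the two parities.\<close>
lemma half_commuting_word_extract:
  assumes "a \<in># alternate w False"
  shows "\<exists>w'. row_word e w = (u_gen e a * row_word e w' :: ('n, 'k) quantum_algebra) \<and> length w = Suc (length w')
    \<and> alternate w' True = alternate w False - {#a#} \<and> alternate w' False = alternate w True"
  using assms
proof (induction w rule: induct_list012)
  case (3 x y zs)
  show ?case
  proof (cases "a = x")
    case True
    then show ?thesis by (intro exI[of _ "y # zs"]) simp
  next
    case False
    then have "a \<in># alternate zs False" using 3 by simp
    then obtain v where v: "row_word e zs = (u_gen e a * row_word e v :: ('n, 'k) quantum_algebra)"
      "length zs = Suc (length v)" "alternate v True = alternate zs False - {#a#}"
      "alternate v False = alternate zs True"
      using 3 by blast
    have "row_word e (x # y # zs) = (u_gen e x * u_gen e y * u_gen e a * row_word e v :: ('n, 'k) quantum_algebra)"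
      by (simp add: v(1) mult.assoc)
    also have "\<dots> = u_gen e a * row_word e (y # x # v)"
      by (simp only: half[of x y a]) (simp add: mult.assoc)
    finally show ?thesis
      using v(2-4) False \<open>a \<in># alternate zs False\<close> by (intro exI[of _ "y # x # v"]) simp
  qed
qed auto

lemma half_commuting_word_eq:
  assumes "alternate w False = alternate w' False" "alternate w True = alternate w' True"
  shows "row_word e w = (row_word e w' :: ('n, 'k) quantum_algebra)"
  using assms
proof (induction w arbitrary: w')
  case Nil
  then have "w' = []" by (cases w') auto
  then show ?case by simp
next
  case (Cons a w)
  have "a \<in># alternate w' False" using Cons.prems(1)[symmetric] by simp
  then obtain v where v: "row_word e w' = (u_gen e a * row_word e v :: ('n, 'k) quantum_algebra)"
    "alternate v True = alternate w' False - {#a#}" "alternate v False = alternate w' True"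
    using half_commuting_word_extract by blast
  have "row_word e w = (row_word e v :: ('n, 'k) quantum_algebra)"
    by (rule Cons.IH) (use Cons.prems v(2,3) in \<open>simp_all flip: Cons.prems\<close>)
  then show ?case by (simp add: v(1))
qed

lemma half_commuting_word_reduced:
  "length w \<le> S \<Longrightarrow> row_word e w \<in> cspan (row_word e `
    {w. length w \<le> S \<and> (e \<notin># alternate w False \<or> e \<notin># alternate w True)} :: ('n, 'k) quantum_algebra set)"
proof (induction "count (alternate w False) e" arbitrary: w rule: less_induct)
  case less
  let ?A = "{w. length w \<le> S \<and> (e \<notin># alternate w False \<or> e \<notin># alternate w True)}"
  show ?case
  proof (cases "e \<notin># alternate w False \<or> e \<notin># alternate w True")
    case True
    then show ?thesis using less.prems by (intro cvec.span_base) auto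
  next
    case False
    obtain w1 where w1: "row_word e w = (u_gen e e * row_word e w1 :: ('n, 'k) quantum_algebra)"
      "length w = Suc (length w1)" "alternate w1 True = alternate w False - {#e#}"
      "alternate w1 False = alternate w True"
      using half_commuting_word_extract[of e w] False by blast
    obtain w2 where w2: "row_word e w1 = (u_gen e e * row_word e w2 :: ('n, 'k) quantum_algebra)"
      "length w1 = Suc (length w2)" "alternate w2 True = alternate w1 False - {#e#}"
      "alternate w2 False = alternate w1 True"
      using half_commuting_word_extract[of e w1] False w1(4) by auto
    have cnt: "count (alternate w2 False) e < count (alternate w False) e"
      using False by (simp add: w2 w1 count_greater_zero_iff)
    show ?thesis unfolding w1(1) w2(1)
    proof (rule square_expansion_in_span)
      show "row_word e w2 \<in> cspan (row_word e ` ?A :: ('n, 'k) quantum_algebra set)"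
        using less.hyps[OF cnt] less.prems w1(2) w2(2) by simp
      show "u_gen e j * (u_gen e j * row_word e w2) \<in> cspan (row_word e ` ?A :: ('n, 'k) quantum_algebra set)"
        if "j \<noteq> e" for j
        using less.hyps[of "j # j # w2"] cnt that less.prems w1(2) w2(2) by simp
    qed
  qed
qed

text \<open>A reduced word is determined by the multiplicities of the letters other than \<open>e\<close> and the parity
  of its length: the difference of the multiplicities of \<open>e\<close> in odd and in even position is
  determined by the sizes, and one of the two vanishes.\<close>
lemma half_commuting_dim_upper:
  "cdim (sphere_H e S :: ('n, 'k) quantum_algebra set) \<le> 2 * (S + 1) ^ (2 * (CARD('n) - 1))"
proof -
  let ?A = "{w. length w \<le> S \<and> (e \<notin># alternate w False \<or> e \<notin># alternate w True)}"
  let ?K = "{f :: 'n \<Rightarrow> nat. \<forall>j. f j \<le> (if j = e then 0 else S)}"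
  define others where "others = (\<lambda>M j. if j = e then 0 else count M j)"
  define key where "key = (\<lambda>w. (others (alternate w False), others (alternate w True), odd (length w)))"
  have count: "count (alternate w p) j \<le> length w" for w p and j :: 'n
    using count_le_size[of "alternate w p" j] size_alternate[of w] by (cases p) auto
  have sub: "key ` ?A \<subseteq> ?K \<times> ?K \<times> UNIV"
  proof (rule image_subsetI)
    fix w assume "w \<in> ?A"
    then have w: "length w \<le> S" by simp
    have "others (alternate w p) j \<le> (if j = e then 0 else S)" for p j
      using order_trans[OF count w, of p j] by (simp add: others_def)
    then show "key w \<in> ?K \<times> ?K \<times> UNIV"
      unfolding key_def by (intro SigmaI CollectI allI UNIV_I)
  qed
  have fin: "finite (?K \<times> ?K \<times> (UNIV :: bool set))" by (intro finite_cartesian_product card_functions(2)) simp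
  have size: "size M = count M e + (\<Sum>j\<in>UNIV. others M j)" for M
  proof -
    have "(\<Sum>j\<in>UNIV. count M j) = count M e + (\<Sum>j\<in>UNIV - {e}. count M j)"
      by (rule sum.remove) auto
    also have "(\<Sum>j\<in>UNIV - {e}. count M j) = (\<Sum>j\<in>UNIV. others M j)"
      unfolding others_def by (rule sum.mono_neutral_cong_left) auto
    finally show ?thesis by (simp only: size_eq_sum_count)
  qed
  have inj: "alternate w False = alternate w' False \<and> alternate w True = alternate w' True"
    if w: "w \<in> ?A" "w' \<in> ?A" and eq: "key w = key w'" for w w'
  proof -
    have len: "size (alternate w False) = size (alternate w True) + of_bool (odd (length w))" for w :: "'n list"
      by (cases "even (length w)") (simp_all add: size_alternate)
    have zero: "count (alternate w False) e = 0 \<or> count (alternate w True) e = 0"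
      "count (alternate w' False) e = 0 \<or> count (alternate w' True) e = 0"
      using w by (auto simp: not_in_iff)
    have others: "others (alternate w' False) = others (alternate w False)"
      "others (alternate w' True) = others (alternate w True)" "odd (length w') = odd (length w)"
      using eq by (simp_all add: key_def)
    define r s d where "r = (\<Sum>j\<in>UNIV. others (alternate w False) j)"
      and "s = (\<Sum>j\<in>UNIV. others (alternate w True) j)" and "d = (of_bool (odd (length w)) :: nat)"
    have "count (alternate w False) e + r = count (alternate w True) e + s + d"
      using len[of w] by (simp only: size r_def s_def d_def)
    moreover have "count (alternate w' False) e + r = count (alternate w' True) e + s + d"
      using len[of w'] by (simp only: size others r_def s_def d_def)
    ultimately have e: "count (alternate w False) e = count (alternate w' False) e"
      "count (alternate w True) e = count (alternate w' True) e"
      using zero by linarith+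
    have "M = M'" if "others M = others M'" "count M e = count M' e" for M M'
    proof (rule multiset_eqI)
      show "count M j = count M' j" for j
        using fun_cong[OF that(1), of j] that(2) by (cases "j = e") (simp_all add: others_def)
    qed
    then show ?thesis using e eq by (simp add: key_def)
  qed
  have "cdim (sphere_H e S :: ('n, 'k) quantum_algebra set) \<le> card (key ` ?A)"
  proof (rule cdim_le_card_keys[OF sphere_H_subset_span])
    show "finite (key ` ?A)" using sub fin finite_subset by blast
    show "row_word e w = (row_word e w' :: ('n, 'k) quantum_algebra)"
      if "w \<in> ?A" "w' \<in> ?A" "key w = key w'" for w w'
      using inj[OF that] half_commuting_word_eq by blast
  qed (rule half_commuting_word_reduced)
  also have "\<dots> \<le> card (?K \<times> ?K \<times> (UNIV :: bool set))" by (rule card_mono[OF fin sub])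
  also have "\<dots> = 2 * (S + 1) ^ (2 * (CARD('n) - 1))"
    unfolding card_cartesian_product card_functions(1) card_UNIV_bool
    by (simp only: mult_2 power_add) simp
  finally show ?thesis .
qed

end

section \<open>Lower bounds for the dimensions\<close>

text \<open>Weights in the manner of Kronecker: digits to base \<open>k\<close> can be read off from their weighted sum.\<close>
lemma kronecker_weights:
  assumes "finite I"
  shows "\<exists>wt :: 'i \<Rightarrow> nat. inj_on (\<lambda>r. \<Sum>i\<in>I. r i * wt i) (PiE I (\<lambda>_. {..<k}))"
  using assms
proof (induction I)
  case empty
  then show ?case by simp
next
  case (insert x I)
  obtain wt :: "'i \<Rightarrow> nat" where wt: "inj_on (\<lambda>r. \<Sum>i\<in>I. r i * wt i) (PiE I (\<lambda>_. {..<k}))"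
    using insert.IH by blast
  define wt' where "wt' = (\<lambda>i. if i = x then 1 else k * wt i)"
  have sum: "(\<Sum>i\<in>insert x I. r i * wt' i) = r x + k * (\<Sum>i\<in>I. r i * wt i)" for r
  proof -
    have "(\<Sum>i\<in>I. r i * wt' i) = (\<Sum>i\<in>I. k * (r i * wt i))"
      by (intro sum.cong refl) (use insert.hyps(2) in \<open>auto simp: wt'_def\<close>)
    then show ?thesis using insert.hyps by (simp add: wt'_def sum_distrib_left)
  qed
  have "inj_on (\<lambda>r. \<Sum>i\<in>insert x I. r i * wt' i) (PiE (insert x I) (\<lambda>_. {..<k}))"
  proof (rule inj_onI)
    fix r s assume r: "r \<in> PiE (insert x I) (\<lambda>_. {..<k})" and s: "s \<in> PiE (insert x I) (\<lambda>_. {..<k})"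
      and "(\<Sum>i\<in>insert x I. r i * wt' i) = (\<Sum>i\<in>insert x I. s i * wt' i)"
    then have eq: "r x + k * (\<Sum>i\<in>I. r i * wt i) = s x + k * (\<Sum>i\<in>I. s i * wt i)" by (simp only: sum)
    have lt: "r x < k" "s x < k" using r s by auto
    have x: "r x = s x" using arg_cong[OF eq, of "\<lambda>n. n mod k"] lt by simp
    then have "(\<Sum>i\<in>I. r i * wt i) = (\<Sum>i\<in>I. s i * wt i)" using eq lt by simp
    then have "(\<Sum>i\<in>I. restrict r I i * wt i) = (\<Sum>i\<in>I. restrict s I i * wt i)"
      by simp
    then have "restrict r I = restrict s I" by (rule inj_onD[OF wt]) (use r s in auto)
    then have I: "r i = s i" if "i \<in> I" for i using that by (metis restrict_apply')
    show "r = s"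
    proof
      show "r i = s i" for i
        using r s x I[of i] by (cases "i \<in> insert x I") (auto simp: PiE_def extensional_def)
    qed
  qed
  then show ?case by blast
qed

lemma monomials_independent:
  fixes k c :: "'p \<Rightarrow> complex" and T :: "complex set"
  assumes "finite P" "inj_on n P" "infinite T" and c: "\<And>p. p \<in> P \<Longrightarrow> c p \<noteq> 0"
    and zero: "\<And>t. t \<in> T \<Longrightarrow> (\<Sum>p\<in>P. k p * (c p * t ^ n p)) = 0" and p: "p \<in> P"
  shows "k p = 0"
proof -
  define f where "f = (\<Sum>p\<in>P. monom (k p * c p) (n p))"
  have "poly f t = 0" if "t \<in> T" for t
    using zero[OF that] by (simp add: f_def poly_sum poly_monom mult.assoc)
  then have "T \<subseteq> {t. poly f t = 0}" by auto
  then have "f = 0" using poly_roots_finite[of f] assms(3) finite_subset by blast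
  moreover have "coeff f (n p) = (\<Sum>p'\<in>P. if p' = p then k p' * c p' else 0)"
    unfolding f_def coeff_sum coeff_monom
    by (intro sum.cong refl) (use assms(2) p in \<open>auto dest: inj_onD\<close>)
  ultimately show ?thesis using assms(1) p c by simp
qed

lemma dim_lower_bound:
  fixes a :: "('i \<Rightarrow> nat) \<Rightarrow> ('n::finite, 'k::liberation_kind) quantum_algebra"
  assumes I: "finite I" "card I = m" and wt: "inj_on (\<lambda>r. \<Sum>i\<in>I. r i * wt i) (PiE I (\<lambda>_. {..<k}))"
    and V: "\<And>r. r \<in> PiE I (\<lambda>_. {..<k}) \<Longrightarrow> a r \<in> sphere_H e S"
    and T: "infinite T"
    and \<psi>: "\<And>t. t \<in> T \<Longrightarrow> \<exists>\<psi>. (\<forall>a b. \<psi> (a + b) = \<psi> a + \<psi> b) \<and> (\<forall>c a. \<psi> (c *\<^sub>C a) = c * \<psi> a)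
      \<and> (\<forall>r\<in>PiE I (\<lambda>_. {..<k}). \<psi> (a r) = c r * t ^ (d + (\<Sum>i\<in>I. r i * wt i)))"
    and c: "\<And>r. c r \<noteq> (0 :: complex)"
  shows "k ^ m \<le> cdim (sphere_H e S :: ('n, 'k) quantum_algebra set)"
proof -
  let ?P = "PiE I (\<lambda>_. {..<k})"
  have P: "finite ?P" using I(1) by (intro finite_PiE) auto
  have "card ?P = k ^ m" using I by (simp add: card_PiE)
  moreover have "card ?P \<le> cdim (sphere_H e S :: ('n, 'k) quantum_algebra set)"
  proof (rule cvec.card_le_dim_family[OF P, where a = a])
    show "finite (row_word e ` {J. length J \<le> S} :: ('n, 'k) quantum_algebra set)" by simp
    show "sphere_H e S \<subseteq> cspan (row_word e ` {J. length J \<le> S} :: ('n, 'k) quantum_algebra set)"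
      by (simp add: sphere_H_eq)
    show "a ` ?P \<subseteq> sphere_H e S" using V by auto
    fix l p assume zero: "(\<Sum>p\<in>?P. l p *\<^sub>C a p) = 0" and p: "p \<in> ?P"
    show "l p = 0"
    proof (rule monomials_independent[OF P _ T _ _ p, where c = c])
      show "inj_on (\<lambda>r. d + (\<Sum>i\<in>I. r i * wt i)) ?P"
      proof (rule inj_onI)
        fix r s assume rs: "r \<in> ?P" "s \<in> ?P"
          and "d + (\<Sum>i\<in>I. r i * wt i) = d + (\<Sum>i\<in>I. s i * wt i)"
        then have "(\<Sum>i\<in>I. r i * wt i) = (\<Sum>i\<in>I. s i * wt i)" by simp
        then show "r = s" by (rule inj_onD[OF wt]) (rule rs)+
      qed
      fix t assume "t \<in> T"
      from \<psi>[OF this] obtain \<psi> where \<psi>: "\<forall>a b. \<psi> (a + b) = \<psi> a + \<psi> b" "\<forall>c a. \<psi> (c *\<^sub>C a) = c * \<psi> a"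
        "\<forall>r\<in>?P. \<psi> (a r) = c r * t ^ (d + (\<Sum>i\<in>I. r i * wt i))" by (elim exE conjE)
      have \<psi>0: "\<psi> 0 = 0" using \<psi>(2)[rule_format, of 0 0] by simp
      have "\<psi> (\<Sum>p\<in>A. f p) = (\<Sum>p\<in>A. \<psi> (f p))" for A and f :: "('i \<Rightarrow> nat) \<Rightarrow> _"
        by (induction A rule: infinite_finite_induct) (simp_all add: \<psi>(1) \<psi>0)
      then have "(\<Sum>p\<in>?P. l p * \<psi> (a p)) = \<psi> (\<Sum>p\<in>?P. l p *\<^sub>C a p)"
        by (simp add: \<psi>(2))
      then have "(\<Sum>p\<in>?P. l p * \<psi> (a p)) = 0" by (simp only: zero \<psi>0)
      then show "(\<Sum>p\<in>?P. l p * (c p * t ^ (d + (\<Sum>i\<in>I. p i * wt i)))) = 0"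
        by (simp add: \<psi>(3) cong: sum.cong_simp)
    qed (rule c)
  qed
  ultimately show ?thesis by simp
qed

lemma prod_list_concat_replicate:
  "prod_list (map f (concat (map (\<lambda>j. replicate (r j) j) xs))) = (\<Prod>j\<leftarrow>xs. f j ^ r j)"
  for f :: "'n \<Rightarrow> 'a::monoid_mult"
  by (induction xs) (simp_all add: prod_list_replicate)

lemma length_concat_replicate: "length (concat (map (\<lambda>j. replicate (r j) j) xs)) = (\<Sum>j\<leftarrow>xs. r j)"
  by (induction xs) simp_all

lemma obtain_other_letters:
  obtains xs where "distinct xs" "set xs = UNIV - {e :: 'n::finite}"
  using finite_distinct_list[of "UNIV - {e}"] by auto

text \<open>The monomials with exponents below \<open>k\<close> in the coordinates other than \<open>e\<close> are separated by the points of the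
  unit sphere with coordinates \<open>t\<^bsup>wt j\<^esup> / N\<close>, \<open>0 < t < 1\<close>.\<close>
lemma classical_dim_lower:
  fixes e :: "'n::finite"
  assumes "CARD('n) \<ge> 2"
  shows "k ^ (CARD('n) - 1) \<le> cdim (sphere_H e ((CARD('n) - 1) * k) :: ('n, 'k::liberation_kind) quantum_algebra set)"
proof -
  define I where "I = UNIV - {e}"
  define N where "N = real CARD('n)"
  have N: "N \<ge> 2" using assms by (simp add: N_def)
  have I: "finite I" "card I = CARD('n) - 1" by (simp_all add: I_def card_Diff_singleton)
  obtain xs where xs: "distinct xs" "set xs = I" unfolding I_def by (rule obtain_other_letters)
  have sum_xs: "(\<Sum>j\<leftarrow>xs. f j) = (\<Sum>j\<in>I. f j)" for f :: "'n \<Rightarrow> nat"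
    using sum_list_distinct_conv_sum_set[OF xs(1), of f] xs(2) by simp
  have prod_xs: "(\<Prod>j\<leftarrow>xs. f j) = (\<Prod>j\<in>I. f j)" for f :: "'n \<Rightarrow> complex"
    using prod.distinct_set_conv_list[OF xs(1), of f] xs(2) by simp
  obtain wt :: "'n \<Rightarrow> nat" where wt: "inj_on (\<lambda>r. \<Sum>i\<in>I. r i * wt i) (PiE I (\<lambda>_. {..<k}))"
    using kronecker_weights[OF I(1)] by blast
  define J where "J = (\<lambda>r. concat (map (\<lambda>j. replicate (r j) j) xs))"
  show ?thesis
  proof (rule dim_lower_bound[OF I wt, where a = "\<lambda>r. row_word e (J r)" and d = 0
        and c = "\<lambda>r. (1 / of_real N) ^ (\<Sum>i\<in>I. r i)" and T = "of_real ` {0<..<1}"])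
    show "row_word e (J r) \<in> sphere_H e ((CARD('n) - 1) * k)" if "r \<in> PiE I (\<lambda>_. {..<k})" for r
    proof (rule row_word_in_H)
      have "(\<Sum>j\<in>I. r j) \<le> (\<Sum>j\<in>I. k)" by (rule sum_mono) (use that in \<open>auto dest!: PiE_mem\<close>)
      then show "length (J r) \<le> (CARD('n) - 1) * k"
        by (simp add: J_def length_concat_replicate sum_xs I)
    qed
    show "infinite (complex_of_real ` {0<..<1})"
    proof
      assume "finite (complex_of_real ` {0<..<1})"
      then have "finite {0<..<1::real}" by (rule finite_imageD) (simp add: inj_on_def)
      then show False using infinite_Ioo[of "0::real" 1] by simp
    qed
    fix t' :: complex assume "t' \<in> of_real ` {0<..<1}"
    then obtain t :: real where t: "t' = of_real t" "0 < t" "t < 1" by auto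
    define u where "u = (\<lambda>j. t ^ wt j / N)"
    define v where "v = (\<lambda>j. if j = e then sqrt (1 - (\<Sum>j\<in>I. (u j)\<^sup>2)) else u j)"
    have u: "0 < u j" "(u j)\<^sup>2 \<le> (1 / N)\<^sup>2" for j
    proof -
      show "0 < u j" using t N by (simp add: u_def)
      have "u j \<le> 1 / N" using t N by (simp add: u_def divide_right_mono power_le_one)
      then show "(u j)\<^sup>2 \<le> (1 / N)\<^sup>2" using \<open>0 < u j\<close> by (intro power_mono) auto
    qed
    have "(\<Sum>j\<in>I. (u j)\<^sup>2) \<le> (\<Sum>j\<in>I. (1 / N)\<^sup>2)" by (intro sum_mono u)
    also have "\<dots> = real (card I) * (1 / N)\<^sup>2" by simp
    also have "\<dots> \<le> N * (1 / N)\<^sup>2" by (intro mult_right_mono) (auto simp: I N_def)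
    also have "\<dots> \<le> 1" using N by (simp add: power2_eq_square)
    finally have le1: "(\<Sum>j\<in>I. (u j)\<^sup>2) \<le> 1" .
    have "I \<noteq> {}" using I(2) assms by auto
    then have pos: "0 < (\<Sum>j\<in>I. (u j)\<^sup>2)" by (intro sum_pos I(1) zero_less_power u(1))
    have "(\<Sum>j\<in>UNIV. (v j)\<^sup>2) = (v e)\<^sup>2 + (\<Sum>j\<in>I. (v j)\<^sup>2)" unfolding I_def by (rule sum.remove) auto
    also have "(\<Sum>j\<in>I. (v j)\<^sup>2) = (\<Sum>j\<in>I. (u j)\<^sup>2)" by (intro sum.cong refl) (auto simp: v_def I_def)
    finally have v1: "(\<Sum>j\<in>UNIV. (v j)\<^sup>2) = 1" using le1 by (simp add: v_def)
    have "v e \<noteq> 1" using pos le1 by (simp add: v_def)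
    then obtain \<psi> :: "('n, 'k) quantum_algebra \<Rightarrow> complex"
      where \<psi>: "\<And>a b. \<psi> (a + b) = \<psi> a + \<psi> b" "\<And>c a. \<psi> (c *\<^sub>C a) = c * \<psi> a"
        "\<And>a b. \<psi> (a * b) = \<psi> a * \<psi> b" "\<psi> 1 = 1" "\<And>j. \<psi> (u_gen e j) = of_real (v j)"
      using character[OF v1] by blast
    have word: "\<psi> (row_word e w) = prod_list (map (\<lambda>j. complex_of_real (v j)) w)" for w
      by (induction w) (simp_all add: \<psi>)
    have val: "\<psi> (row_word e (J r)) = (1 / of_real N) ^ (\<Sum>i\<in>I. r i) * t' ^ (0 + (\<Sum>i\<in>I. r i * wt i))" for r
    proof -
      have "\<psi> (row_word e (J r)) = prod_list (map (\<lambda>j. complex_of_real (v j)) (J r))" by (rule word)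
      also have "\<dots> = (\<Prod>j\<in>I. of_real (v j) ^ r j)"
        unfolding J_def prod_list_concat_replicate prod_xs ..
      also have "\<dots> = (\<Prod>j\<in>I. (1 / of_real N) ^ r j * t' ^ (r j * wt j))"
        by (intro prod.cong refl) (auto simp: v_def u_def I_def t(1) power_divide power_mult[symmetric] mult.commute)
      finally show ?thesis by (simp add: prod.distrib power_sum)
    qed
    show "\<exists>\<psi>. (\<forall>a b. \<psi> (a + b) = \<psi> a + \<psi> b) \<and> (\<forall>c a. \<psi> (c *\<^sub>C a) = c * \<psi> a) \<and>
        (\<forall>r\<in>PiE I (\<lambda>_. {..<k}). \<psi> (row_word e (J r) :: ('n, 'k) quantum_algebra)
          = (1 / of_real N) ^ (\<Sum>i\<in>I. r i) * t' ^ (0 + (\<Sum>i\<in>I. r i * wt i)))"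
      by (intro exI[of _ \<psi>] conjI allI ballI) (rule \<psi>(1), rule \<psi>(2), rule val)
  qed (use N in simp)
qed

primrec alternating_prod :: "('n \<Rightarrow> complex) \<Rightarrow> ('n \<Rightarrow> complex) \<Rightarrow> 'n list \<Rightarrow> bool \<Rightarrow> complex" where
  "alternating_prod a b [] p = 1"
| "alternating_prod a b (j # J) p = (if p then b j else a j) * alternating_prod a b J (\<not> p)"

text \<open>The product of the shears \<open>1 + e \<alpha>\<^sup>t\<close> and \<open>1 - \<beta> e\<^sup>t\<close> and its inverse transpose give a point of
  the half-liberated quantum group whose rows with index \<open>e\<close> are \<open>(1 - \<alpha>\<beta>, \<alpha>)\<close> and \<open>(1, \<beta>)\<close>.\<close>
lemma half_liberated_point:
  fixes \<alpha> \<beta> :: "'n::finite \<Rightarrow> complex"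
  assumes nonclassical: "liberation_of TYPE('k::liberation_kind) \<noteq> Classical"
    and e: "\<alpha> e = 0" "\<beta> e = 0"
  shows "\<exists>\<psi> :: ('n, 'k) quantum_algebra \<Rightarrow> complex.
    (\<forall>a b. \<psi> (a + b) = \<psi> a + \<psi> b) \<and> (\<forall>c a. \<psi> (c *\<^sub>C a) = c * \<psi> a) \<and>
    (\<forall>J. \<psi> (row_word e J) = alternating_prod (\<alpha>(e := 1 - (\<Sum>j\<in>UNIV. \<alpha> j * \<beta> j))) (\<beta>(e := 1)) J False)"
proof -
  define s where "s = (\<Sum>j\<in>UNIV. \<alpha> j * \<beta> j)"
  define \<delta> :: "'n \<Rightarrow> 'n \<Rightarrow> complex" where "\<delta> = (\<lambda>i j. of_bool (i = j))"
  define Z where "Z = (\<lambda>i j. \<delta> i j - \<delta> j e * \<beta> i + \<delta> i e * \<alpha> j - \<delta> i e * s * \<delta> j e)"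
  define W where "W = (\<lambda>i j. \<delta> i j - \<delta> j e * \<alpha> i + \<delta> i e * \<beta> j - \<beta> j * \<alpha> i)"
  have delta: "(\<Sum>k\<in>UNIV. \<delta> i k * f k) = f i" "(\<Sum>k\<in>UNIV. \<delta> k i * f k) = f i"
    for i and f :: "'n \<Rightarrow> complex"
    by (simp_all add: \<delta>_def of_bool_def if_distrib[of "\<lambda>c. c * _"] cong: if_cong)
  have sumZ: "(\<Sum>k\<in>UNIV. Z i k * f k) = f i - \<beta> i * f e + \<delta> i e * (\<Sum>k\<in>UNIV. \<alpha> k * f k) - \<delta> i e * s * f e"
    for i f
  proof -
    have "(\<Sum>k\<in>UNIV. Z i k * f k) = (\<Sum>k\<in>UNIV. \<delta> i k * f k) - \<beta> i * (\<Sum>k\<in>UNIV. \<delta> k e * f k)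
        + \<delta> i e * (\<Sum>k\<in>UNIV. \<alpha> k * f k) - \<delta> i e * s * (\<Sum>k\<in>UNIV. \<delta> k e * f k)"
      unfolding Z_def sum_distrib_left sum.distrib[symmetric] sum_subtractf[symmetric]
      by (intro sum.cong refl) (simp add: algebra_simps)
    then show ?thesis by (simp only: delta)
  qed
  have sumZ': "(\<Sum>k\<in>UNIV. Z k i * f k) = f i - \<delta> i e * (\<Sum>k\<in>UNIV. \<beta> k * f k) + \<alpha> i * f e - \<delta> i e * s * f e"
    for i f
  proof -
    have "(\<Sum>k\<in>UNIV. Z k i * f k) = (\<Sum>k\<in>UNIV. \<delta> k i * f k) - \<delta> i e * (\<Sum>k\<in>UNIV. \<beta> k * f k)
        + \<alpha> i * (\<Sum>k\<in>UNIV. \<delta> k e * f k) - \<delta> i e * s * (\<Sum>k\<in>UNIV. \<delta> k e * f k)"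
      unfolding Z_def sum_distrib_left sum.distrib[symmetric] sum_subtractf[symmetric]
      by (intro sum.cong refl) (simp add: algebra_simps)
    then show ?thesis by (simp only: delta)
  qed
  have \<alpha>W: "(\<Sum>k\<in>UNIV. \<alpha> k * W j k) = \<alpha> j + s * \<delta> j e - s * \<alpha> j" for j
  proof -
    have "(\<Sum>k\<in>UNIV. \<alpha> k * W j k) = (\<Sum>k\<in>UNIV. \<delta> j k * \<alpha> k) - \<alpha> j * (\<Sum>k\<in>UNIV. \<delta> k e * \<alpha> k)
        + \<delta> j e * s - \<alpha> j * s"
      unfolding W_def s_def sum_distrib_left sum.distrib[symmetric] sum_subtractf[symmetric]
      by (intro sum.cong refl) (simp add: algebra_simps)
    then show ?thesis by (simp only: delta e) (simp add: mult.commute)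
  qed
  have \<beta>W: "(\<Sum>k\<in>UNIV. \<beta> k * W k j) = \<beta> j - s * \<delta> j e - s * \<beta> j" for j
  proof -
    have "(\<Sum>k\<in>UNIV. \<beta> k * W k j) = (\<Sum>k\<in>UNIV. \<delta> k j * \<beta> k) - \<delta> j e * s
        + \<beta> j * (\<Sum>k\<in>UNIV. \<delta> k e * \<beta> k) - \<beta> j * s"
      unfolding W_def s_def sum_distrib_left sum.distrib[symmetric] sum_subtractf[symmetric]
      by (intro sum.cong refl) (simp add: algebra_simps)
    then show ?thesis by (simp only: delta e) (simp add: mult.commute)
  qed
  have sym: "\<delta> i j = \<delta> j i" for i j by (simp add: \<delta>_def eq_commute)
  have ee: "\<delta> e e = 1" by (simp add: \<delta>_def)
  have ZW: "(\<Sum>k\<in>UNIV. Z i k * W j k) = \<delta> i j" for i j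
    unfolding sumZ \<alpha>W by (simp add: W_def e ee sym[of j i] algebra_simps)
  have ZW': "(\<Sum>k\<in>UNIV. Z k i * W k j) = \<delta> i j" for i j
    unfolding sumZ' \<beta>W by (simp add: W_def e ee sym[of e j] sym[of e i] algebra_simps)
  define M where "M = (\<lambda>p i j. if p then W i j else Z i j)"
  have MM: "(\<Sum>k\<in>UNIV. M p i k * M (\<not> p) j k) = \<delta> i j" "(\<Sum>k\<in>UNIV. M p k i * M (\<not> p) k j) = \<delta> i j" for p i j
  proof -
    show "(\<Sum>k\<in>UNIV. M p i k * M (\<not> p) j k) = \<delta> i j"
      using ZW[of i j] ZW[of j i] by (cases p) (simp_all add: M_def mult.commute[of "W _ _"] sym[of j i])
    show "(\<Sum>k\<in>UNIV. M p k i * M (\<not> p) k j) = \<delta> i j"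
      using ZW'[of i j] ZW'[of j i] by (cases p) (simp_all add: M_def mult.commute[of "W _ _"] sym[of j i])
  qed
  define g :: "'n \<Rightarrow> 'n \<Rightarrow> bool linop" where "g = (\<lambda>i j. Linop (\<lambda>v p. M p i j * v (\<not> p)))"
  have app_g: "app (g i j) v p = M p i j * v (\<not> p)" for i j v p
    unfolding g_def by (subst Linop_inverse) (auto simp: fun_eq_iff algebra_simps)
  have "\<exists>\<Phi> :: ('n, 'k) quantum_algebra \<Rightarrow> bool linop. algebra_hom \<Phi> \<and> (\<forall>i j. \<Phi> (u_gen i j) = g i j)"
  proof (rule quantum_algebra_hom)
    show "(\<Sum>k\<in>UNIV. g i k * g j k) = of_bool (i = j) *\<^sub>C 1" for i j
      by (rule linop_eqI) (simp add: app_simps app_g mult.assoc[symmetric] sum_distrib_right[symmetric] MM, simp add: \<delta>_def)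
    show "(\<Sum>k\<in>UNIV. g k i * g k j) = of_bool (i = j) *\<^sub>C 1" for i j
      by (rule linop_eqI) (simp add: app_simps app_g mult.assoc[symmetric] sum_distrib_right[symmetric] MM, simp add: \<delta>_def)
    show "g i j * g k l * g m n = g m n * g k l * g i j" for i j k l m n
      by (rule linop_eqI) (simp add: app_simps app_g mult_ac)
  qed (use nonclassical in simp)
  then obtain \<Phi> :: "('n, 'k) quantum_algebra \<Rightarrow> bool linop"
    where \<Phi>: "algebra_hom \<Phi>" "\<And>i j. \<Phi> (u_gen i j) = g i j" by blast
  have rows: "M False e = \<alpha>(e := 1 - s)" "M True e = \<beta>(e := 1)"
    by (auto simp: fun_eq_iff M_def Z_def W_def \<delta>_def e)
  have "app (\<Phi> (row_word e J)) (\<lambda>_. 1) p = alternating_prod (\<alpha>(e := 1 - s)) (\<beta>(e := 1)) J p" for J p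
  proof (induction J arbitrary: p)
    case Nil
    show ?case by (simp add: algebra_homD[OF \<Phi>(1)] app_simps)
  next
    case (Cons j J)
    have "M p e j = (if p then (\<beta>(e := 1)) j else (\<alpha>(e := 1 - s)) j)"
      using rows by (cases p) simp_all
    then show ?case
      by (simp add: algebra_homD[OF \<Phi>(1)] app_simps \<Phi>(2) app_g Cons.IH del: fun_upd_apply)
  qed
  then show ?thesis
    by (intro exI[of _ "\<lambda>a. app (\<Phi> a) (\<lambda>_. 1) False"] conjI allI) (simp_all add: algebra_homD[OF \<Phi>(1)] app_simps s_def)
qed

lemma alternating_prod_interleave:
  "length O' = length E \<Longrightarrow>
    alternating_prod a b (concat (map (\<lambda>(i, j). [i, j]) (zip O' E))) False = prod_list (map a O') * prod_list (map b E)"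
  by (induction O' E rule: list_induct2) simp_all

lemma length_interleave:
  "length O' = length E \<Longrightarrow> length (concat (map (\<lambda>(i, j). [i, j]) (zip O' E))) = 2 * length O'"
  by (induction O' E rule: list_induct2) simp_all

text \<open>Odd and even positions evaluate to independent coordinates, so there are twice as many parameters as in
  the classical case.\<close>
lemma nonclassical_dim_lower:
  fixes e :: "'n::finite"
  assumes nonclassical: "liberation_of TYPE('k::liberation_kind) \<noteq> Classical"
  shows "k ^ (2 * (CARD('n) - 1)) \<le> cdim (sphere_H e (4 * (CARD('n) - 1) * k) :: ('n, 'k::liberation_kind) quantum_algebra set)"
proof -
  define L where "L = UNIV - {e}"
  define I where "I = L \<times> (UNIV :: bool set)"
  have L: "finite L" "card L = CARD('n) - 1" by (simp_all add: L_def card_Diff_singleton)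
  have I: "finite I" "card I = 2 * (CARD('n) - 1)" using L by (simp_all add: I_def card_cartesian_product)
  obtain xs where xs: "distinct xs" "set xs = L" unfolding L_def by (rule obtain_other_letters)
  have sum_xs: "(\<Sum>j\<leftarrow>xs. f j) = (\<Sum>j\<in>L. f j)" for f :: "'n \<Rightarrow> nat"
    using sum_list_distinct_conv_sum_set[OF xs(1), of f] xs(2) by simp
  have prod_xs: "(\<Prod>j\<leftarrow>xs. f j) = (\<Prod>j\<in>L. f j)" for f :: "'n \<Rightarrow> complex"
    using prod.distinct_set_conv_list[OF xs(1), of f] xs(2) by simp
  have sum_I: "(\<Sum>i\<in>I. f i) = (\<Sum>j\<in>L. f (j, False)) + (\<Sum>j\<in>L. f (j, True))" for f :: "'n \<times> bool \<Rightarrow> nat"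
    using sum.cartesian_product[of "\<lambda>j p. f (j, p)" UNIV L] by (simp add: I_def UNIV_bool sum.distrib)
  obtain wt :: "'n \<times> bool \<Rightarrow> nat" where wt: "inj_on (\<lambda>r. \<Sum>i\<in>I. r i * wt i) (PiE I (\<lambda>_. {..<k}))"
    using kronecker_weights[OF I(1)] by blast
  define odds where "odds = (\<lambda>r :: 'n \<times> bool \<Rightarrow> nat. concat (map (\<lambda>j. replicate (k + r (j, False)) j) xs))"
  define evens0 where "evens0 = (\<lambda>r :: 'n \<times> bool \<Rightarrow> nat. concat (map (\<lambda>j. replicate (r (j, True)) j) xs))"
  \<comment> \<open>The even positions are filled up with the letter \<open>e\<close>, whose value at even positions is 1; each letter
    occurs at least \<open>k\<close> times at odd positions to leave room for this.\<close>
  define evens where "evens = (\<lambda>r. evens0 r @ replicate (length (odds r) - length (evens0 r)) e)"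
  define J where "J = (\<lambda>r. concat (map (\<lambda>(i, j). [i, j]) (zip (odds r) (evens r))))"
  have lengths: "length (odds r) = length (evens r)" "length (odds r) \<le> (CARD('n) - 1) * (2 * k)"
    if r: "r \<in> PiE I (\<lambda>_. {..<k})" for r
  proof -
    have lt: "r (j, p) \<le> k" if "j \<in> L" for j p using PiE_mem[OF r, of "(j, p)"] that by (simp add: I_def)
    have "(\<Sum>j\<in>L. r (j, True)) \<le> (\<Sum>j\<in>L. k + r (j, False))"
      by (intro sum_mono trans_le_add1 lt)
    then show "length (odds r) = length (evens r)"
      by (simp add: evens_def odds_def evens0_def length_concat_replicate sum_xs)
    have "(\<Sum>j\<in>L. k + r (j, False)) \<le> (\<Sum>j\<in>L. 2 * k)"
      by (intro sum_mono) (use lt in force)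
    then show "length (odds r) \<le> (CARD('n) - 1) * (2 * k)"
      by (simp add: odds_def length_concat_replicate sum_xs L)
  qed
  show ?thesis
  proof (rule dim_lower_bound[OF I wt, where a = "\<lambda>r. row_word e (J r)" and d = "\<Sum>j\<in>L. k * wt (j, False)"
        and c = "\<lambda>_. 1" and T = UNIV])
    show "row_word e (J r) \<in> sphere_H e (4 * (CARD('n) - 1) * k)" if "r \<in> PiE I (\<lambda>_. {..<k})" for r
    proof (rule row_word_in_H)
      have "length (J r) = 2 * length (odds r)"
        unfolding J_def by (rule length_interleave[OF lengths(1)[OF that]])
      also have "\<dots> \<le> 2 * ((CARD('n) - 1) * (2 * k))" by (rule mult_le_mono2[OF lengths(2)[OF that]])
      also have "\<dots> = 4 * (CARD('n) - 1) * k" by simp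
      finally show "length (J r) \<le> 4 * (CARD('n) - 1) * k" .
    qed
    fix t :: complex
    define \<alpha> where "\<alpha> = (\<lambda>j. if j = e then 0 else t ^ wt (j, False))"
    define \<beta> where "\<beta> = (\<lambda>j. if j = e then 0 else t ^ wt (j, True))"
    define a where "a = \<alpha>(e := 1 - (\<Sum>j\<in>UNIV. \<alpha> j * \<beta> j))"
    define b where "b = \<beta>(e := 1)"
    have "\<alpha> e = 0" "\<beta> e = 0" by (simp_all add: \<alpha>_def \<beta>_def)
    from half_liberated_point[of \<alpha> e \<beta>, OF nonclassical this] obtain \<psi> :: "('n, 'k) quantum_algebra \<Rightarrow> complex"
      where \<psi>: "\<forall>a b. \<psi> (a + b) = \<psi> a + \<psi> b" "\<forall>c a. \<psi> (c *\<^sub>C a) = c * \<psi> a"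
        "\<forall>J. \<psi> (row_word e J) = alternating_prod a b J False"
      unfolding a_def b_def by (elim exE conjE)
    have ab: "a j = t ^ wt (j, False)" "b j = t ^ wt (j, True)" if "j \<in> L" for j
      using that by (auto simp: a_def b_def \<alpha>_def \<beta>_def L_def)
    have be: "b e = 1" by (simp add: b_def)
    have val: "\<psi> (row_word e (J r)) = t ^ ((\<Sum>j\<in>L. k * wt (j, False)) + (\<Sum>i\<in>I. r i * wt i))"
      if r: "r \<in> PiE I (\<lambda>_. {..<k})" for r
    proof -
      have "\<psi> (row_word e (J r)) = prod_list (map a (odds r)) * prod_list (map b (evens r))"
        using \<psi>(3) alternating_prod_interleave[OF lengths(1)[OF r]] unfolding J_def by simp
      also have "prod_list (map a (odds r)) = (\<Prod>j\<in>L. a j ^ (k + r (j, False)))"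
        unfolding odds_def prod_list_concat_replicate prod_xs ..
      also have "\<dots> = (\<Prod>j\<in>L. t ^ (k * wt (j, False) + r (j, False) * wt (j, False)))"
        by (intro prod.cong refl)
          (simp add: ab(1) power_mult[symmetric] distrib_left mult.commute[of "wt _"])
      also have "prod_list (map b (evens r)) = prod_list (map b (evens0 r))"
        by (simp add: evens_def prod_list_replicate be)
      also have "\<dots> = (\<Prod>j\<in>L. b j ^ r (j, True))"
        unfolding evens0_def prod_list_concat_replicate prod_xs ..
      also have "\<dots> = (\<Prod>j\<in>L. t ^ (r (j, True) * wt (j, True)))"
        by (intro prod.cong refl) (simp add: ab(2) power_mult[symmetric] mult.commute[of "wt _"])
      finally show ?thesis
        by (simp only: power_sum[symmetric] power_add[symmetric] sum_I sum.distrib add.assoc)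
    qed
    show "\<exists>\<psi>. (\<forall>a b. \<psi> (a + b) = \<psi> a + \<psi> b) \<and> (\<forall>c a. \<psi> (c *\<^sub>C a) = c * \<psi> a) \<and>
        (\<forall>r\<in>PiE I (\<lambda>_. {..<k}). \<psi> (row_word e (J r) :: ('n, 'k) quantum_algebra)
          = 1 * t ^ ((\<Sum>j\<in>L. k * wt (j, False)) + (\<Sum>i\<in>I. r i * wt i)))"
      by (intro exI[of _ \<psi>] conjI allI ballI) (rule \<psi>(1)[rule_format], rule \<psi>(2)[rule_format], simp add: val)
  qed (simp_all add: infinite_UNIV_char_0)
qed

section \<open>The action of free reflections on reduced words\<close>

text \<open>The action of the generator \<open>a\<close> of the free product of copies of the group with two elements on
  its reduced words. Lists that are not reduced are fixed, so that \<open>act a\<close> is an involution of all lists.\<close>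
definition act :: "'n \<Rightarrow> 'n list \<Rightarrow> 'n list" where
  "act a w = (if distinct_adj w then (if w \<noteq> [] \<and> hd w = a then tl w else a # w) else w)"

lemma act_act: "act a (act a w) = w"
  by (cases w) (auto simp: act_def distinct_adj_Cons)

lemma act_Cons_same: "distinct_adj (a # w) \<Longrightarrow> act a (a # w) = w"
  by (simp add: act_def)

lemma act_extend: "distinct_adj (a # w) \<Longrightarrow> act a w = a # w"
  by (cases w) (auto simp: act_def distinct_adj_Cons)

lemma length_act: "length w \<le> Suc (length (act a w))"
  by (auto simp: act_def)

definition reduced :: "nat \<Rightarrow> 'n list set" where
  "reduced L = {w. distinct_adj w \<and> length w \<le> L}"

lemma finite_reduced [simp]: "finite (reduced L :: 'n::finite list set)"
  by (rule finite_subset[OF _ finite_short_words[of L]]) (auto simp: reduced_def)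

text \<open>The Cayley graph is a tree: a sum over the vertices \<open>w\<close> and their neighbours in direction \<open>a\<close>
  is a sum over the edges in direction \<open>a\<close>, each of which is met from both of its ends.\<close>
lemma sum_edges:
  fixes T :: "'n::finite list \<Rightarrow> 'n list \<Rightarrow> 'b::comm_monoid_add"
  assumes zero: "\<And>w w'. length w = L \<Longrightarrow> T w w' = 0"
  shows "(\<Sum>w\<in>reduced L. T w (act a w))
    = (\<Sum>w\<in>{w. distinct_adj (a # w) \<and> length w < L}. T w (a # w) + T (a # w) w)"
proof -
  let ?E = "{w. distinct_adj (a # w) \<and> length w < L}"
  have fin: "finite ?E" by (rule finite_subset[OF _ finite_short_words[of L]]) auto
  have eq: "reduced L = (Cons a ` ?E) \<union> {w\<in>reduced L. distinct_adj (a # w)}"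
  proof (intro equalityI subsetI)
    fix w :: "'n list" assume w: "w \<in> reduced L"
    show "w \<in> (Cons a ` ?E) \<union> {w\<in>reduced L. distinct_adj (a # w)}"
      using w by (cases w) (auto simp: reduced_def distinct_adj_Cons)
  qed (auto simp: reduced_def distinct_adj_Cons)
  have "(\<Sum>w\<in>reduced L. T w (act a w)) = (\<Sum>w\<in>Cons a ` ?E. T w (act a w))
      + (\<Sum>w\<in>{w\<in>reduced L. distinct_adj (a # w)}. T w (act a w))"
    by (subst eq, rule sum.union_disjoint) (use fin in auto)
  also have "(\<Sum>w\<in>Cons a ` ?E. T w (act a w)) = (\<Sum>w\<in>?E. T (a # w) w)"
    by (subst sum.reindex) (auto simp: act_Cons_same intro!: sum.cong)
  also have "(\<Sum>w\<in>{w\<in>reduced L. distinct_adj (a # w)}. T w (act a w)) = (\<Sum>w\<in>?E. T w (act a w))"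
    by (rule sum.mono_neutral_right)
      (auto simp: reduced_def distinct_adj_Cons intro!: zero)
  also have "\<dots> = (\<Sum>w\<in>?E. T w (a # w))"
    by (intro sum.cong refl) (simp add: act_extend)
  finally show ?thesis by (simp add: sum.distrib add.commute)
qed

section \<open>The free orthogonal quantum group acts on the tree\<close>

locale flat =
  fixes e :: "'n::finite" and G :: "'n \<Rightarrow> 'n \<Rightarrow> real" and \<Phi> :: "('n, 'k::liberation_kind) quantum_algebra \<Rightarrow> 'n list linop"
  assumes sym: "G i j = G j i" and orth: "(\<Sum>k\<in>UNIV. G i k * G j k) = of_bool (i = j)"
    and flat: "G e j = 1 / sqrt (real CARD('n))"
    and hom: "algebra_hom \<Phi>"
    and \<Phi>_u: "app (\<Phi> (u_gen k j)) v w = (\<Sum>a\<in>UNIV. of_real (G k a * G j a) * v (act a w))"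

text \<open>The representation is \<open>u = o diag(g) o\<^sup>t\<close> with \<open>g a\<close> the free reflections and \<open>o\<close> an orthogonal
  matrix whose row with index \<open>e\<close> has equal entries.\<close>
lemma obtain_flat:
  fixes e :: "'n::finite"
  assumes "liberation_of TYPE('k::liberation_kind) = Free" "CARD('n) \<ge> 2"
  shows "\<exists>G (\<Phi> :: ('n, 'k) quantum_algebra \<Rightarrow> 'n list linop). flat e G \<Phi>"
proof -
  have "sqrt (real CARD('n)) \<noteq> 1" using assms(2) by simp
  then obtain G where G: "\<And>i j. G i j = (G j i :: real)"
    "\<And>i j. (\<Sum>k\<in>UNIV. G i k * G j k) = of_bool (i = j)" "\<And>j. G e j = 1 / sqrt (real CARD('n))"
    using householder[of "\<lambda>j :: 'n. 1 / sqrt (real CARD('n))" e] by (auto simp: power_divide)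
  define g :: "'n \<Rightarrow> 'n \<Rightarrow> 'n list linop" where
    "g = (\<lambda>k j. Linop (\<lambda>v w. \<Sum>a\<in>UNIV. of_real (G k a * G j a) * v (act a w)))"
  have app_g: "app (g k j) v w = (\<Sum>a\<in>UNIV. of_real (G k a * G j a) * v (act a w))" for k j v w
    unfolding g_def
    by (subst Linop_inverse) (auto simp: fun_eq_iff distrib_left sum.distrib sum_distrib_left mult.left_commute)
  have row: "(\<Sum>k\<in>UNIV. g i k * g j k) = of_bool (i = j) *\<^sub>C 1" for i j
  proof (rule linop_eqI)
    fix v w
    have "app (\<Sum>k\<in>UNIV. g i k * g j k) v w = (\<Sum>k\<in>UNIV. \<Sum>a\<in>UNIV. \<Sum>b\<in>UNIV.
        of_real (G i a * G j b * (G a k * G b k)) * v (act b (act a w)))"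
      by (simp add: app_simps app_g sum_distrib_left G(1)[of _ "_ :: 'n"] mult_ac)
    also have "\<dots> = (\<Sum>a\<in>UNIV. \<Sum>b\<in>UNIV. \<Sum>k\<in>UNIV.
        of_real (G i a * G j b * (G a k * G b k)) * v (act b (act a w)))"
      by (subst sum.swap, rule sum.cong[OF refl], rule sum.swap)
    also have "\<dots> = (\<Sum>a\<in>UNIV. \<Sum>b\<in>UNIV.
        of_real (G i a * G j b * (\<Sum>k\<in>UNIV. G a k * G b k)) * v (act b (act a w)))"
      by (simp only: sum_distrib_left sum_distrib_right of_real_sum)
    also have "\<dots> = (\<Sum>a\<in>UNIV. \<Sum>b\<in>UNIV. if a = b then of_real (G i a * G j b) * v w else 0)"
      by (intro sum.cong refl) (auto simp: G(2) act_act)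
    also have "\<dots> = of_real (\<Sum>a\<in>UNIV. G i a * G j a) * v w"
      by (simp add: sum_distrib_right)
    finally show "app (\<Sum>k\<in>UNIV. g i k * g j k) v w = app (of_bool (i = j) *\<^sub>C 1) v w"
      by (simp add: G(2) app_simps)
  qed
  have g_sym: "g i j = g j i" for i j by (simp add: g_def mult.commute)
  have column: "(\<Sum>k\<in>UNIV. g k i * g k j) = of_bool (i = j) *\<^sub>C 1" for i j
    by (simp only: g_sym[of _ i] g_sym[of _ j] row)
  have "\<exists>\<Phi> :: ('n, 'k) quantum_algebra \<Rightarrow> 'n list linop. algebra_hom \<Phi> \<and> (\<forall>i j. \<Phi> (u_gen i j) = g i j)"
    by (rule quantum_algebra_hom) (use assms(1) in \<open>simp_all add: row column\<close>)
  then obtain \<Phi> :: "('n, 'k) quantum_algebra \<Rightarrow> 'n list linop"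
    where \<Phi>: "algebra_hom \<Phi>" "\<And>i j. \<Phi> (u_gen i j) = g i j" by blast
  have "flat e G \<Phi>" by unfold_locales (simp_all add: G(2,3) \<Phi> app_g, rule G(1))
  then show ?thesis by blast
qed

context flat
begin

definition y :: "'n \<Rightarrow> ('n, 'k) quantum_algebra" where "y a = (\<Sum>k\<in>UNIV. of_real (G k a) *\<^sub>C u_gen e k)"

lemma orth_complex: "(\<Sum>k\<in>UNIV. complex_of_real (G k a) * complex_of_real (G k b)) = of_bool (a = b)"
  using arg_cong[OF orth[of a b], of complex_of_real] by (simp add: sym[of _ a] sym[of _ b])

lemma \<Phi>_y: "app (\<Phi> (y a)) v w = of_real (1 / sqrt (real CARD('n))) * v (act a w)"
proof -
  have "app (\<Phi> (y a)) v w
      = (\<Sum>k\<in>UNIV. \<Sum>b\<in>UNIV. of_real (G k a) * of_real (G k b) * (of_real (G e b) * v (act b w)))"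
    by (simp add: y_def algebra_homD[OF hom] app_simps \<Phi>_u sum_distrib_left mult_ac)
  also have "\<dots> = (\<Sum>b\<in>UNIV. (\<Sum>k\<in>UNIV. complex_of_real (G k a) * of_real (G k b)) * (of_real (G e b) * v (act b w)))"
    by (subst sum.swap) (simp only: sum_distrib_right)
  also have "\<dots> = (\<Sum>b\<in>UNIV. if b = a then of_real (G e b) * v (act b w) else 0)"
    unfolding orth_complex by (intro sum.cong refl) auto
  finally show ?thesis by (simp add: flat)
qed

lemma y_squares: "(\<Sum>a\<in>UNIV. y a * y a) = 1"
proof -
  have "(\<Sum>a\<in>UNIV. y a * y a) = (\<Sum>a\<in>UNIV. \<Sum>k\<in>UNIV. \<Sum>l\<in>UNIV.
      of_real (G k a * G l a) *\<^sub>C (u_gen e k * u_gen e l))"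
    by (simp add: y_def sum_product mult_scaleC_left mult_scaleC_right scaleC_scaleC mult.commute)
  also have "\<dots> = (\<Sum>k\<in>UNIV. \<Sum>l\<in>UNIV. \<Sum>a\<in>UNIV.
      of_real (G k a * G l a) *\<^sub>C (u_gen e k * u_gen e l))"
    by (subst sum.swap, rule sum.cong[OF refl], rule sum.swap)
  also have "\<dots> = (\<Sum>k\<in>UNIV. \<Sum>l\<in>UNIV. of_real (\<Sum>a\<in>UNIV. G k a * G l a) *\<^sub>C (u_gen e k * u_gen e l))"
    by (simp only: cvec.scale_sum_left of_real_sum)
  also have "\<dots> = (\<Sum>k\<in>UNIV. \<Sum>l\<in>UNIV. if k = l then u_gen e k * u_gen e l else 0)"
    by (intro sum.cong refl) (simp add: orth scaleC_one)
  also have "\<dots> = 1" by (simp add: u_gen_row scaleC_one)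
  finally show ?thesis .
qed

lemma qstar_y: "qstar (y a) = y a"
  by (simp add: y_def qstar_sum qstar_scale)

definition F :: "nat \<Rightarrow> 'n list \<Rightarrow> ('n, 'k) quantum_algebra" where
  "F n = spread e \<Phi> (\<lambda>w. of_bool (w = [])) (replicate n e)"

text \<open>The image of \<open>u e e\<close> in the sphere algebra tensored with the operators on the tree.\<close>
definition X :: "('n list \<Rightarrow> ('n, 'k) quantum_algebra) \<Rightarrow> 'n list \<Rightarrow> ('n, 'k) quantum_algebra" where
  "X f w = (\<Sum>a\<in>UNIV. of_real (1 / sqrt (real CARD('n))) *\<^sub>C (y a * f (act a w)))"

lemma F_0: "F 0 w = (if w = [] then 1 else 0)"
  by (simp add: F_def spread_Nil[OF hom] scaleC_one)

lemma F_Suc: "F (Suc n) = X (F n)"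
proof
  fix w
  have "F (Suc n) w = (\<Sum>k\<in>UNIV. \<Sum>a\<in>UNIV. of_real (G k a * G e a) *\<^sub>C (u_gen e k * F n (act a w)))"
    unfolding F_def replicate_Suc by (rule spread_Cons[OF hom]) (rule \<Phi>_u)
  also have "\<dots> = X (F n) w"
    by (subst sum.swap) (simp add: X_def y_def sum_distrib_right mult_scaleC_left cvec.scale_sum_right scaleC_scaleC flat mult.commute)
  finally show "F (Suc n) w = X (F n) w" .
qed

lemma F_support: "n < length w \<Longrightarrow> F n w = 0"
proof (induction n arbitrary: w)
  case 0
  then show ?case by (auto simp: F_0)
next
  case (Suc n)
  have "F n (act a w) = 0" for a using Suc length_act[of w a] by (intro Suc.IH) linarith
  then show ?case by (simp add: F_Suc X_def)
qed

end

text \<open>The logarithmic derivative at 1 is the sum of \<open>1 / (1 - x)\<close> over the roots \<open>x\<close>.\<close>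
lemma log_derivative_bound:
  fixes p :: "complex poly"
  assumes "degree p = n" "p \<noteq> 0" "\<rho> < 1"
    and roots: "\<And>z. poly p z = 0 \<Longrightarrow> \<exists>x\<le>\<rho>. z = of_real x"
  shows "\<exists>x. poly (pderiv p) 1 = poly p 1 * of_real x \<and> (0 < n \<longrightarrow> 0 < x) \<and> 0 \<le> x \<and> x \<le> real n / (1 - \<rho>)"
  using assms
proof (induction n arbitrary: p)
  case 0
  then have "pderiv p = 0" by (simp add: pderiv_eq_0_iff)
  then show ?case by (intro exI[of _ 0]) simp
next
  case (Suc n)
  have "\<not> constant (poly p)" using Suc.prems(1) by (simp add: constant_degree)
  then obtain z where z: "poly p z = 0" using fundamental_theorem_of_algebra by blast
  then obtain x where x: "x \<le> \<rho>" "z = of_real x" using Suc.prems(4) by blast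
  obtain g where g: "p = [:- z, 1:] * g" using z by (auto simp: poly_eq_0_iff_dvd)
  have "g \<noteq> 0" using Suc.prems(2) g by auto
  then have "degree p = Suc (degree g)" unfolding g by (subst degree_mult_eq) auto
  then have "degree g = n" using Suc.prems(1) by simp
  moreover have "\<exists>x\<le>\<rho>. z = of_real x" if "poly g z = 0" for z
    using Suc.prems(4)[of z] that by (simp add: g)
  ultimately obtain t where t: "poly (pderiv g) 1 = poly g 1 * of_real t" "0 \<le> t" "t \<le> real n / (1 - \<rho>)"
    using Suc.IH[of g] \<open>g \<noteq> 0\<close> \<open>\<rho> < 1\<close> by blast
  have x1: "1 - x > 0" "1 / (1 - x) \<le> 1 / (1 - \<rho>)" using x Suc.prems(3) by (auto intro: divide_left_mono)
  have nz: "1 - z \<noteq> 0" using x1(1) x(2) by (metis of_real_1 of_real_diff of_real_eq_0_iff less_irrefl)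
  have "poly (pderiv p) 1 = (1 - z) * poly (pderiv g) 1 + poly g 1"
    unfolding g pderiv_mult poly_add poly_mult by (simp add: pderiv_pCons)
  also have "\<dots> = poly p 1 * of_real (t + 1 / (1 - x))"
    using nz by (simp add: g t(1) x(2) field_simps)
  finally have "poly (pderiv p) 1 = poly p 1 * of_real (t + 1 / (1 - x))" .
  moreover have "0 < t + 1 / (1 - x)" using t(2) x1(1) by (simp add: add_nonneg_pos)
  moreover have "t + 1 / (1 - x) \<le> real (Suc n) / (1 - \<rho>)" using t(3) x1(2) by (simp add: add_divide_distrib)
  ultimately show ?case by (intro exI[of _ "t + 1 / (1 - x)"]) simp
qed

section \<open>The spectral gap of the free spheres\<close>

locale tree = flat e G \<Phi> + haar h
  for e :: "'n::finite" and G and \<Phi> :: "('n, 'k::liberation_kind) quantum_algebra \<Rightarrow> 'n list linop"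
    and h :: "('n, 'k) quantum_algebra \<Rightarrow> complex" +
  assumes card: "CARD('n) \<ge> 2"
begin

definition sq :: "('n, 'k) quantum_algebra \<Rightarrow> real" where "sq b = Re (h (qstar b * b))"

definition pairing where "pairing L f g = (\<Sum>w\<in>reduced L. h (qstar (f w) * g w))"

definition N :: real where "N = real CARD('n)"

definition \<rho> :: real where "\<rho> = 1 / 2 + 2 * (N - 1) / N\<^sup>2"

lemma N_ge_2: "2 \<le> N"
  using card by (simp add: N_def)

lemma sq_nonneg: "0 \<le> sq b"
  unfolding sq_def using ip.ip_self by blast

lemma sq_zero [simp]: "sq 0 = 0"
  by (simp add: sq_def h_zero)

lemma young:
  assumes "0 < s"
  shows "2 * c * Re (h (qstar p * r)) \<le> s * sq p + c\<^sup>2 / s * sq r"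
proof -
  let ?b = "of_real s *\<^sub>C p - of_real c *\<^sub>C r"
  have comm: "h (qstar r * p) = cnj (h (qstar p * r))" by (rule ip.ip_commute)
  have "?b = of_real s *\<^sub>C p + of_real (- c) *\<^sub>C r" by simp
  then have "h (qstar ?b * ?b) = of_real (s * s) * h (qstar p * p) - of_real (s * c) * h (qstar p * r)
      - of_real (s * c) * cnj (h (qstar p * r)) + of_real (c * c) * h (qstar r * r)"
    by (simp only: ip.ip_add_left ip.ip_add_right ip.ip_scale_left ip.ip_scale_right comm) (simp add: algebra_simps)
  then have "sq ?b = s * s * sq p - 2 * s * c * Re (h (qstar p * r)) + c * c * sq r"
    by (simp add: sq_def)
  then have "0 \<le> s * (s * sq p - 2 * c * Re (h (qstar p * r)) + c\<^sup>2 / s * sq r)"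
    using sq_nonneg[of ?b] assms by (simp add: algebra_simps power2_eq_square)
  then show ?thesis using assms by (simp add: zero_le_mult_iff)
qed

lemma h_y_adjoint: "h (qstar (y a * p) * r) = h (qstar p * (y a * r))"
  by (simp add: qstar_mult qstar_y mult.assoc)

lemma sum_sq_y: "(\<Sum>a\<in>UNIV. sq (y a * b)) = sq b"
proof -
  have "(\<Sum>a\<in>UNIV. h (qstar (y a * b) * (y a * b))) = h (qstar b * ((\<Sum>a\<in>UNIV. y a * y a) * b))"
    by (simp only: h_y_adjoint) (simp add: sum_distrib_left sum_distrib_right h_sum mult.assoc)
  then have "Re (\<Sum>a\<in>UNIV. h (qstar (y a * b) * (y a * b))) = sq b"
    by (simp add: y_squares sq_def)
  then show ?thesis by (simp add: sq_def)
qed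

lemma pairing_X_right:
  "pairing L f (X g) = (\<Sum>a\<in>UNIV. \<Sum>w\<in>reduced L. of_real (1 / sqrt N) * h (qstar (f w) * (y a * g (act a w))))"
  unfolding pairing_def X_def ip.ip_sum_right N_def
  by (subst sum.swap) (simp add: mult_scaleC_right h_scale)

lemma pairing_X_left:
  "pairing L (X f) g = (\<Sum>a\<in>UNIV. \<Sum>w\<in>reduced L. of_real (1 / sqrt N) * h (qstar (f (act a w)) * (y a * g w)))"
  unfolding pairing_def X_def ip.ip_sum_left N_def
  by (subst sum.swap) (simp add: qstar_scale mult_scaleC_left h_scale h_y_adjoint)

lemma X_symmetric:
  assumes f: "\<And>w. length w = L \<Longrightarrow> f w = 0" and g: "\<And>w. length w = L \<Longrightarrow> g w = 0"
  shows "pairing L (X f) g = pairing L f (X g)"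
  unfolding pairing_X_left pairing_X_right
proof (rule sum.cong[OF refl])
  fix a
  let ?T = "\<lambda>w w'. of_real (1 / sqrt N) * h (qstar (f w') * (y a * g w))"
  let ?T' = "\<lambda>w w'. of_real (1 / sqrt N) * h (qstar (f w) * (y a * g w'))"
  have "(\<Sum>w\<in>reduced L. ?T w (act a w)) = (\<Sum>w\<in>reduced L. ?T' w (act a w))"
    by (subst (1 2) sum_edges) (simp_all add: f g h_zero add.commute)
  then show "(\<Sum>w\<in>reduced L. of_real (1 / sqrt N) * h (qstar (f (act a w)) * (y a * g w)))
      = (\<Sum>w\<in>reduced L. of_real (1 / sqrt N) * h (qstar (f w) * (y a * g (act a w))))" .
qed

text \<open>Cauchy-Schwarz on an edge: the share \<open>(N - 1) / N\<close> of the inner product puts \<open>y\<close> on the vector at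
  the parent, the share \<open>1 / N\<close> puts it on the vector at the child. The constants are such
  that the two terms with \<open>y\<close> have the same coefficient; summed over all edges at a vertex they are
  then controlled by the relation that the squares of the \<open>y a\<close> add up to 1.\<close>
lemma edge_estimate:
  "2 / sqrt N * Re (h (qstar p * (y a * r)))
    \<le> (N - 1) / (2 * N) * sq p + 2 * (N - 1) / N\<^sup>2 * sq (y a * p)
      + 2 * (N - 1) / N\<^sup>2 * sq (y a * r) + 1 / (2 * N * (N - 1)) * sq r"
proof -
  have N: "N > 1" "N \<noteq> 0" "N - 1 \<noteq> 0" "sqrt N > 0" "(sqrt N)\<^sup>2 = N" using N_ge_2 by auto
  define c where "c = (N - 1) / N / sqrt N"
  define d where "d = 1 / N / sqrt N"
  have "c\<^sup>2 / ((N - 1) / (2 * N)) = 2 * (N - 1) / N\<^sup>2"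
    using N by (simp add: c_def power_divide) (simp add: field_simps power2_eq_square)
  moreover have "0 < (N - 1) / (2 * N)" using N by simp
  ultimately have 1: "2 * c * Re (h (qstar p * (y a * r))) \<le> (N - 1) / (2 * N) * sq p + 2 * (N - 1) / N\<^sup>2 * sq (y a * r)"
    using young[of "(N - 1) / (2 * N)" c p "y a * r"] by (simp only:)
  have "d\<^sup>2 / (2 * (N - 1) / N\<^sup>2) = 1 / (2 * N * (N - 1))"
    using N by (simp add: d_def power_divide) (simp add: field_simps power2_eq_square)
  moreover have "0 < 2 * (N - 1) / N\<^sup>2" using N by simp
  ultimately have 2: "2 * d * Re (h (qstar p * (y a * r))) \<le> 2 * (N - 1) / N\<^sup>2 * sq (y a * p) + 1 / (2 * N * (N - 1)) * sq r"
    using young[of "2 * (N - 1) / N\<^sup>2" d "y a * p" r] by (simp only: h_y_adjoint)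
  have "c + d = 1 / sqrt N" using N by (simp add: c_def d_def field_simps)
  then have "2 / sqrt N * Re (h (qstar p * (y a * r)))
      = 2 * c * Re (h (qstar p * (y a * r))) + 2 * d * Re (h (qstar p * (y a * r)))"
    by (metis distrib_left distrib_right mult.assoc times_divide_eq_right mult_1_right)
  with 1 2 show ?thesis by linarith
qed

text \<open>With \<open>t = \<parallel>y\<^sub>b f\<parallel>\<^sup>2\<close> at a vertex whose first letter is \<open>b\<close>, the edge to its parent contributes \<open>t\<close> and
  the edges to its children contribute \<open>\<parallel>f\<parallel>\<^sup>2 - t\<close>, both with the same coefficient. What remains is a total
  weight of at most \<open>1 / 2\<close> per vertex.\<close>
lemma gap:
  assumes f: "\<And>w. length w = L \<Longrightarrow> f w = 0"
  shows "Re (pairing L f (X f)) \<le> \<rho> * (\<Sum>w\<in>reduced L. sq (f w))"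
proof -
  define s P R where "s = (N - 1) / (2 * N)" and "P = 2 * (N - 1) / N\<^sup>2" and "R = 1 / (2 * N * (N - 1))"
  define T where "T = (\<lambda>a w w'. 1 / sqrt N * Re (h (qstar (f w) * (y a * f w'))))"
  define c where "c = (\<lambda>(w :: 'n list) (w' :: 'n list). if length w' < length w then s else R)"
  define B where "B = (\<lambda>a w w'. P * sq (y a * f w) + c w w' * sq (f w))"
  have N: "N > 1" using N_ge_2 by simp
  have edge: "T a w (a # w) + T a (a # w) w \<le> B a w (a # w) + B a (a # w) w" for a w
  proof -
    have "h (qstar (f w) * (y a * f (a # w))) = cnj (h (qstar (y a * f (a # w)) * f w))"
      by (rule ip.ip_commute)
    then have "Re (h (qstar (f w) * (y a * f (a # w)))) = Re (h (qstar (f (a # w)) * (y a * f w)))"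
      by (simp add: h_y_adjoint)
    then have "T a w (a # w) + T a (a # w) w = 2 / sqrt N * Re (h (qstar (f (a # w)) * (y a * f w)))"
      by (simp add: T_def)
    also have "\<dots> \<le> B a w (a # w) + B a (a # w) w"
      using edge_estimate[of "f (a # w)" a "f w"] by (simp add: B_def c_def s_def P_def R_def)
    finally show ?thesis .
  qed
  have "Re (pairing L f (X f)) = (\<Sum>a\<in>UNIV. \<Sum>w\<in>reduced L. T a w (act a w))"
    by (simp add: pairing_X_right T_def)
  also have "\<dots> = (\<Sum>a\<in>UNIV. \<Sum>w\<in>{w. distinct_adj (a # w) \<and> length w < L}. T a w (a # w) + T a (a # w) w)"
    by (intro sum.cong refl sum_edges) (simp add: T_def f h_zero)
  also have "\<dots> \<le> (\<Sum>a\<in>UNIV. \<Sum>w\<in>{w. distinct_adj (a # w) \<and> length w < L}. B a w (a # w) + B a (a # w) w)"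
    by (intro sum_mono edge)
  also have "\<dots> = (\<Sum>a\<in>UNIV. \<Sum>w\<in>reduced L. B a w (act a w))"
    by (intro sum.cong refl sum_edges[symmetric]) (simp add: B_def f)
  also have "\<dots> = (\<Sum>w\<in>reduced L. \<Sum>a\<in>UNIV. B a w (act a w))"
    by (rule sum.swap)
  also have "\<dots> \<le> (\<Sum>w\<in>reduced L. \<rho> * sq (f w))"
  proof (rule sum_mono)
    fix w :: "'n list" assume "w \<in> reduced L"
    then have w: "distinct_adj w" by (simp add: reduced_def)
    have "(\<Sum>a\<in>UNIV. c w (act a w)) \<le> 1 / 2"
    proof (cases w)
      case Nil
      then have "(\<Sum>a\<in>UNIV. c w (act a w)) = N * R" by (simp add: c_def act_def N_def)
      also have "\<dots> = 1 / (2 * (N - 1))" using N by (simp add: R_def)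
      also have "\<dots> \<le> 1 / 2" using N_ge_2 by (simp add: field_simps)
      finally show ?thesis .
    next
      case (Cons b v)
      then have c: "c w (act a w) = (if a = b then s else R)" for a using w by (auto simp: c_def act_def)
      have "(\<Sum>a\<in>UNIV. c w (act a w)) = s + (\<Sum>a\<in>UNIV - {b}. c w (act a w))"
        by (subst sum.remove[of _ b]) (simp_all add: c)
      also have "\<dots> = s + (N - 1) * R"
        using card by (simp add: c N_def card_Diff_singleton of_nat_diff)
      also have "\<dots> = 1 / 2" using N by (simp add: s_def R_def field_simps)
      finally show ?thesis by simp
    qed
    then have "(\<Sum>a\<in>UNIV. c w (act a w)) * sq (f w) \<le> 1 / 2 * sq (f w)"
      by (rule mult_right_mono[OF _ sq_nonneg])
    moreover have "(\<Sum>a\<in>UNIV. B a w (act a w)) = P * sq (f w) + (\<Sum>a\<in>UNIV. c w (act a w)) * sq (f w)"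
      by (simp add: B_def sum.distrib sum_distrib_left[symmetric] sum_distrib_right[symmetric] sum_sq_y)
    ultimately show "(\<Sum>a\<in>UNIV. B a w (act a w)) \<le> \<rho> * sq (f w)"
      by (simp add: \<rho>_def P_def algebra_simps)
  qed
  finally show ?thesis by (simp add: sum_distrib_left)
qed

text \<open>As \<open>X\<close> is symmetric, \<open>\<langle>X\<^sup>m F\<^sub>0, X\<^sup>n F\<^sub>0\<rangle> = \<langle>F\<^sub>0, X\<^sup>m\<^sup>+\<^sup>n F\<^sub>0\<rangle>\<close>; the length bound keeps all supports inside the
  finite part of the tree that enters the pairing.\<close>
lemma pairing_F: "m + n < L \<Longrightarrow> pairing L (F m) (F n) = h (u_gen e e ^ (m + n))"
proof (induction m arbitrary: n)
  case 0
  have "pairing L (F 0) (F n) = (\<Sum>w\<in>(reduced L :: 'n list set). if w = [] then h (F n []) else 0)"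
    unfolding pairing_def by (intro sum.cong refl) (simp add: F_0 h_zero)
  also have "\<dots> = h (F n [])" by (simp add: reduced_def)
  also have "\<dots> = h (u_gen e e ^ n)"
    unfolding F_def h_spread[OF hom] by (simp add: prod_list_replicate)
  finally show ?case by simp
next
  case (Suc m)
  have "pairing L (X (F m)) (F n) = pairing L (F m) (X (F n))"
    by (rule X_symmetric) (use Suc.prems in \<open>auto intro: F_support\<close>)
  then show ?case using Suc.IH[of "Suc n"] Suc.prems by (simp add: F_Suc)
qed

lemma X_sum: "X (\<lambda>w. \<Sum>n\<in>A. c n *\<^sub>C f n w) w = (\<Sum>n\<in>A. c n *\<^sub>C X (f n) w)"
proof -
  have "X (\<lambda>w. \<Sum>n\<in>A. c n *\<^sub>C f n w) w = (\<Sum>a\<in>UNIV. \<Sum>n\<in>A. c n *\<^sub>C (of_real (1 / sqrt (real CARD('n))) *\<^sub>C (y a * f n (act a w))))"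
    by (simp add: X_def sum_distrib_left cvec.scale_sum_right mult_scaleC_right scaleC_scaleC mult.commute)
  also have "\<dots> = (\<Sum>n\<in>A. c n *\<^sub>C X (f n) w)"
    by (subst sum.swap) (simp add: X_def cvec.scale_sum_right)
  finally show ?thesis .
qed

lemma pairing_sums:
  "pairing L (\<lambda>w. \<Sum>i\<in>A. c i *\<^sub>C f i w) (\<lambda>w. \<Sum>j\<in>B. d j *\<^sub>C g j w)
    = (\<Sum>j\<in>B. \<Sum>i\<in>A. d j * (cnj (c i) * pairing L (f i) (g j)))"
proof -
  have "pairing L (\<lambda>w. \<Sum>i\<in>A. c i *\<^sub>C f i w) (\<lambda>w. \<Sum>j\<in>B. d j *\<^sub>C g j w)
      = (\<Sum>w\<in>reduced L. \<Sum>j\<in>B. \<Sum>i\<in>A. d j * (cnj (c i) * h (qstar (f i w) * g j w)))"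
    unfolding pairing_def ip.ip_sum_left ip.ip_sum_right
    by (simp only: ip.ip_scale_left ip.ip_scale_right)
  also have "\<dots> = (\<Sum>j\<in>B. \<Sum>i\<in>A. \<Sum>w\<in>reduced L. d j * (cnj (c i) * h (qstar (f i w) * g j w)))"
    by (subst sum.swap, rule sum.cong[OF refl], rule sum.swap)
  finally show ?thesis by (simp add: pairing_def sum_distrib_left)
qed

text \<open>The gap in terms of the distribution of \<open>u e e\<close>.\<close>
lemma gap_polynomial:
  fixes g :: "complex poly"
  defines "b \<equiv> eval_poly g (u_gen e e)"
  shows "Re (h (qstar b * (u_gen e e * b))) \<le> \<rho> * Re (h (qstar b * b))"
proof -
  define n where "n = degree g"
  define L where "L = 2 * n + 2"
  define f where "f = (\<lambda>w. \<Sum>i\<le>n. coeff g i *\<^sub>C F i w)"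
  have f: "f w = 0" if "length w = L" for w
    unfolding f_def by (rule sum.neutral) (use that in \<open>simp add: F_support L_def\<close>)
  have b: "b = (\<Sum>i\<le>n. coeff g i *\<^sub>C u_gen e e ^ i)" by (simp add: b_def eval_poly_def n_def)
  have star: "qstar (u_gen e e ^ i) = (u_gen e e ^ i :: ('n, 'k) quantum_algebra)" for i
    by (induction i) (simp_all add: qstar_mult power_commutes)
  have ip: "h (qstar b * (\<Sum>j\<le>n. coeff g j *\<^sub>C u_gen e e ^ (j + k)))
      = (\<Sum>j\<le>n. \<Sum>i\<le>n. coeff g j * (cnj (coeff g i) * h (u_gen e e ^ (i + (j + k)))))" for k
    unfolding b ip.ip_sum_left ip.ip_sum_right
    by (simp only: ip.ip_scale_left ip.ip_scale_right star power_add[symmetric])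
  have Xf: "X f = (\<lambda>w. \<Sum>j\<le>n. coeff g j *\<^sub>C F (Suc j) w)"
    unfolding f_def by (rule ext) (simp add: X_sum F_Suc)
  have "pairing L f f = (\<Sum>j\<le>n. \<Sum>i\<le>n. coeff g j * (cnj (coeff g i) * h (u_gen e e ^ (i + j))))"
    unfolding f_def pairing_sums by (intro sum.cong refl) (simp add: pairing_F L_def)
  then have 1: "h (qstar b * b) = pairing L f f" using ip[of 0] by (simp add: b[symmetric])
  have "pairing L f (X f) = (\<Sum>j\<le>n. \<Sum>i\<le>n. coeff g j * (cnj (coeff g i) * h (u_gen e e ^ (i + Suc j))))"
    unfolding Xf unfolding f_def pairing_sums by (intro sum.cong refl) (simp add: pairing_F L_def del: power_Suc)
  moreover have "u_gen e e * b = (\<Sum>j\<le>n. coeff g j *\<^sub>C u_gen e e ^ (j + 1))"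
    by (simp add: b sum_distrib_left mult_scaleC_right)
  ultimately have 2: "h (qstar b * (u_gen e e * b)) = pairing L f (X f)" using ip[of 1] by simp
  have "Re (pairing L f f) = (\<Sum>w\<in>reduced L. sq (f w))" by (simp add: pairing_def sq_def)
  then show ?thesis using gap[OF f] by (simp add: 1 2)
qed

lemma sphere_H_mult: "b \<in> sphere_H e n \<Longrightarrow> y a * b \<in> sphere_H e (Suc n)"
proof -
  assume b: "b \<in> sphere_H e n"
  have "u_gen e k * b \<in> sphere_H e (Suc n)" for k
    using b unfolding sphere_H_eq[of e n]
  proof (induction rule: cvec.span_induct_alt)
    case base
    show ?case using cvec.subspace_0[OF subspace_sphere_H] by simp
  next
    case (step c x z)
    then obtain J where "x = row_word e J" "length J \<le> n" by auto
    then have x: "u_gen e k * x \<in> sphere_H e (Suc n)" using row_word_in_H[of "k # J" "Suc n" e] by simp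
    show ?case
      unfolding distrib_left mult_scaleC_right
      by (rule cvec.subspace_add[OF subspace_sphere_H cvec.subspace_scale[OF subspace_sphere_H x]]) (use step in simp)
  qed
  then show ?thesis
    unfolding y_def sum_distrib_right mult_scaleC_left
    by (intro cvec.subspace_sum cvec.subspace_scale subspace_sphere_H)
qed

lemma y_word_in_H: "prod_list (map y w) \<in> sphere_H e (length w)"
  by (induction w) (use row_word_in_H[of "[]" 0 e] in \<open>simp_all add: sphere_H_mult\<close>)

text \<open>Each letter shortens a word by at most one.\<close>
lemma fold_act_Nil:
  fixes w w' :: "'n list"
  shows "distinct_adj w' \<Longrightarrow> length w' = length w \<Longrightarrow> fold act w w' = [] \<longleftrightarrow> w = w'"
proof (induction w arbitrary: w')
  case (Cons a w)
  obtain b v where w': "w' = b # v" using Cons.prems by (cases w') auto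
  show ?case
  proof (cases "a = b")
    case True
    then have "act a w' = v" using Cons.prems by (simp add: w' act_Cons_same)
    moreover have "distinct_adj v" using Cons.prems by (cases v) (auto simp: w' distinct_adj_Cons)
    ultimately show ?thesis using Cons.IH[of v] Cons.prems True by (simp add: w')
  next
    case False
    have len: "length u \<le> length w + length (fold act w u)" for w u :: "'n list"
    proof (induction w arbitrary: u)
      case (Cons a w)
      show ?case using Cons.IH[of "act a u"] length_act[of u a] by simp
    qed simp
    have "act a w' = a # w'" using False Cons.prems by (simp add: act_def w')
    then have "fold act w (act a w') \<noteq> []" using len[of "act a w'" w] Cons.prems by auto
    then show ?thesis using False by (simp add: w')
  qed
qed simp

lemma free_dim_lower:
  assumes "CARD('n) \<ge> 3"
  shows "2 ^ k \<le> cdim (sphere_H e (2 * k) :: ('n, 'k) quantum_algebra set)"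
proof -
  obtain f where f: "f \<noteq> e"
    using assms card_le_Suc0_iff_eq[of "UNIV :: 'n set"] by (metis One_nat_def UNIV_I card finite not_less_eq_eq numeral_2_eq_2)
  have "card (UNIV - {e, f}) = CARD('n) - 2" using f by (subst card_Diff_subset) auto
  then have "UNIV - {e, f} \<noteq> {}" using assms by (metis card.empty diff_is_0_eq not_less_eq_eq numeral_2_eq_2 numeral_3_eq_3)
  then obtain g where g: "g \<noteq> e" "g \<noteq> f" by blast
  define W where "W = (\<lambda>bs. concat (map (\<lambda>b. [e, if b then f else g]) bs))"
  have W: "distinct_adj (W bs)" "length (W bs) = 2 * length bs" "W bs \<noteq> [] \<Longrightarrow> hd (W bs) = e" for bs
    by (induction bs) (use f g in \<open>auto simp: W_def distinct_adj_Cons\<close>)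
  have inj: "inj_on W {bs. length bs = k}"
  proof (rule inj_onI)
    fix bs cs assume "bs \<in> {bs. length bs = k}" "cs \<in> {bs. length bs = k}" and eq: "W bs = W cs"
    then have "length bs = length cs" by simp
    then show "bs = cs" using eq by (induction bs cs rule: list_induct2) (use g in \<open>auto simp: W_def split: if_splits\<close>)
  qed
  let ?P = "W ` {bs. length bs = k}"
  have fin: "finite {bs :: bool list. length bs = k}" using finite_lists_length_eq[of "UNIV :: bool set" k] by simp
  have "card {bs :: bool list. length bs = k} = 2 ^ k"
    using card_lists_length_eq[of "UNIV :: bool set" k] by simp
  then have "card ?P = 2 ^ k" by (simp add: card_image[OF inj])
  moreover have "card ?P \<le> cdim (sphere_H e (2 * k) :: ('n, 'k) quantum_algebra set)"
  proof (rule cvec.card_le_dim_family[where a = "\<lambda>w. prod_list (map y w)"])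
    show "finite ?P" using fin by simp
    show "finite (row_word e ` {J. length J \<le> 2 * k} :: ('n, 'k) quantum_algebra set)" by simp
    show "sphere_H e (2 * k) \<subseteq> cspan (row_word e ` {J. length J \<le> 2 * k} :: ('n, 'k) quantum_algebra set)"
      by (simp add: sphere_H_eq)
    show "(\<lambda>w. prod_list (map y w)) ` ?P \<subseteq> sphere_H e (2 * k)"
      using y_word_in_H W(2) by (auto, metis)
    fix c w' assume zero: "(\<Sum>w\<in>?P. c w *\<^sub>C prod_list (map y w)) = 0" and w': "w' \<in> ?P"
    let ?v = "\<lambda>w :: 'n list. of_bool (w = []) :: complex"
    define z where "z = complex_of_real (1 / sqrt (real CARD('n)))"
    have word: "app (\<Phi> (prod_list (map y w))) v u = z ^ length w * v (fold act w u)" for w v u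
      by (induction w arbitrary: u) (simp_all add: algebra_homD[OF hom] app_simps \<Phi>_y z_def)
    have "\<Phi> 0 = 0" using algebra_homD(2)[OF hom, of 0 0] by simp
    then have "0 = app (\<Phi> (\<Sum>w\<in>?P. c w *\<^sub>C prod_list (map y w))) ?v w'"
      by (simp add: zero app_simps)
    also have "\<dots> = (\<Sum>w\<in>?P. c w * (z ^ length w * ?v (fold act w w')))"
      by (simp only: algebra_homD[OF hom] app_simps word)
    also have "\<dots> = (\<Sum>w\<in>?P. if w = w' then c w * z ^ length w else 0)"
    proof (rule sum.cong[OF refl])
      fix w assume "w \<in> ?P"
      then have "fold act w w' = [] \<longleftrightarrow> w = w'" using w' W by (intro fold_act_Nil) auto
      then show "c w * (z ^ length w * ?v (fold act w w')) = (if w = w' then c w * z ^ length w else 0)" by simp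
    qed
    also have "\<dots> = c w' * z ^ length w'" using w' fin by simp
    finally show "c w' = 0" by (simp add: z_def)
  qed
  ultimately show ?thesis by simp
qed

end

section \<open>The spectral dimensions\<close>

context zonal
begin

lemma sum_dims_le: "(\<Sum>s=1..S. cdim (sphere_D e h s)) \<le> cdim (sphere_H e S :: ('n, 'k) quantum_algebra set)"
  by (simp add: dim_sphere_H[of e S])

lemma summable_imp_dim_bound:
  assumes lam: "\<And>s. 1 \<le> s \<Longrightarrow> 0 < - sphere_eigenvalue q s \<and> - sphere_eigenvalue q s \<le> B * real s ^ r"
    and "0 < d" and sum: "summable (\<lambda>s. real (cdim (sphere_D e h (Suc s))) * (- sphere_eigenvalue q (Suc s)) powr (- d / 2))"
  obtains c C where "0 \<le> c" "0 \<le> C"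
    "\<And>S. 1 \<le> S \<Longrightarrow> real (cdim (sphere_H e S :: ('n, 'k) quantum_algebra set)) \<le> c + C * real S powr (real r * d / 2)"
proof -
  obtain C where C: "0 \<le> C" "\<forall>S\<ge>1. real (\<Sum>s=1..S. cdim (sphere_D e h s)) \<le> C * real S powr (real r * d / 2)"
    using summable_imp_growth_bound[OF lam assms(2) sum] by blast
  show ?thesis
  proof (rule that[of "real (cdim (sphere_H e 0 :: ('n, 'k) quantum_algebra set))" C])
    fix S :: nat assume "1 \<le> S"
    then show "real (cdim (sphere_H e S :: ('n, 'k) quantum_algebra set))
        \<le> real (cdim (sphere_H e 0 :: ('n, 'k) quantum_algebra set)) + C * real S powr (real r * d / 2)"
      using C(2) dim_sphere_H[of e S] by simp
  qed (use C in simp_all)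
qed

lemma polynomial_dimension:
  assumes A: "0 < A" and lam: "\<And>s. 1 \<le> s \<Longrightarrow> A * real s ^ 2 \<le> - sphere_eigenvalue q s"
    "\<And>s. 1 \<le> s \<Longrightarrow> - sphere_eigenvalue q s \<le> B * real s ^ 2"
    and lower: "\<And>k. k ^ a \<le> cdim (sphere_H e (b * k) :: ('n, 'k) quantum_algebra set)" and b: "1 \<le> b"
    and upper: "\<And>S. cdim (sphere_H e S :: ('n, 'k) quantum_algebra set) \<le> C * (S + 1) ^ a"
  shows "sphere_dimension e h q = ereal (real a)"
  unfolding sphere_dimension_def
proof (rule spectral_dimension_eqI)
  fix d :: real assume d: "0 < d"
    and sum: "summable (\<lambda>s. real (cdim (sphere_D e h (Suc s))) * (- sphere_eigenvalue q (Suc s)) powr (- d / 2))"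
  have "0 < - sphere_eigenvalue q s \<and> - sphere_eigenvalue q s \<le> B * real s ^ 2" if s: "1 \<le> s" for s
  proof -
    have "0 < A * real s ^ 2" using A s by simp
    also have "\<dots> \<le> - sphere_eigenvalue q s" by (rule lam(1)[OF s])
    finally show ?thesis using lam(2)[OF s] by simp
  qed
  then obtain c K where cK: "0 \<le> c" "0 \<le> K"
    "\<And>S. 1 \<le> S \<Longrightarrow> real (cdim (sphere_H e S :: ('n, 'k) quantum_algebra set)) \<le> c + K * real S powr (real 2 * d / 2)"
    using summable_imp_dim_bound[OF _ d sum, where B = B and r = 2] by blast
  show "real a \<le> d"
  proof (rule power_le_powr_imp_le)
    fix k :: nat assume k: "1 \<le> k"
    have "real k ^ a \<le> real (cdim (sphere_H e (b * k) :: ('n, 'k) quantum_algebra set))"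
      using lower[of k] by (metis of_nat_le_iff of_nat_power)
    also have "\<dots> \<le> c + K * real (b * k) powr d"
      using cK(3)[of "b * k"] k b by simp
    also have "\<dots> = c + (K * real b powr d) * real k powr d"
      by (simp add: powr_mult)
    finally show "real k ^ a \<le> c + (K * real b powr d) * real k powr d" .
  qed (use cK d in auto)
next
  fix d :: real assume "real a < d"
  moreover have "real (\<Sum>s=1..S. cdim (sphere_D e h s)) \<le> real C * (real S + 1) ^ a" for S
  proof -
    have "(\<Sum>s=1..S. cdim (sphere_D e h s)) \<le> C * (S + 1) ^ a"
      using sum_dims_le[of S] upper[of S] by linarith
    then have "real (\<Sum>s=1..S. cdim (sphere_D e h s)) \<le> real (C * (S + 1) ^ a)" by (rule of_nat_mono)
    then show ?thesis by (simp add: add.commute)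
  qed
  ultimately show "summable (\<lambda>s. real (cdim (sphere_D e h (Suc s))) * (- sphere_eigenvalue q (Suc s)) powr (- d / 2))"
    by (intro growth_bound_imp_summable[OF lam(1) A])
qed simp

lemma classical_dimension:
  assumes classical: "liberation_of TYPE('k) = Classical"
  shows "sphere_dimension e h q = ereal (real (CARD('n) - 1))"
proof -
  define K where "K = real (CARD('n) - 1)"
  have K: "1 \<le> K" using card by (simp add: K_def)
  have eig: "- sphere_eigenvalue q s = (real s * (real s - 1) + K * real s) / K" for s
    using classical_eigenvalue[OF classical, of s] K unfolding K_def[symmetric] by (simp add: field_simps)
  show ?thesis
  proof (rule polynomial_dimension)
    show "0 < 1 / K" using K by simp
    fix s :: nat assume s: "1 \<le> s"
    have "real s ^ 2 \<le> real s * (real s - 1) + K * real s"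
      using K mult_right_mono[of 1 K "real s"] by (simp add: power2_eq_square algebra_simps)
    then show "1 / K * real s ^ 2 \<le> - sphere_eigenvalue q s"
      using K unfolding eig by (simp add: divide_right_mono)
    have "0 \<le> (K - 1) * (real s * (real s - 1))" using K s by simp
    then have "real s * (real s - 1) + K * real s \<le> K * (1 * real s ^ 2)"
      by (simp add: power2_eq_square algebra_simps)
    then show "- sphere_eigenvalue q s \<le> 1 * real s ^ 2"
      using K unfolding eig by (simp add: divide_le_eq mult.commute)
  next
    show "k ^ (CARD('n) - 1) \<le> cdim (sphere_H e ((CARD('n) - 1) * k) :: ('n, 'k) quantum_algebra set)" for k
      by (rule classical_dim_lower[OF card])
    show "1 \<le> CARD('n) - 1" using card by simp
    show "cdim (sphere_H e S :: ('n, 'k) quantum_algebra set) \<le> 2 * (S + 1) ^ (CARD('n) - 1)" for S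
      by (rule commuting_dim_upper) (rule u_gen_commute[OF classical])
  qed
qed

lemma half_liberated_dimension:
  assumes nonclassical: "liberation_of TYPE('k) \<noteq> Classical"
    and half: "\<And>a b c. u_gen e a * u_gen e b * u_gen e c = (u_gen e c * u_gen e b * u_gen e a :: ('n, 'k) quantum_algebra)"
  shows "sphere_dimension e h q = ereal (real (2 * (CARD('n) - 1)))"
proof -
  define K where "K = 2 * real (CARD('n) - 1)"
  have K: "2 \<le> K" using card by (simp add: K_def)
  have eig: "- sphere_eigenvalue q s = ((real s)\<^sup>2 - of_bool (odd s) + K * real s) / K" for s
    using half_liberated_eigenvalue[OF nonclassical half, of s] K unfolding K_def[symmetric]
    by (simp add: field_simps)
  show ?thesis
  proof (rule polynomial_dimension)
    show "0 < 1 / K" using K by simp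
    fix s :: nat assume s: "1 \<le> s"
    have "1 * 1 \<le> K * real s" using K s by (intro mult_mono) auto
    then have "real s ^ 2 \<le> (real s)\<^sup>2 - of_bool (odd s) + K * real s"
      by (simp add: of_bool_def)
    then show "1 / K * real s ^ 2 \<le> - sphere_eigenvalue q s"
      using K unfolding eig by (simp add: divide_right_mono)
    have "1 * (real s)\<^sup>2 \<le> K * (real s)\<^sup>2" using K by (intro mult_right_mono) auto
    moreover have "K * real s \<le> K * (real s)\<^sup>2"
      using K s by (intro mult_left_mono) (auto simp: power2_eq_square)
    ultimately have "(real s)\<^sup>2 - of_bool (odd s) + K * real s \<le> K * (2 * real s ^ 2)"
      by (simp add: of_bool_def)
    then show "- sphere_eigenvalue q s \<le> 2 * real s ^ 2"
      using K unfolding eig by (simp add: divide_le_eq mult.commute)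
  next
    show "k ^ (2 * (CARD('n) - 1)) \<le> cdim (sphere_H e (4 * (CARD('n) - 1) * k) :: ('n, 'k) quantum_algebra set)" for k
      by (rule nonclassical_dim_lower[OF nonclassical])
    show "1 \<le> 4 * (CARD('n) - 1)" using card by simp
    show "cdim (sphere_H e S :: ('n, 'k) quantum_algebra set) \<le> 2 * (S + 1) ^ (2 * (CARD('n) - 1))" for S
      by (rule half_commuting_dim_upper) (rule half)
  qed
qed

lemma eval_poly_x: "eval_poly [:0, 1:] a = a"
  by (simp add: eval_poly_pCons scaleC_one)

text \<open>The root \<open>z\<close> of \<open>Q s = (x - z) g\<close> is the mean value of \<open>x\<close> with weight \<open>|g|\<^sup>2\<close>, because \<open>Q s\<close> is
  orthogonal to \<open>g\<close>.\<close>
lemma roots_below_gap: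
  assumes gap: "\<And>g. Re (mom (map_poly cnj g * ([:0, 1:] * g))) \<le> \<rho> * Re (mom (map_poly cnj g * g))"
    and root: "poly (Q s) z = 0"
  shows "\<exists>x\<le>\<rho>. z = of_real x"
proof -
  obtain g where g: "Q s = [:- z, 1:] * g" using root by (auto simp: poly_eq_0_iff_dvd)
  have "Q s \<noteq> 0" using poly_Q_1[of s] by auto
  then have g0: "g \<noteq> 0" using g by auto
  then have deg: "s = Suc (degree g)"
    using degree_Q[of s] unfolding g by (subst (asm) degree_mult_eq) auto
  define A where "A = mom (map_poly cnj g * g)"
  define B where "B = mom (map_poly cnj g * ([:0, 1:] * g))"
  have "mom (Q s * map_poly cnj g) = 0"
    by (rule mom_Q_lower) (simp add: coeff_map_poly coeff_eq_0 deg)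
  moreover have "Q s * map_poly cnj g = map_poly cnj g * ([:0, 1:] * g) - smult z (map_poly cnj g * g)"
    by (simp add: g algebra_simps)
  ultimately have BA: "B = z * A" by (simp add: A_def B_def mom_diff mom_smult)
  have A: "A \<noteq> 0" "A \<in> \<real>" "0 \<le> Re A"
    using mom_faithful[of g] g0 mom_positive[of g] by (auto simp: A_def)
  then obtain a where a: "A = of_real a" "0 < a" by (auto elim!: Reals_cases)
  have "cnj B = B"
  proof -
    let ?b = "eval_poly g (u_gen e e) :: ('n, 'k) quantum_algebra"
    have B: "B = h (qstar ?b * (u_gen e e * ?b))"
      unfolding B_def mom_def eval_poly_mult eval_poly_x qstar_eval_poly ..
    show ?thesis unfolding B h_qstar[symmetric] by (simp add: qstar_mult mult.assoc)
  qed
  then obtain b where b: "B = of_real b" by (metis Reals_cases Reals_cnj_iff)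
  have "z = of_real (b / a)" using BA a b by (simp add: field_simps)
  moreover have "b / a \<le> \<rho>" using gap[of g] a b unfolding A_def[symmetric] B_def[symmetric] by (simp add: divide_le_eq)
  ultimately show ?thesis by blast
qed

lemma free_dimension:
  assumes free: "liberation_of TYPE('k) = Free" and N: "CARD('n) \<ge> 3"
  shows "sphere_dimension e h q = \<infinity>"
proof -
  obtain G and \<Phi> :: "('n, 'k) quantum_algebra \<Rightarrow> 'n list linop" where "flat e G \<Phi>"
    using obtain_flat[OF free card, of e] by blast
  then interpret T: tree e G \<Phi> h
    using card haar_axioms by (simp add: tree_def tree_axioms_def)
  have \<rho>: "T.\<rho> < 1"
  proof -
    have "0 < (T.N - 2)\<^sup>2" using N by (simp add: T.N_def)
    then have "4 * (T.N - 1) < T.N\<^sup>2" by (simp add: power2_eq_square algebra_simps)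
    then have "2 * (T.N - 1) / T.N\<^sup>2 < 1 / 2" using T.N_ge_2 by (simp add: divide_less_eq)
    then show ?thesis unfolding T.\<rho>_def by linarith
  qed
  have gap: "Re (mom (map_poly cnj g * ([:0, 1:] * g))) \<le> T.\<rho> * Re (mom (map_poly cnj g * g))" for g
    using T.gap_polynomial[of g]
    unfolding mom_def eval_poly_mult eval_poly_x qstar_eval_poly .
  have lam: "0 < - sphere_eigenvalue q s \<and> - sphere_eigenvalue q s \<le> 1 / (1 - T.\<rho>) * real s ^ 1" if s: "1 \<le> s" for s
  proof -
    have "Q s \<noteq> 0" using poly_Q_1[of s] by auto
    moreover have "\<exists>x\<le>T.\<rho>. z = of_real x" if "poly (Q s) z = 0" for z
      by (rule roots_below_gap[OF gap that])
    ultimately obtain x where x: "poly (pderiv (Q s)) 1 = poly (Q s) 1 * of_real x" "0 < s \<longrightarrow> 0 < x" "x \<le> real s / (1 - T.\<rho>)"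
      using log_derivative_bound[OF degree_Q _ \<rho>, of s] by blast
    have "- sphere_eigenvalue q s = x"
      using x(1) unfolding pderiv_Q_1 poly_Q_1 by (metis mult_1 of_real_eq_iff)
    then show ?thesis using x s by simp
  qed
  have "\<not> summable (\<lambda>s. real (cdim (sphere_D e h (Suc s))) * (- sphere_eigenvalue q (Suc s)) powr (- d / 2))"
    if d: "0 < d" for d
  proof
    assume "summable (\<lambda>s. real (cdim (sphere_D e h (Suc s))) * (- sphere_eigenvalue q (Suc s)) powr (- d / 2))"
    from summable_imp_dim_bound[OF lam d this] obtain c C where cC: "0 \<le> c" "0 \<le> C"
      "\<And>S. 1 \<le> S \<Longrightarrow> real (cdim (sphere_H e S :: ('n, 'k) quantum_algebra set)) \<le> c + C * real S powr (real 1 * d / 2)"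
      by blast
    define r where "r = d / 2"
    have r: "r > 0" using d by (simp add: r_def)
    have bound: "2 ^ k \<le> c + C * (2 * real k) powr r" if "1 \<le> k" for k
    proof -
      have "(2::real) ^ k \<le> real (cdim (sphere_H e (2 * k) :: ('n, 'k) quantum_algebra set))"
        using T.free_dim_lower[OF N, of k] by (metis of_nat_le_iff of_nat_numeral of_nat_power)
      also have "\<dots> \<le> c + C * (2 * real k) powr r"
        using cC(3)[of "2 * k"] that by (simp add: r_def)
      finally show ?thesis .
    qed
    have "(\<lambda>k::nat. (2 * real k) powr r / 2 ^ k) \<longlonglongrightarrow> 0" using r by real_asymp
    moreover have "(\<lambda>k::nat. 1 / 2 ^ k :: real) \<longlonglongrightarrow> 0" by real_asymp
    ultimately have "(\<lambda>k::nat. c * (1 / 2 ^ k) + C * ((2 * real k) powr r / 2 ^ k)) \<longlonglongrightarrow> c * 0 + C * 0"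
      by (intro tendsto_intros)
    then have "eventually (\<lambda>k. c * (1 / 2 ^ k) + C * ((2 * real k) powr r / 2 ^ k) < 1) sequentially"
      by (rule order_tendstoD) simp
    then have "eventually (\<lambda>k. c * (1 / 2 ^ k) + C * ((2 * real k) powr r / 2 ^ k) < 1 \<and> 1 \<le> k) sequentially"
      using eventually_ge_at_top[of 1] by (rule eventually_conj)
    from eventually_happens'[OF sequentially_bot this]
    obtain k where k: "c * (1 / 2 ^ k) + C * ((2 * real k) powr r / 2 ^ k) < 1" "1 \<le> k" by blast
    then have "c + C * (2 * real k) powr r < 2 ^ k" by (simp add: field_simps)
    with bound[OF k(2)] show False by simp
  qed
  then have "{d. d > 0 \<and> summable (\<lambda>s. real (cdim (sphere_D e h (Suc s))) * (- sphere_eigenvalue q (Suc s)) powr (- d / 2))} = {}"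
    by blast
  then show ?thesis
    unfolding sphere_dimension_def spectral_dimension_def by (simp only: image_empty) (simp add: top_ereal_def)
qed

end

text \<open>With two letters the relation \<open>x\<^sup>2 + y\<^sup>2 = 1\<close> makes squares central.\<close>
lemma two_letters_half_commute:
  fixes e :: "'n::finite"
  assumes "CARD('n) = 2"
  shows "u_gen e a * u_gen e b * u_gen e c = (u_gen e c * u_gen e b * u_gen e a :: ('n, 'k::liberation_kind) quantum_algebra)"
proof (cases "a = c")
  case False
  then have "card {a, c} = CARD('n)" using assms by simp
  then have univ: "UNIV = {a, c}" by (metis card_subset_eq finite subset_UNIV)
  let ?x = "u_gen e a :: ('n, 'k) quantum_algebra" and ?z = "u_gen e c :: ('n, 'k) quantum_algebra"
  have "(\<Sum>k\<in>UNIV. u_gen e k * u_gen e k) = (1 :: ('n, 'k) quantum_algebra)" by (simp add: u_gen_row scaleC_one)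
  then have one: "?x * ?x + ?z * ?z = 1" using False unfolding univ by simp
  then have sq: "?x * ?x = 1 - ?z * ?z" "?z * ?z = 1 - ?x * ?x"
    by (simp_all add: eq_diff_eq diff_eq_eq add.commute)
  have 1: "?x * ?x * ?z = ?z * ?x * ?x"
    unfolding mult.assoc[of ?z] sq(1) by (simp add: left_diff_distrib right_diff_distrib mult.assoc)
  have 2: "?x * ?z * ?z = ?z * ?z * ?x"
    unfolding mult.assoc[of ?x] sq(2) by (simp add: left_diff_distrib right_diff_distrib mult.assoc)
  have "b = a \<or> b = c" using univ by blast
  then show ?thesis using 1 2 by auto
qed simp

lemma zonal_if_sphere_data:
  assumes "CARD('n::finite) \<ge> 2" "sphere_data (e :: 'n) h \<mu> q L"
  shows "zonal h e \<mu> q L"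
  using assms unfolding zonal_def zonal_axioms_def haar_def by (simp add: sphere_data_def)

theorem mainTheorem6:
  fixes e :: "'n::finite"
  assumes "CARD('n) \<ge> 2"
  shows
    "(\<forall>(h :: ('n, classical) quantum_algebra \<Rightarrow> complex) \<mu> q L.
        sphere_data e h \<mu> q L \<longrightarrow>
          sphere_dimension e h q = ereal (real (CARD('n) - 1))) \<and>
     (\<forall>(h :: ('n, half_liberated) quantum_algebra \<Rightarrow> complex) \<mu> q L.
        sphere_data e h \<mu> q L \<longrightarrow>
          sphere_dimension e h q = ereal (real (2 * (CARD('n) - 1)))) \<and>
     (\<forall>(h :: ('n, free_kind) quantum_algebra \<Rightarrow> complex) \<mu> q L.
        sphere_data e h \<mu> q L \<longrightarrow>
          (CARD('n) = 2 \<longrightarrow> sphere_dimension e h q = 2) \<and>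
          (CARD('n) \<ge> 3 \<longrightarrow> sphere_dimension e h q = \<infinity>))"
proof (intro conjI allI impI)
  fix h :: "('n, classical) quantum_algebra \<Rightarrow> complex" and \<mu> q L
  assume "sphere_data e h \<mu> q L"
  then interpret zonal h e \<mu> q L by (rule zonal_if_sphere_data[OF assms])
  show "sphere_dimension e h q = ereal (real (CARD('n) - 1))"
    by (rule classical_dimension) (simp add: liberation_of_classical_def)
next
  fix h :: "('n, half_liberated) quantum_algebra \<Rightarrow> complex" and \<mu> q L
  assume "sphere_data e h \<mu> q L"
  then interpret zonal h e \<mu> q L by (rule zonal_if_sphere_data[OF assms])
  have "liberation_of TYPE(half_liberated) = Half_Liberated" by (simp add: liberation_of_half_liberated_def)
  then show "sphere_dimension e h q = ereal (real (2 * (CARD('n) - 1)))"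
    by (intro half_liberated_dimension u_gen_half_commute) simp_all
next
  fix h :: "('n, free_kind) quantum_algebra \<Rightarrow> complex" and \<mu> q L
  assume "sphere_data e h \<mu> q L"
  then interpret zonal h e \<mu> q L by (rule zonal_if_sphere_data[OF assms])
  have free: "liberation_of TYPE(free_kind) = Free" by (simp add: liberation_of_free_kind_def)
  show "sphere_dimension e h q = 2" if "CARD('n) = 2"
    using half_liberated_dimension[OF _ two_letters_half_commute[OF that]] that by (simp add: free)
  show "sphere_dimension e h q = \<infinity>" if "CARD('n) \<ge> 3"
    by (rule free_dimension[OF free that])
qed

end
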